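(* Let the penalties $\widehat C_k$ be defined by $$\widehat C_k=\Bigl(8\widehat R_{\widehat{\mathcal F}_k}+20\,n^{-1}\log(nk)+2\sqrt{n^{-1}\log(nk)}\cdot\sqrt{8\widehat L(\hat f_k)+7\hat u_k}\Bigr)\wedge 1,$$ and let $\hat f$ be the corresponding penalized empirical loss minimizer. Then for every $n\ge1$ and every distribution of $(X,Y)$: (a) $\mathbb E L(\hat f)-L^*\le\inf_k\bigl(L_k^*-L^*+\mathbb E\widehat C_k\bigr)+\frac{22}{n^2}$; (b) with probability greater than $1-44/n^2$, $L(\hat f)-L^*\le\inf_k\bigl(L_k^*-L^*+2\widehat C_k\bigr)$; (c) if the data form an infinite i.i.d. sequence and all quantities are computed from the first $n$ pairs, then $$\mathbb P\Bigl[\liminf_{n\to\infty}\Bigl\{L(\hat f)-L^*\le\inf_k\bigl(L_k^*-L^*+2\widehat C_k\bigr)\Bigr\}\Bigr]=1.$$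
   Context: Let $(X,Y)$ be a random pair taking values in $\mathbb R^d\times\{0,1\}$ with arbitrary distribution, and let $\mathcal D_n=((X_1,Y_1),\dots,(X_n,Y_n))$ be $n$ i.i.d. copies of $(X,Y)$, independent of $(X,Y)$. A classifier is a measurable map $f:\mathbb R^d\to\{0,1\}$. Its loss is $L(f)=\mathbb P\{f(X)\ne Y\}$ (for a classifier chosen from the data, $L(f)=\mathbb P\{f(X)\neq Y\mid\mathcal D_n\}$), its empirical loss is $\widehat L(f)=\frac1n\sum_{i=1}^n\mathbb I\{f(X_i)\ne Y_i\}$. Let $L^*=\inf_f L(f)$, the infimum over all classifiers. Let $\mathcal F_1,\mathcal F_2,\dots$ be fixed (non-random) classes of classifiers; $\hat f_k\in\mathcal F_k$ denotes a minimizer of $\widehat L$ over $\mathcal F_k$, $L_k^*=\inf_{f\in\mathcal F_k}L(f)$, and $f_k^*\in\mathcal F_k$ is a (non-random) classifier with $L(f_k^* )=L_k^*$ (assumed to exist). The random shatter coefficient is $\mathbb S_k(X_1^n)=|\{(f(X_1),\dots,f(X_n)):f\in\mathcal F_k\}|$. Define $\hat u_k=16\,\frac{4\log\mathbb S_k(X_1^n)+9\log(nk)}{n}$ and the random subclass $\widehat{\mathcal F}_k=\{f\in\mathcal F_k:\widehat L(f)\le 16\widehat L(\hat f_k)+15\hat u_k\}$. For a (possibly data-dependent) class $\mathcal G\subseteq\mathcal F_k$, the Rademacher average is $\widehat R_{\mathcal G}=\mathbb E\bigl[\sup_{f\in\mathcal G}\frac1n\sum_{i=1}^n\sigma_i\mathbb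 I\{f(X_i)\ne Y_i\}\,\big|\,\mathcal D_n\bigr]$, where $\sigma_1,\dots,\sigma_n$ are i.i.d. uniform $\{-1,1\}$-valued variables independent of $\mathcal D_n$. $\log$ is the natural logarithm and $a\wedge b=\min(a,b)$. Given penalties $\widehat C_k$, the penalized estimator is $\hat f=\hat f_{\hat k}$ with $\hat k\in\arg\min_{k\ge1}(\widehat L(\hat f_k)+\widehat C_k)$ (assumed to exist). All quantities are assumed measurable. *)

theory Defs
  imports "HOL-Probability.Probability"
begin

text \<open>Classifiers: Borel-measurable maps into the labels. Labels {0,1} are represented by bool.\<close>
definition classifiers :: "('a::topological_space \<Rightarrow> bool) set" where
  "classifiers = borel \<rightarrow>\<^sub>M count_space UNIV"

definition loss :: "('a \<times> bool) measure \<Rightarrow> ('a \<Rightarrow> bool) \<Rightarrow> real" where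
  "loss \<mu> f = measure \<mu> {z \<in> space \<mu>. f (fst z) \<noteq> snd z}"

definition Bayes_risk :: "('a::topological_space \<times> bool) measure \<Rightarrow> real" where
  "Bayes_risk \<mu> = (INF f\<in>classifiers. loss \<mu> f)"

definition class_risk :: "('a \<times> bool) measure \<Rightarrow> ('a \<Rightarrow> bool) set \<Rightarrow> real" where
  "class_risk \<mu> G = (INF f\<in>G. loss \<mu> f)"

definition emp_loss :: "nat \<Rightarrow> (nat \<Rightarrow> 'a \<times> bool) \<Rightarrow> ('a \<Rightarrow> bool) \<Rightarrow> real" where
  "emp_loss n D f = (\<Sum>i<n. if f (fst (D i)) \<noteq> snd (D i) then 1 else 0) / real n"

definition shatter :: "('a \<Rightarrow> bool) set \<Rightarrow> nat \<Rightarrow> (nat \<Rightarrow> 'a \<times> bool) \<Rightarrow> nat" where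
  "shatter G n D = card ((\<lambda>f. map (\<lambda>i. f (fst (D i))) [0..<n]) ` G)"

definition u_hat :: "('a \<Rightarrow> bool) set \<Rightarrow> nat \<Rightarrow> nat \<Rightarrow> (nat \<Rightarrow> 'a \<times> bool) \<Rightarrow> real" where
  "u_hat G n k D = 16 * (4 * ln (real (shatter G n D)) + 9 * ln (real (n * k))) / real n"

text \<open>The random subclass F_k hat; fh is the empirical minimizer f_k hat.\<close>
definition F_hat :: "('a \<Rightarrow> bool) set \<Rightarrow> nat \<Rightarrow> nat \<Rightarrow> ('a \<Rightarrow> bool) \<Rightarrow> (nat \<Rightarrow> 'a \<times> bool) \<Rightarrow> ('a \<Rightarrow> bool) set" where
  "F_hat G n k fh D = {f \<in> G. emp_loss n D f \<le> 16 * emp_loss n D fh + 15 * u_hat G n k D}"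

text \<open>Conditional Rademacher average: expectation over uniform signs sigma in {-1,1}^n,
  written out as the finite average.\<close>
definition rademacher :: "nat \<Rightarrow> (nat \<Rightarrow> 'a \<times> bool) \<Rightarrow> ('a \<Rightarrow> bool) set \<Rightarrow> real" where
  "rademacher n D G =
     (\<Sum>\<sigma>\<in>({..<n} \<rightarrow>\<^sub>E {-1, 1::real}).
        Sup ((\<lambda>f. (\<Sum>i<n. \<sigma> i * (if f (fst (D i)) \<noteq> snd (D i) then 1 else 0)) / real n) ` G))
     / 2 ^ n"

definition penalty :: "('a \<Rightarrow> bool) set \<Rightarrow> nat \<Rightarrow> nat \<Rightarrow> ('a \<Rightarrow> bool) \<Rightarrow> (nat \<Rightarrow> 'a \<times> bool) \<Rightarrow> real" where
  "penalty G n k fh D =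
     min (8 * rademacher n D (F_hat G n k fh D) + 20 * ln (real (n * k)) / real n
          + 2 * sqrt (ln (real (n * k)) / real n) * sqrt (8 * emp_loss n D fh + 7 * u_hat G n k D)) 1"

definition C_hat :: "(nat \<Rightarrow> ('a \<Rightarrow> bool) set) \<Rightarrow> (nat \<Rightarrow> nat \<Rightarrow> (nat \<Rightarrow> 'a \<times> bool) \<Rightarrow> ('a \<Rightarrow> bool))
    \<Rightarrow> nat \<Rightarrow> nat \<Rightarrow> (nat \<Rightarrow> 'a \<times> bool) \<Rightarrow> real" where
  "C_hat F fhat n k D = penalty (F k) n k (fhat n k D) D"

end

theory Submission
  imports Defs
begin

text \<open>
  Draw a ghost sample \<open>D'\<close> and exchange the members of the pairs \<open>(D\<^sub>i, D'\<^sub>i)\<close> by independent random signs.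
  Conditionally on the \<open>2n\<close> points only finitely many error patterns matter, and four facts about
  sign vectors, each failing with probability of order \<open>1/(nk)\<^sup>2\<close>, give the bound for one class:
  Hoeffding's inequality for each pattern, with a union bound, localizes the empirical minimizer to
  the patterns with few errors on the double sample; the chain rule for entropies turns the number of
  patterns on the double sample into the number on the training half; the entropy method bounds the
  localized supremum by its mean; and that mean is a sum of nonnegative weights attached to the
  \<open>2n\<close> points, a random half of which is dominated by the Rademacher average of the training half.
  The last two facts replace Talagrand's concentration inequality. Choosing the model then costs the
  sum over \<open>k\<close> of \<open>1/(nk)\<^sup>2\<close>, and the almost sure statement is the Borel-Cantelli lemma.
\<close>

section \<open>Averages over sign vectors\<close>

definition signs :: "nat \<Rightarrow> (nat \<Rightarrow> real) set" where
  "signs n = {..<n} \<rightarrow>\<^sub>E {-1, 1}"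

definition avg :: "nat \<Rightarrow> ((nat \<Rightarrow> real) \<Rightarrow> real) \<Rightarrow> real" where
  "avg n g = (\<Sum>s\<in>signs n. g s) / 2 ^ n"

definition flip_sign :: "nat \<Rightarrow> (nat \<Rightarrow> real) \<Rightarrow> nat \<Rightarrow> real" where
  "flip_sign i s = s(i := - s i)"

lemma finite_signs [simp]: "finite (signs n)"
  by (auto simp: signs_def intro!: finite_PiE)

lemma card_signs [simp]: "card (signs n) = 2 ^ n"
  by (simp add: signs_def card_PiE numeral_2_eq_2)

lemma signs_0: "signs 0 = {\<lambda>_. undefined}"
  by (simp add: signs_def)

lemma signs_nonempty [simp]: "signs n \<noteq> {}"
  by (metis card.empty card_signs power_not_zero zero_neq_numeral)

lemma signs_cases: "s \<in> signs n \<Longrightarrow> i < n \<Longrightarrow> s i = 1 \<or> s i = -1"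
  by (auto simp: signs_def dest!: PiE_mem)

lemma flip_sign_signs [intro]: "s \<in> signs n \<Longrightarrow> i < n \<Longrightarrow> flip_sign i s \<in> signs n"
  by (auto simp: signs_def flip_sign_def PiE_iff extensional_def)

lemma flip_sign_flip_sign [simp]: "flip_sign i (flip_sign i s) = s"
  by (simp add: flip_sign_def)

lemma flip_sign_same [simp]: "flip_sign i s i = - s i"
  by (simp add: flip_sign_def)

lemma signs_Suc: "signs (Suc n) = (\<lambda>s. s(n := 1)) ` signs n \<union> (\<lambda>s. s(n := -1)) ` signs n"
proof -
  have "signs (Suc n) = (\<lambda>(y, g). g(n := y)) ` ({-1, 1} \<times> signs n)"
    by (simp add: signs_def lessThan_Suc PiE_insert_eq)
  also have "\<dots> = (\<lambda>s. s(n := 1)) ` signs n \<union> (\<lambda>s. s(n := -1)) ` signs n"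
    by force
  finally show ?thesis .
qed

lemma signs_SucI: "s \<in> signs n \<Longrightarrow> e = 1 \<or> e = -1 \<Longrightarrow> s(n := e) \<in> signs (Suc n)"
  by (auto simp: signs_Suc)

lemma inj_on_signs_upd: "inj_on (\<lambda>s. s(n := e)) (signs n)"
proof (rule inj_onI)
  fix s s' assume s: "s \<in> signs n" "s' \<in> signs n" and eq: "s(n := e) = s'(n := e)"
  have "s n = undefined" "s' n = undefined"
    using s by (auto simp: signs_def intro: PiE_arb)
  then show "s = s'"
    using eq by (metis fun_upd_triv fun_upd_upd)
qed

lemma avg_0: "avg 0 g = g (\<lambda>_. undefined)"
  by (simp add: avg_def signs_0)

lemma avg_Suc: "avg (Suc n) g = (avg n (\<lambda>s. g (s(n := 1))) + avg n (\<lambda>s. g (s(n := -1)))) / 2"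
proof -
  have disj: "(\<lambda>s. s(n := 1)) ` signs n \<inter> (\<lambda>s. s(n := -1)) ` signs n = {}"
  proof -
    have "s(n := 1) \<noteq> s'(n := -1)" for s s' :: "nat \<Rightarrow> real"
      by (metis fun_upd_same one_neq_neg_one)
    then show ?thesis by blast
  qed
  have "(\<Sum>s\<in>signs (Suc n). g s)
      = (\<Sum>s\<in>signs n. g (s(n := 1))) + (\<Sum>s\<in>signs n. g (s(n := -1)))"
    by (simp add: signs_Suc sum.union_disjoint disj sum.reindex inj_on_signs_upd)
  then show ?thesis
    by (simp add: avg_def add_divide_distrib)
qed

lemma avg_cong: "(\<And>s. s \<in> signs n \<Longrightarrow> f s = g s) \<Longrightarrow> avg n f = avg n g"
  by (simp add: avg_def)

lemma avg_mono: "(\<And>s. s \<in> signs n \<Longrightarrow> f s \<le> g s) \<Longrightarrow> avg n f \<le> avg n g"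
  by (auto simp: avg_def intro!: divide_right_mono sum_mono)

lemma avg_const [simp]: "avg n (\<lambda>_. c) = c"
  by (simp add: avg_def)

lemma avg_add: "avg n (\<lambda>s. f s + g s) = avg n f + avg n g"
  by (simp add: avg_def sum.distrib add_divide_distrib)

lemma avg_diff: "avg n (\<lambda>s. f s - g s) = avg n f - avg n g"
  by (simp add: avg_def sum_subtractf diff_divide_distrib)

lemma avg_cmult: "avg n (\<lambda>s. c * f s) = c * avg n f"
  by (simp add: avg_def sum_distrib_left)

lemma avg_sum: "avg n (\<lambda>s. \<Sum>i\<in>I. f i s) = (\<Sum>i\<in>I. avg n (f i))"
  by (induction I rule: infinite_finite_induct) (simp_all add: avg_add)

lemma avg_nonneg: "(\<And>s. s \<in> signs n \<Longrightarrow> 0 \<le> f s) \<Longrightarrow> 0 \<le> avg n f"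
  using avg_mono[of n "\<lambda>_. 0" f] by simp

lemma avg_pos:
  assumes "\<And>s. s \<in> signs n \<Longrightarrow> 0 < f s"
  shows "0 < avg n f"
  unfolding avg_def using assms by (intro divide_pos_pos sum_pos) auto

lemma avg_mult_signs:
  assumes "\<And>i. i < n \<Longrightarrow> k i = 1 \<or> k i = (-1::real)"
  shows "avg n (\<lambda>s. g (\<lambda>i\<in>{..<n}. k i * s i)) = avg n g"
proof -
  have inv: "(\<lambda>i\<in>{..<n}. k i * (\<lambda>i\<in>{..<n}. k i * s i) i) = s" if "s \<in> signs n" for s
  proof
    fix i show "(\<lambda>i\<in>{..<n}. k i * (\<lambda>i\<in>{..<n}. k i * s i) i) i = s i"
    proof (cases "i < n")
      case True then show ?thesis using assms[of i] by auto
    next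
      case False then show ?thesis using that by (auto simp: signs_def PiE_iff extensional_def)
    qed
  qed
  have mem: "(\<lambda>i\<in>{..<n}. k i * s i) \<in> signs n" if "s \<in> signs n" for s
  proof -
    have "k i * s i = -1 \<or> k i * s i = 1" if "i < n" for i
      using assms[OF that] signs_cases[OF \<open>s \<in> signs n\<close> that] by auto
    then show ?thesis by (auto simp: signs_def PiE_iff)
  qed
  have "(\<Sum>s\<in>signs n. g (\<lambda>i\<in>{..<n}. k i * s i)) = (\<Sum>s\<in>signs n. g s)"
    by (rule sum.reindex_bij_witness[where i = "\<lambda>s. \<lambda>i\<in>{..<n}. k i * s i"
          and j = "\<lambda>s. \<lambda>i\<in>{..<n}. k i * s i"])
       (use inv mem in auto)
  then show ?thesis by (simp add: avg_def)
qed

lemma avg_flip_sign: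
  assumes "i < n"
  shows "avg n (\<lambda>s. g (flip_sign i s)) = avg n g"
proof -
  have "(\<Sum>s\<in>signs n. g (flip_sign i s)) = (\<Sum>s\<in>signs n. g s)"
    by (rule sum.reindex_bij_witness[where i = "flip_sign i" and j = "flip_sign i"])
       (use assms in auto)
  then show ?thesis by (simp add: avg_def)
qed

lemma avg_prod:
  "avg n (\<lambda>s. \<Prod>i<n. \<phi> i (s i)) = (\<Prod>i<n. (\<phi> i 1 + \<phi> i (-1)) / 2)"
proof (induction n)
  case 0 show ?case by (simp add: avg_0)
next
  case (Suc n)
  have eq: "(\<Prod>i<Suc n. \<phi> i ((s(n := e)) i)) = \<phi> n e * (\<Prod>i<n. \<phi> i (s i))" for s e
    by (simp add: mult.commute)
  show ?case
    unfolding avg_Suc eq avg_cmult Suc.IH by (simp add: field_simps)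
qed

lemma avg_of_bool_le_exp:
  assumes "\<And>s. s \<in> signs n \<Longrightarrow> P s \<Longrightarrow> 0 \<le> Y s"
  shows "avg n (\<lambda>s. of_bool (P s)) \<le> avg n (\<lambda>s. exp (Y s))"
  using assms by (intro avg_mono) (auto simp: of_bool_def)

lemma log_sum_avg:
  assumes "\<And>s. s \<in> signs n \<Longrightarrow> 0 < f s" "\<And>s. s \<in> signs n \<Longrightarrow> 0 < g s"
  shows "avg n f * (ln (avg n f) - ln (avg n g)) \<le> avg n (\<lambda>s. f s * (ln (f s) - ln (g s)))"
proof -
  let ?X = "avg n f" and ?Y = "avg n g"
  have X: "?X > 0" and Y: "?Y > 0" using assms by (auto intro: avg_pos)
  have "f s * (ln ?X - ln ?Y) + f s - ?X / ?Y * g s \<le> f s * (ln (f s) - ln (g s))"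
    if s: "s \<in> signs n" for s
  proof -
    have f: "f s > 0" and g: "g s > 0" using assms s by auto
    let ?u = "g s * ?X / (f s * ?Y)"
    have "ln ?u \<le> ?u - 1" using f g X Y by (intro ln_le_minus_one) auto
    moreover have "ln ?u = ln (g s) + ln ?X - ln (f s) - ln ?Y"
      using f g X Y by (simp add: ln_mult ln_div)
    ultimately have "f s * (ln (g s) + ln ?X - ln (f s) - ln ?Y) \<le> f s * (?u - 1)"
      using f by (intro mult_left_mono) auto
    also have "\<dots> = ?X / ?Y * g s - f s"
      using f Y by (simp add: field_simps)
    finally show ?thesis by (simp add: algebra_simps)
  qed
  then have "avg n (\<lambda>s. f s * (ln ?X - ln ?Y) + f s - ?X / ?Y * g s)
      \<le> avg n (\<lambda>s. f s * (ln (f s) - ln (g s)))"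
    by (rule avg_mono)
  moreover have "avg n (\<lambda>s. f s * (ln ?X - ln ?Y) + f s - ?X / ?Y * g s)
      = ?X * (ln ?X - ln ?Y) + ?X - ?X / ?Y * ?Y"
    by (simp only: avg_add avg_diff avg_cmult mult.commute[of _ "ln ?X - ln ?Y"])
  ultimately show ?thesis using Y by simp
qed

lemma two_point_entropy:
  fixes x y :: real
  assumes "x > 0" "y > 0"
  shows "(x * ln x + y * ln y) / 2 - (x + y) / 2 * ln ((x + y) / 2) \<le> (x - y) * (ln x - ln y) / 4"
proof -
  have "sqrt x * sqrt y \<le> (x + y) / 2"
    using arith_geo_mean_sqrt[of x y] assms by (simp add: real_sqrt_mult)
  then have "ln (sqrt x * sqrt y) \<le> ln ((x + y) / 2)"
    using assms by (subst ln_le_cancel_iff) auto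
  then have "(ln x + ln y) / 2 \<le> ln ((x + y) / 2)"
    using assms by (simp add: ln_mult ln_sqrt)
  then have "(x + y) / 2 * ((ln x + ln y) / 2) \<le> (x + y) / 2 * ln ((x + y) / 2)"
    using assms by (intro mult_left_mono) auto
  then show ?thesis by (simp add: field_simps)
qed

lemma entropy_tensorization:
  assumes "\<And>s. s \<in> signs n \<Longrightarrow> 0 < g s"
  shows "avg n (\<lambda>s. g s * ln (g s)) - avg n g * ln (avg n g)
    \<le> (\<Sum>i<n. avg n (\<lambda>s. (g s - g (flip_sign i s)) * (ln (g s) - ln (g (flip_sign i s))))) / 4"
  using assms
proof (induction n arbitrary: g)
  case 0 show ?case by (simp add: avg_0)
next
  case (Suc n)
  define p where "p = (\<lambda>s. g (s(n := 1)))"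
  define m where "m = (\<lambda>s. g (s(n := -1)))"
  have p: "p s > 0" and m: "m s > 0" if "s \<in> signs n" for s
    using Suc.prems signs_SucI[OF that] by (auto simp: p_def m_def)
  define D where "D = (\<lambda>i s. (g s - g (flip_sign i s)) * (ln (g s) - ln (g (flip_sign i s))))"
  define Dp where "Dp = (\<lambda>i s. (p s - p (flip_sign i s)) * (ln (p s) - ln (p (flip_sign i s))))"
  define Dm where "Dm = (\<lambda>i s. (m s - m (flip_sign i s)) * (ln (m s) - ln (m (flip_sign i s))))"
  let ?P = "avg n p" and ?M = "avg n m"
  have PM: "?P > 0" "?M > 0" using p m by (auto intro: avg_pos)
  have IHp: "avg n (\<lambda>s. p s * ln (p s)) - ?P * ln ?P \<le> (\<Sum>i<n. avg n (Dp i)) / 4"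
    unfolding Dp_def by (rule Suc.IH) (rule p)
  have IHm: "avg n (\<lambda>s. m s * ln (m s)) - ?M * ln ?M \<le> (\<Sum>i<n. avg n (Dm i)) / 4"
    unfolding Dm_def by (rule Suc.IH) (rule m)
  have com: "flip_sign i (s(n := e)) = (flip_sign i s)(n := e)" if "i < n" for i s e
    using that by (auto simp: flip_sign_def)
  have com': "flip_sign n (s(n := e)) = s(n := - e)" for s e
    by (auto simp: flip_sign_def)
  have lo: "avg (Suc n) (D i) = (avg n (Dp i) + avg n (Dm i)) / 2" if "i < n" for i
    by (simp add: avg_Suc D_def Dp_def Dm_def p_def m_def com[OF that])
  have hi: "avg (Suc n) (D n) = avg n (\<lambda>s. (p s - m s) * (ln (p s) - ln (m s)))"
  proof -
    have "(m s - p s) * (ln (m s) - ln (p s)) = (p s - m s) * (ln (p s) - ln (m s))" for s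
      by (simp add: algebra_simps)
    then show ?thesis
      by (simp add: avg_Suc D_def com') (simp add: p_def m_def)
  qed
  have "(?P - ?M) * (ln ?P - ln ?M) = ?P * (ln ?P - ln ?M) + ?M * (ln ?M - ln ?P)"
    by (simp add: algebra_simps)
  also have "\<dots> \<le> avg n (\<lambda>s. p s * (ln (p s) - ln (m s))) + avg n (\<lambda>s. m s * (ln (m s) - ln (p s)))"
    by (intro add_mono log_sum_avg p m)
  also have "\<dots> = avg (Suc n) (D n)"
    unfolding hi avg_add[symmetric] by (rule avg_cong) (simp add: algebra_simps)
  finally have top: "(?P - ?M) * (ln ?P - ln ?M) \<le> avg (Suc n) (D n)" .
  have "avg (Suc n) (\<lambda>s. g s * ln (g s)) - avg (Suc n) g * ln (avg (Suc n) g)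
    = (avg n (\<lambda>s. p s * ln (p s)) - ?P * ln ?P + (avg n (\<lambda>s. m s * ln (m s)) - ?M * ln ?M)) / 2
      + ((?P * ln ?P + ?M * ln ?M) / 2 - (?P + ?M) / 2 * ln ((?P + ?M) / 2))"
    by (simp add: avg_Suc p_def m_def field_simps)
  also have "\<dots> \<le> ((\<Sum>i<n. avg n (Dp i)) / 4 + (\<Sum>i<n. avg n (Dm i)) / 4) / 2
      + avg (Suc n) (D n) / 4"
    using IHp IHm two_point_entropy[OF PM] top by argo
  also have "\<dots> = (\<Sum>i<Suc n. avg (Suc n) (D i)) / 4"
    by (simp add: lo flip: sum_divide_distrib) (simp add: sum.distrib field_simps)
  finally show ?case by (simp add: D_def)
qed

lemma avg_sign [simp]: "i < n \<Longrightarrow> avg n (\<lambda>s. s i) = 0"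
  using avg_flip_sign[of i n "\<lambda>s. s i"] avg_cmult[of n "-1" "\<lambda>s. s i"] by simp

lemma has_real_derivative_avg_exp:
  "((\<lambda>l. avg n (\<lambda>s. exp (l * Z s))) has_real_derivative avg n (\<lambda>s. Z s * exp (l * Z s))) (at l)"
  unfolding avg_def by (auto intro!: derivative_eq_intros simp: sum_divide_distrib mult_ac)

lemma entropy_exp_bound:
  assumes Z: "\<And>s. s \<in> signs n \<Longrightarrow> (\<Sum>i<n. (max 0 (Z s - Z (flip_sign i s)))\<^sup>2) \<le> 2 * (r + Z s)"
    and l: "l > 0"
  defines "M \<equiv> avg n (\<lambda>s. exp (l * Z s))"
    and "M' \<equiv> avg n (\<lambda>s. Z s * exp (l * Z s))"
  shows "l * M' - M * ln M \<le> l\<^sup>2 * (r * M + M')"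
proof -
  define g where "g = (\<lambda>s. exp (l * Z s))"
  define D where "D = (\<lambda>i s. (g s - g (flip_sign i s)) * (ln (g s) - ln (g (flip_sign i s))))"
  define T where "T = (\<lambda>i s. l\<^sup>2 * (max 0 (Z s - Z (flip_sign i s)))\<^sup>2 * g s)"
  have exp_diff: "(exp (l * x) - exp (l * y)) * (l * x - l * y) \<le> l\<^sup>2 * (x - y)\<^sup>2 * exp (l * x)"
    if "y \<le> x" for x y
  proof -
    have "1 + (l * y - l * x) \<le> exp (l * y - l * x)" by (rule exp_ge_add_one_self)
    then have "(1 + (l * y - l * x)) * exp (l * x) \<le> exp (l * y - l * x) * exp (l * x)"
      by (intro mult_right_mono) auto
    then have "exp (l * x) - exp (l * y) \<le> (l * x - l * y) * exp (l * x)"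
      by (simp add: exp_diff algebra_simps)
    then have "(exp (l * x) - exp (l * y)) * (l * x - l * y)
        \<le> (l * x - l * y) * exp (l * x) * (l * x - l * y)"
      using that l by (intro mult_right_mono) auto
    also have "\<dots> = l\<^sup>2 * (x - y)\<^sup>2 * exp (l * x)"
      by (simp add: power2_eq_square algebra_simps)
    finally show ?thesis .
  qed
  have "D i s \<le> T i s + T i (flip_sign i s)" for i s
  proof (cases "Z (flip_sign i s) \<le> Z s")
    case True
    then show ?thesis using exp_diff[OF True] by (simp add: D_def T_def g_def)
  next
    case False
    then show ?thesis using exp_diff[of "Z s" "Z (flip_sign i s)"]
      by (simp add: D_def T_def g_def algebra_simps)
  qed
  then have "avg n (D i) \<le> 2 * avg n (T i)" if "i < n" for i
    using avg_mono[of n "D i" "\<lambda>s. T i s + T i (flip_sign i s)"] avg_flip_sign[OF that, of "T i"]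
    by (simp add: avg_add)
  then have "(\<Sum>i<n. avg n (D i)) / 4 \<le> (\<Sum>i<n. 2 * avg n (T i)) / 4"
    by (intro divide_right_mono sum_mono) auto
  also have "\<dots> = avg n (\<lambda>s. \<Sum>i<n. T i s) / 2"
    by (simp add: avg_sum flip: sum_distrib_left)
  also have "avg n (\<lambda>s. \<Sum>i<n. T i s) \<le> avg n (\<lambda>s. l\<^sup>2 * (2 * (r + Z s)) * g s)"
  proof (rule avg_mono)
    fix s assume "s \<in> signs n"
    have "(\<Sum>i<n. T i s) = l\<^sup>2 * (\<Sum>i<n. (max 0 (Z s - Z (flip_sign i s)))\<^sup>2) * g s"
      by (simp add: T_def sum_distrib_left sum_distrib_right)
    also have "\<dots> \<le> l\<^sup>2 * (2 * (r + Z s)) * g s"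
      using Z[OF \<open>s \<in> signs n\<close>] by (intro mult_right_mono mult_left_mono) (auto simp: g_def)
    finally show "(\<Sum>i<n. T i s) \<le> l\<^sup>2 * (2 * (r + Z s)) * g s" .
  qed
  also have "avg n (\<lambda>s. l\<^sup>2 * (2 * (r + Z s)) * g s) = avg n (\<lambda>s. 2 * l\<^sup>2 * (r * g s + Z s * g s))"
    by (rule avg_cong) (simp add: algebra_simps)
  also have "\<dots> = 2 * (l\<^sup>2 * (r * M + M'))"
    by (simp add: avg_cmult avg_add M_def M'_def g_def)
  finally have "(\<Sum>i<n. avg n (D i)) / 4 \<le> l\<^sup>2 * (r * M + M')" by simp
  moreover have "avg n (\<lambda>s. g s * ln (g s)) - avg n g * ln (avg n g) \<le> (\<Sum>i<n. avg n (D i)) / 4"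
    unfolding D_def by (rule entropy_tensorization) (simp add: g_def)
  moreover have "avg n (\<lambda>s. g s * ln (g s)) = l * M'"
    unfolding M'_def avg_cmult[symmetric] by (rule avg_cong) (simp add: g_def)
  ultimately show ?thesis by (simp add: g_def M_def)
qed

lemma log_mgf_bound:
  assumes Z: "\<And>s. s \<in> signs n \<Longrightarrow> (\<Sum>i<n. (max 0 (Z s - Z (flip_sign i s)))\<^sup>2) \<le> 2 * (r + Z s)"
    and l: "l > 0"
  shows "(1 - l) * ln (avg n (\<lambda>s. exp (l * Z s))) \<le> l * avg n Z + l\<^sup>2 * r"
proof -
  define M where "M = (\<lambda>l. avg n (\<lambda>s. exp (l * Z s)))"
  define M' where "M' = (\<lambda>l. avg n (\<lambda>s. Z s * exp (l * Z s)))"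
  define u where "u = (\<lambda>l. ln (M l) / l - r * l - ln (M l))"
  have M_pos: "M l > 0" for l unfolding M_def by (rule avg_pos) simp
  have dM: "(M has_real_derivative M' l) (at l)" for l
    unfolding M_def M'_def by (rule has_real_derivative_avg_exp)
  have dlnM: "((\<lambda>l. ln (M l)) has_real_derivative M' l / M l) (at l)" for l
    using dM[of l] M_pos[of l] by (auto intro!: derivative_eq_intros)
  have du: "(u has_real_derivative (l * M' l - M l * ln (M l) - l\<^sup>2 * (r * M l + M' l)) / (l\<^sup>2 * M l)) (at l)"
    if "l > 0" for l
    unfolding u_def using that M_pos[of l]
    by (auto intro!: derivative_eq_intros dM simp: field_simps power2_eq_square)
  have mono: "u l \<le> u a" if "0 < a" "a \<le> l" for a
  proof (rule DERIV_nonpos_imp_nonincreasing[OF that(2)])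
    fix x assume "a \<le> x" "x \<le> l"
    then have x: "x > 0" using that by simp
    have "(x * M' x - M x * ln (M x) - x\<^sup>2 * (r * M x + M' x)) / (x\<^sup>2 * M x) \<le> 0"
      using entropy_exp_bound[OF Z x] M_pos[of x] x
      by (intro divide_nonpos_pos) (auto simp: M_def M'_def)
    then show "\<exists>y. DERIV u x :> y \<and> y \<le> 0" using du[OF x] by blast
  qed
  have M0: "M 0 = 1" "M' 0 = avg n Z" by (simp_all add: M_def M'_def)
  have "((\<lambda>h. (ln (M (0 + h)) - ln (M 0)) / h) \<longlongrightarrow> avg n Z) (at 0)"
    using dlnM[of 0] M0 by (simp add: DERIV_def)
  then have lim1: "((\<lambda>h. ln (M h) / h) \<longlongrightarrow> avg n Z) (at_right 0)"
    using M0 by (auto intro: filterlim_at_split[THEN iffD1, THEN conjunct2] simp: filterlim_at_split)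
  have "isCont (\<lambda>l. ln (M l)) 0" using dlnM by (rule DERIV_isCont)
  then have "((\<lambda>l. ln (M l)) \<longlongrightarrow> ln (M 0)) (at_right 0)"
    by (simp add: isCont_def filterlim_at_split)
  then have "(u \<longlongrightarrow> avg n Z - r * 0 - ln (M 0)) (at_right 0)"
    unfolding u_def by (intro tendsto_diff tendsto_mult tendsto_const tendsto_ident_at lim1)
  then have lim: "(u \<longlongrightarrow> avg n Z) (at_right 0)" by (simp add: M0)
  have "eventually (\<lambda>a. a \<in> {0<..<l}) (at_right 0)"
    using l by (rule eventually_at_right_real)
  then have "eventually (\<lambda>a. u l \<le> u a) (at_right 0)"
    by eventually_elim (auto intro: mono)
  then have "u l \<le> avg n Z"
    by (rule tendsto_lowerbound[OF lim]) simp
  then have "l * u l \<le> l * avg n Z" using l by simp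
  moreover have "l * u l = (1 - l) * ln (M l) - l\<^sup>2 * r"
    using l by (simp add: u_def algebra_simps power2_eq_square)
  ultimately show ?thesis by (simp add: M_def)
qed

section \<open>Suprema of sign processes\<close>

lemma le_exp_of_ln_le: "0 < x \<Longrightarrow> ln x \<le> y \<Longrightarrow> x \<le> exp y" for x y :: real
  by (metis exp_le_cancel_iff exp_ln)

lemma avg_sign_sum: "avg n (\<lambda>s. \<Sum>i<n. s i * c i) = 0"
  by (simp add: avg_sum mult.commute[of _ "c _"] avg_cmult)

lemma cosh_le_exp: "(exp x + exp (- x)) / 2 \<le> exp (x\<^sup>2 / 2)" for x :: real
proof -
  have *: "(exp x + exp (- x)) / 2 \<le> exp (x\<^sup>2 / 2)" if "x \<ge> 0" for x :: real
  proof -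
    have "- (2 * x) * (1/2) + ln (1 + 1/2 * (exp (2 * x) - 1)) \<le> (2 * x)\<^sup>2 / 8"
      using that by (intro Hoeffdings_lemma_aux) auto
    then have "ln ((1 + exp (2 * x)) / 2) \<le> x + x\<^sup>2 / 2"
      by (simp add: field_simps)
    then have "(1 + exp (2 * x)) / 2 \<le> exp (x + x\<^sup>2 / 2)"
      by (intro le_exp_of_ln_le) (auto intro: add_pos_pos)
    then have "(1 + exp (2 * x)) / 2 * exp (- x) \<le> exp (x + x\<^sup>2 / 2) * exp (- x)"
      by (intro mult_right_mono) auto
    moreover have "exp (x + x\<^sup>2 / 2) * exp (- x) = exp (x\<^sup>2 / 2)" "exp (2 * x) * exp (- x) = exp x"
      by (simp_all flip: exp_add)
    ultimately show ?thesis by (simp add: field_simps)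
  qed
  show ?thesis using *[of x] *[of "- x"] by (cases "x \<ge> 0") (auto simp: add.commute)
qed

lemma sign_sum_tail:
  assumes "(\<Sum>i<n. (c i)\<^sup>2) \<le> N" "\<theta> \<ge> 0"
  shows "avg n (\<lambda>s. of_bool ((\<Sum>i<n. s i * c i) > \<theta> * N + q)) \<le> exp (- 2 * \<theta> * q)"
proof -
  let ?Y = "\<lambda>s. 2 * \<theta> * ((\<Sum>i<n. s i * c i) - \<theta> * N - q)"
  have "avg n (\<lambda>s. of_bool ((\<Sum>i<n. s i * c i) > \<theta> * N + q)) \<le> avg n (\<lambda>s. exp (?Y s))"
    using assms by (intro avg_of_bool_le_exp) auto
  also have "\<dots> = avg n (\<lambda>s. exp (- 2 * \<theta>\<^sup>2 * N - 2 * \<theta> * q) * (\<Prod>i<n. exp (2 * \<theta> * (s i * c i))))"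
    by (rule avg_cong)
       (simp only: exp_sum[OF finite_lessThan, symmetric] exp_add[symmetric] sum_distrib_left[symmetric],
        simp add: algebra_simps power2_eq_square)
  also have "\<dots> = exp (- 2 * \<theta>\<^sup>2 * N - 2 * \<theta> * q) *
      (\<Prod>i<n. (exp (2 * \<theta> * (1 * c i)) + exp (2 * \<theta> * (-1 * c i))) / 2)"
    by (simp only: avg_cmult avg_prod[of n "\<lambda>i e. exp (2 * \<theta> * (e * c i))"])
  also have "\<dots> \<le> exp (- 2 * \<theta>\<^sup>2 * N - 2 * \<theta> * q) * (\<Prod>i<n. exp ((2 * \<theta> * c i)\<^sup>2 / 2))"
  proof (intro mult_left_mono prod_mono conjI)
    fix i show "(exp (2 * \<theta> * (1 * c i)) + exp (2 * \<theta> * (-1 * c i))) / 2 \<le> exp ((2 * \<theta> * c i)\<^sup>2 / 2)"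
      using cosh_le_exp[of "2 * \<theta> * c i"] by simp
  qed (auto intro: add_nonneg_nonneg)
  also have "\<dots> = exp (- 2 * \<theta>\<^sup>2 * N - 2 * \<theta> * q + 2 * \<theta>\<^sup>2 * (\<Sum>i<n. (c i)\<^sup>2))"
    by (simp add: exp_sum[symmetric] exp_add[symmetric] sum_distrib_left power_mult_distrib
        sum_divide_distrib[symmetric] algebra_simps)
  also have "\<dots> \<le> exp (- 2 * \<theta> * q)"
    using mult_left_mono[OF assms(1), of "2 * \<theta>\<^sup>2"] by simp
  finally show ?thesis .
qed

lemma chosen_weight_lower_tail:
  assumes y: "\<And>i b. i < n \<Longrightarrow> 0 \<le> y i b \<and> y i b \<le> (1::real)"
  shows "avg n (\<lambda>s. of_bool ((\<Sum>i<n. y i (s i < 0)) < (\<Sum>i<n. y i False + y i True) / 4 - x)) \<le> exp (- x)"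
proof -
  let ?S = "\<Sum>i<n. y i False + y i True"
  have e: "exp (- w) \<le> 1 - w / 2" if "0 \<le> w" "w \<le> 1" for w :: real
  proof -
    have "1 \<le> (1 + w) * (1 - w / 2)"
      using mult_nonneg_nonneg[of w "1 - w"] that by (simp add: algebra_simps)
    also have "\<dots> \<le> exp w * (1 - w / 2)"
      using that by (intro mult_right_mono) auto
    finally show ?thesis by (simp add: exp_minus field_simps)
  qed
  have "avg n (\<lambda>s. of_bool ((\<Sum>i<n. y i (s i < 0)) < ?S / 4 - x))
      \<le> avg n (\<lambda>s. exp (?S / 4 - x - (\<Sum>i<n. y i (s i < 0))))"
    by (rule avg_of_bool_le_exp) auto
  also have "\<dots> = avg n (\<lambda>s. exp (?S / 4 - x) * (\<Prod>i<n. exp (- y i (s i < 0))))"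
    by (simp add: exp_sum[symmetric] exp_add[symmetric] sum_negf)
  also have "\<dots> = exp (?S / 4 - x) * (\<Prod>i<n. (exp (- y i False) + exp (- y i True)) / 2)"
    using avg_prod[of n "\<lambda>i e. exp (- y i (e < 0))"] by (simp add: avg_cmult)
  also have "\<dots> \<le> exp (?S / 4 - x) * (\<Prod>i<n. exp (- (y i False + y i True) / 4))"
  proof (intro mult_left_mono prod_mono conjI)
    fix i assume "i \<in> {..<n}"
    then have "(exp (- y i False) + exp (- y i True)) / 2 \<le> 1 + (- (y i False + y i True) / 4)"
      using e[of "y i False"] e[of "y i True"] y[of i False] y[of i True] by (simp add: field_simps)
    also have "\<dots> \<le> exp (- (y i False + y i True) / 4)" by (rule exp_ge_add_one_self)
    finally show "(exp (- y i False) + exp (- y i True)) / 2 \<le> exp (- (y i False + y i True) / 4)" .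
  qed (auto intro: add_nonneg_nonneg)
  also have "\<dots> = exp (- x)"
    by (simp only: exp_sum[OF finite_lessThan, symmetric] exp_add[symmetric] sum_divide_distrib[symmetric] sum_negf)
       simp
  finally show ?thesis .
qed

definition sign_max :: "nat \<Rightarrow> 'v set \<Rightarrow> ('v \<Rightarrow> nat \<Rightarrow> real) \<Rightarrow> (nat \<Rightarrow> real) \<Rightarrow> real" where
  "sign_max n W c s = Max ((\<lambda>v. \<Sum>i<n. s i * c v i) ` W)"

lemma sign_max_ge: "finite W \<Longrightarrow> v \<in> W \<Longrightarrow> (\<Sum>i<n. s i * c v i) \<le> sign_max n W c s"
  unfolding sign_max_def by (intro Max_ge) auto

lemma sign_max_attained:
  assumes "finite W" "W \<noteq> {}"
  obtains v where "v \<in> W" "sign_max n W c s = (\<Sum>i<n. s i * c v i)"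
proof -
  have "sign_max n W c s \<in> (\<lambda>v. \<Sum>i<n. s i * c v i) ` W"
    unfolding sign_max_def using assms by (intro Max_in) auto
  then show ?thesis using that by auto
qed

lemma avg_sign_max_nonneg:
  assumes "finite W" "W \<noteq> {}"
  shows "0 \<le> avg n (sign_max n W c)"
proof -
  obtain v where "v \<in> W" using assms by auto
  then have "avg n (\<lambda>s. \<Sum>i<n. s i * c v i) \<le> avg n (sign_max n W c)"
    by (intro avg_mono sign_max_ge assms)
  then show ?thesis by (simp add: avg_sign_sum)
qed

lemma sum_flip_sign:
  fixes c :: "nat \<Rightarrow> real"
  assumes "i < n"
  shows "(\<Sum>j<n. flip_sign i s j * c j) = (\<Sum>j<n. s j * c j) - 2 * (s i * c i)"
proof -
  have "(\<Sum>j<n. flip_sign i s j * c j) = (\<Sum>j<n. s j * c j - (if j = i then 2 * (s i * c i) else 0))"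
    by (rule sum.cong) (auto simp: flip_sign_def)
  then show ?thesis using assms by (simp add: sum_subtractf)
qed

text \<open>Only the coordinates where the maximizer agrees with the sign can lower the maximum when they
  are flipped; counting those instead of all nonzero coordinates is what produces the sharp factor
  in front of the variance.\<close>

lemma sign_max_self_bounding:
  assumes W: "finite W" "W \<noteq> {}"
    and c: "\<And>v i. v \<in> W \<Longrightarrow> c v i = -1 \<or> c v i = 0 \<or> c v i = (1::real)"
    and r: "\<And>v. v \<in> W \<Longrightarrow> (\<Sum>i<n. \<bar>c v i\<bar>) \<le> r"
    and s: "s \<in> signs n"
  shows "(\<Sum>i<n. (max 0 (sign_max n W c s - sign_max n W c (flip_sign i s)))\<^sup>2) \<le> 2 * (r + sign_max n W c s)"
proof -
  obtain v where v: "v \<in> W" "sign_max n W c s = (\<Sum>i<n. s i * c v i)"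
    using sign_max_attained[OF W] .
  have "(max 0 (sign_max n W c s - sign_max n W c (flip_sign i s)))\<^sup>2 \<le> 2 * (\<bar>c v i\<bar> + s i * c v i)"
    if i: "i < n" for i
  proof -
    have "sign_max n W c s - 2 * (s i * c v i) \<le> sign_max n W c (flip_sign i s)"
      using sign_max_ge[OF W(1) v(1), of "flip_sign i s" c n] by (simp add: sum_flip_sign[OF i] v(2))
    then have "max 0 (sign_max n W c s - sign_max n W c (flip_sign i s)) \<le> max 0 (2 * (s i * c v i))"
      by simp
    then have "(max 0 (sign_max n W c s - sign_max n W c (flip_sign i s)))\<^sup>2 \<le> (max 0 (2 * (s i * c v i)))\<^sup>2"
      by (intro power_mono) auto
    also have "\<dots> = 2 * (\<bar>c v i\<bar> + s i * c v i)"
      using c[OF v(1), of i] signs_cases[OF s i] by auto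
    finally show ?thesis .
  qed
  then have "(\<Sum>i<n. (max 0 (sign_max n W c s - sign_max n W c (flip_sign i s)))\<^sup>2)
      \<le> (\<Sum>i<n. 2 * (\<bar>c v i\<bar> + s i * c v i))"
    by (intro sum_mono) auto
  also have "\<dots> = 2 * ((\<Sum>i<n. \<bar>c v i\<bar>) + sign_max n W c s)"
    by (simp add: v(2) sum.distrib flip: sum_distrib_left)
  also have "\<dots> \<le> 2 * (r + sign_max n W c s)" using r[OF v(1)] by simp
  finally show ?thesis .
qed

lemma sign_max_upper_tail:
  assumes W: "finite W" "W \<noteq> {}"
    and c: "\<And>v i. v \<in> W \<Longrightarrow> c v i = -1 \<or> c v i = 0 \<or> c v i = (1::real)"
    and r: "\<And>v. v \<in> W \<Longrightarrow> (\<Sum>i<n. \<bar>c v i\<bar>) \<le> r"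
    and r0: "r > 0" and t: "t > 0"
  shows "avg n (\<lambda>s. of_bool (sign_max n W c s > 2 * avg n (sign_max n W c) + sqrt (8 * r * t) + 4 * t)) \<le> exp (- 2 * t)"
proof -
  let ?Z = "sign_max n W c"
  let ?E = "avg n ?Z"
  define l where "l = (if r \<ge> 8 * t then sqrt (2 * t / r) else 1 / 2)"
  have l: "0 < l" "l \<le> 1 / 2"
  proof -
    show "0 < l" using r0 t by (simp add: l_def)
    have "sqrt (2 * t / r) \<le> sqrt (1 / 4)" if "r \<ge> 8 * t"
      using that r0 by (subst real_sqrt_le_iff) (simp add: field_simps)
    then show "l \<le> 1 / 2" by (simp add: l_def real_sqrt_divide)
  qed
  have E: "?E \<ge> 0" by (rule avg_sign_max_nonneg[OF W])
  have key: "l * r + 2 * t * (1 - l) / l \<le> (sqrt (8 * r * t) + 4 * t) * (1 - l)"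
  proof (cases "r \<ge> 8 * t")
    case True
    have lr: "l * l * r = 2 * t" using True r0 t by (simp add: l_def flip: power2_eq_square)
    have "(2 * l * r)\<^sup>2 = 4 * (l * l * r) * r" by (simp add: power2_eq_square)
    also have "\<dots> = 8 * r * t" by (simp add: lr)
    finally have "sqrt (8 * r * t) = 2 * l * r"
      using l r0 by (intro real_sqrt_unique) auto
    moreover have "2 * t * (1 - l) / l = l * r - 2 * t"
    proof -
      have "2 * t * (1 - l) / l = l * l * r * (1 - l) / l" by (simp add: lr)
      also have "\<dots> = l * r - l * l * r" using l by (simp add: field_simps)
      finally show ?thesis by (simp add: lr)
    qed
    moreover have "(2 * l * r + 4 * t) * (1 - l) = 2 * l * r - 4 * t * l"
      using lr by (simp add: algebra_simps)
    moreover have "4 * t * l \<le> 2 * t" using l t by simp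
    ultimately show ?thesis by simp
  next
    case False
    have "r * r \<le> 8 * t * r" using False r0 by (intro mult_right_mono) auto
    then have "r \<le> sqrt (8 * r * t)" using r0 by (intro real_le_rsqrt) (simp add: power2_eq_square mult_ac)
    then show ?thesis using False by (simp add: l_def)
  qed
  have ln_le: "ln (avg n (\<lambda>s. exp (l * ?Z s))) \<le> l * (2 * ?E + sqrt (8 * r * t) + 4 * t) - 2 * t"
  proof -
    have "(1 - l) * ln (avg n (\<lambda>s. exp (l * ?Z s))) \<le> l * ?E + l\<^sup>2 * r"
      using sign_max_self_bounding[OF W c r] l by (intro log_mgf_bound) auto
    also have "\<dots> \<le> (1 - l) * (l * (2 * ?E + sqrt (8 * r * t) + 4 * t) - 2 * t)"
    proof -
      have "l * ?E \<le> 2 * (l * ?E) - 2 * (l * (l * ?E))"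
        using mult_right_mono[of "2 * l" 1 "l * ?E"] l E by simp
      moreover have "l * (l * r + 2 * t * (1 - l) / l) \<le> l * ((sqrt (8 * r * t) + 4 * t) * (1 - l))"
        using key l by (intro mult_left_mono) auto
      moreover have "l * (l * r + 2 * t * (1 - l) / l) = l\<^sup>2 * r + 2 * t * (1 - l)"
        using l by (simp add: distrib_left power2_eq_square)
      moreover have "(1 - l) * (l * (2 * ?E + sqrt (8 * r * t) + 4 * t) - 2 * t)
          = 2 * (l * ?E) - 2 * (l * (l * ?E)) + l * ((sqrt (8 * r * t) + 4 * t) * (1 - l)) - 2 * t * (1 - l)"
        by (simp add: algebra_simps)
      ultimately show ?thesis by linarith
    qed
    finally show ?thesis using l by simp
  qed
  have "avg n (\<lambda>s. of_bool (?Z s > 2 * ?E + sqrt (8 * r * t) + 4 * t))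
      \<le> avg n (\<lambda>s. exp (l * (?Z s - (2 * ?E + sqrt (8 * r * t) + 4 * t))))"
    using l by (intro avg_of_bool_le_exp) auto
  also have "\<dots> = exp (- l * (2 * ?E + sqrt (8 * r * t) + 4 * t)) * avg n (\<lambda>s. exp (l * ?Z s))"
    unfolding avg_cmult[symmetric] by (rule avg_cong) (simp add: exp_add[symmetric] algebra_simps)
  also have "avg n (\<lambda>s. exp (l * ?Z s)) \<le> exp (l * (2 * ?E + sqrt (8 * r * t) + 4 * t) - 2 * t)"
    using ln_le by (intro le_exp_of_ln_le) (auto intro: avg_pos)
  also have "exp (- l * (2 * ?E + sqrt (8 * r * t) + 4 * t)) * \<dots> = exp (- 2 * t)"
    by (simp flip: exp_add)
  finally show ?thesis by simp
qed

section \<open>Rademacher averages and traces on half of the points\<close>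

text \<open>Among the maximizers the one of least index is chosen: with arbitrary tie-breaking the weights of
  the two members of a pair could have opposite signs.\<close>

lemma maximizer_weights:
  fixes x :: "'v \<Rightarrow> nat \<Rightarrow> bool \<Rightarrow> bool"
  assumes W: "finite W" "W \<noteq> {}"
  defines "c \<equiv> \<lambda>v i. of_bool (x v i True) - of_bool (x v i False)"
  obtains \<alpha> :: "nat \<Rightarrow> bool \<Rightarrow> real" where
    "\<And>i b. i < n \<Longrightarrow> 0 \<le> \<alpha> i b \<and> \<alpha> i b \<le> 1 / 2"
    "avg n (sign_max n W c) = (\<Sum>i<n. \<alpha> i False + \<alpha> i True)"
    "\<And>s. s \<in> signs n \<Longrightarrow> (\<Sum>i<n. \<alpha> i (s i < 0)) \<le> avg n (sign_max n W (\<lambda>v i. of_bool (x v i (s i < 0))))"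
proof -
  obtain \<kappa> :: "'v \<Rightarrow> nat" where \<kappa>: "inj_on \<kappa> W"
    using finite_imp_inj_to_nat_seg[OF W(1)] by auto
  let ?val = "\<lambda>s v. \<Sum>i<n. s i * c v i"
  define sel where "sel = (\<lambda>s. arg_min \<kappa> (\<lambda>v. v \<in> W \<and> ?val s v = sign_max n W c s))"
  have sel_ex: "\<exists>v. v \<in> W \<and> ?val s v = sign_max n W c s" for s
    using sign_max_attained[OF W, of n c s] by metis
  have sel: "sel s \<in> W" "?val s (sel s) = sign_max n W c s" for s
    using arg_min_natI[of "\<lambda>v. v \<in> W \<and> ?val s v = sign_max n W c s" _ \<kappa>] sel_ex[of s]
    unfolding sel_def by blast+
  have sel_least: "\<kappa> (sel s) \<le> \<kappa> v" if "v \<in> W" "?val s v = sign_max n W c s" for s v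
    unfolding sel_def using that by (intro arg_min_nat_le) auto
  have val_flip: "?val (flip_sign i s) v = ?val s v - 2 * (s i * c v i)" if "i < n" for i s v
    by (rule sum_flip_sign[OF that])
  have step: "c (sel (flip_sign i s)) i < c (sel s) i \<or> sel (flip_sign i s) = sel s"
    if i: "i < n" and s: "s i = 1" for i s
  proof -
    let ?u = "sel s" and ?w = "sel (flip_sign i s)"
    have 1: "?val s ?w \<le> ?val s ?u" using sign_max_ge[OF W(1) sel(1)] sel(2) by metis
    have 2: "?val (flip_sign i s) ?u \<le> ?val (flip_sign i s) ?w" using sign_max_ge[OF W(1) sel(1)] sel(2) by metis
    have 3: "?val s ?u - 2 * c ?u i \<le> ?val s ?w - 2 * c ?w i"
      using 2 s by (simp add: val_flip[OF i])
    show ?thesis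
    proof (cases "c ?w i < c ?u i")
      case False
      then have eq: "c ?w i = c ?u i" "?val s ?w = ?val s ?u" using 1 3 by auto
      have "\<kappa> ?u \<le> \<kappa> ?w" using eq sel[of s] sel(1)[of "flip_sign i s"] by (intro sel_least) auto
      moreover have "\<kappa> ?w \<le> \<kappa> ?u"
        using eq sel(1)[of s] sel(2)[of "flip_sign i s"] by (intro sel_least) (auto simp: val_flip[OF i])
      ultimately have "?w = ?u" using \<kappa> sel(1) by (metis inj_onD le_antisym)
      then show ?thesis ..
    qed simp
  qed
  define \<kappa>b where "\<kappa>b = (\<lambda>b::bool. if b then 1 else (-1::real))"
  define \<alpha> where "\<alpha> = (\<lambda>i b. avg n (\<lambda>s. \<kappa>b b * s i * of_bool (x (sel s) i b)))"
  have bound: "0 \<le> \<alpha> i b \<and> \<alpha> i b \<le> 1 / 2" if i: "i < n" for i b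
  proof -
    let ?g = "\<lambda>s. \<kappa>b b * s i * of_bool (x (sel s) i b)"
    have pt: "0 \<le> ?g s + ?g (flip_sign i s) \<and> ?g s + ?g (flip_sign i s) \<le> 1" if "s i = 1" for s
      using step[of i s, OF i that] that by (cases b) (auto simp: c_def \<kappa>b_def of_bool_def split: if_splits)
    have pt': "0 \<le> ?g s + ?g (flip_sign i s) \<and> ?g s + ?g (flip_sign i s) \<le> 1" if "s \<in> signs n" for s
    proof (cases "s i = 1")
      case False
      then have "flip_sign i s i = 1" using signs_cases[OF that i] by simp
      from pt[of "flip_sign i s", OF this] show ?thesis by (simp add: add.commute)
    qed (rule pt)
    have "2 * \<alpha> i b = avg n (\<lambda>s. ?g s + ?g (flip_sign i s))"
      unfolding avg_add using avg_flip_sign[OF i, of ?g] by (simp add: \<alpha>_def)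
    moreover have "0 \<le> avg n (\<lambda>s. ?g s + ?g (flip_sign i s))"
      using pt' by (intro avg_nonneg) auto
    moreover have "avg n (\<lambda>s. ?g s + ?g (flip_sign i s)) \<le> 1"
      using avg_mono[of n "\<lambda>s. ?g s + ?g (flip_sign i s)" "\<lambda>_. 1"] pt' by simp
    ultimately show ?thesis by linarith
  qed
  have total: "avg n (sign_max n W c) = (\<Sum>i<n. \<alpha> i False + \<alpha> i True)"
  proof -
    have "avg n (sign_max n W c) = avg n (\<lambda>s. ?val s (sel s))" by (simp add: sel(2))
    also have "\<dots> = (\<Sum>i<n. \<alpha> i False + \<alpha> i True)"
      unfolding avg_sum \<alpha>_def avg_add[symmetric]
      by (intro sum.cong avg_cong refl) (simp add: c_def \<kappa>b_def algebra_simps)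
    finally show ?thesis .
  qed
  have lower: "(\<Sum>i<n. \<alpha> i (s i < 0)) \<le> avg n (sign_max n W (\<lambda>v i. of_bool (x v i (s i < 0))))"
    (is "_ \<le> avg n ?G") if "s \<in> signs n" for s
  proof -
    have "(\<Sum>i<n. \<alpha> i (s i < 0)) = avg n (\<lambda>e. \<Sum>i<n. \<kappa>b (s i < 0) * e i * of_bool (x (sel e) i (s i < 0)))"
      unfolding avg_sum \<alpha>_def ..
    also have "\<dots> \<le> avg n (\<lambda>e. ?G (\<lambda>i\<in>{..<n}. \<kappa>b (s i < 0) * e i))"
    proof (rule avg_mono)
      fix e
      have "(\<Sum>i<n. (\<lambda>i\<in>{..<n}. \<kappa>b (s i < 0) * e i) i * of_bool (x (sel e) i (s i < 0)))
          \<le> ?G (\<lambda>i\<in>{..<n}. \<kappa>b (s i < 0) * e i)"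
        by (rule sign_max_ge[OF W(1) sel(1)])
      then show "(\<Sum>i<n. \<kappa>b (s i < 0) * e i * of_bool (x (sel e) i (s i < 0)))
          \<le> ?G (\<lambda>i\<in>{..<n}. \<kappa>b (s i < 0) * e i)"
        by simp
    qed
    also have "\<dots> = avg n ?G"
      by (rule avg_mult_signs) (auto simp: \<kappa>b_def)
    finally show ?thesis .
  qed
  show thesis using that[OF bound total lower] .
qed

lemma chosen_rademacher_lower_tail:
  fixes x :: "'v \<Rightarrow> nat \<Rightarrow> bool \<Rightarrow> bool"
  assumes W: "finite W" "W \<noteq> {}"
  shows "avg n (\<lambda>s. of_bool (4 * avg n (sign_max n W (\<lambda>v i. of_bool (x v i (s i < 0)))) + 4 * t
      < avg n (sign_max n W (\<lambda>v i. of_bool (x v i True) - of_bool (x v i False))))) \<le> exp (- 2 * t)"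
proof -
  obtain \<alpha> :: "nat \<Rightarrow> bool \<Rightarrow> real" where \<alpha>:
    "\<And>i b. i < n \<Longrightarrow> 0 \<le> \<alpha> i b \<and> \<alpha> i b \<le> 1 / 2"
    "avg n (sign_max n W (\<lambda>v i. of_bool (x v i True) - of_bool (x v i False))) = (\<Sum>i<n. \<alpha> i False + \<alpha> i True)"
    "\<And>s. s \<in> signs n \<Longrightarrow> (\<Sum>i<n. \<alpha> i (s i < 0)) \<le> avg n (sign_max n W (\<lambda>v i. of_bool (x v i (s i < 0))))"
    by (rule maximizer_weights[OF W, where n = n and x = x]) blast
  have "avg n (\<lambda>s. of_bool ((\<Sum>i<n. 2 * \<alpha> i (s i < 0)) < (\<Sum>i<n. 2 * \<alpha> i False + 2 * \<alpha> i True) / 4 - 2 * t))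
      \<le> exp (- (2 * t))"
    using \<alpha>(1) by (intro chosen_weight_lower_tail) (force simp: mult.commute)
  moreover have "avg n (\<lambda>s. of_bool (4 * avg n (sign_max n W (\<lambda>v i. of_bool (x v i (s i < 0)))) + 4 * t
      < avg n (sign_max n W (\<lambda>v i. of_bool (x v i True) - of_bool (x v i False)))))
    \<le> avg n (\<lambda>s. of_bool ((\<Sum>i<n. 2 * \<alpha> i (s i < 0)) < (\<Sum>i<n. 2 * \<alpha> i False + 2 * \<alpha> i True) / 4 - 2 * t))"
  proof (rule avg_mono)
    fix s assume "s \<in> signs n"
    from \<alpha>(3)[OF this] show "(of_bool (4 * avg n (sign_max n W (\<lambda>v i. of_bool (x v i (s i < 0)))) + 4 * t
        < avg n (sign_max n W (\<lambda>v i. of_bool (x v i True) - of_bool (x v i False))))::real)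
      \<le> of_bool ((\<Sum>i<n. 2 * \<alpha> i (s i < 0)) < (\<Sum>i<n. 2 * \<alpha> i False + 2 * \<alpha> i True) / 4 - 2 * t)"
      by (auto simp: \<alpha>(2) sum.distrib add_divide_distrib simp flip: sum_distrib_left)
  qed
  ultimately show ?thesis by simp
qed

definition ntrace :: "'i set \<Rightarrow> ('i \<Rightarrow> bool) set \<Rightarrow> nat" where
  "ntrace A V = card ((\<lambda>v. restrict v A) ` V)"

lemma finite_trace: "finite A \<Longrightarrow> finite ((\<lambda>v. restrict v A) ` V)" for V :: "('i \<Rightarrow> bool) set"
  by (rule finite_subset[of _ "A \<rightarrow>\<^sub>E UNIV"]) (auto intro!: finite_PiE)

lemma ntrace_mono: "finite A \<Longrightarrow> V \<subseteq> V' \<Longrightarrow> ntrace A V \<le> ntrace A V'"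
  unfolding ntrace_def by (intro card_mono finite_trace image_mono)

lemma ntrace_pos: "finite A \<Longrightarrow> V \<noteq> {} \<Longrightarrow> 0 < ntrace A V"
  unfolding ntrace_def by (simp add: card_gt_0_iff finite_trace)

lemma ntrace_insert:
  assumes A: "finite A" and j: "j \<notin> A"
  shows "ntrace (insert j A) V = ntrace A {v \<in> V. \<not> v j} + ntrace A {v \<in> V. v j}"
proof -
  let ?r = "\<lambda>v. restrict v (insert j A)"
  have split: "?r ` V = ?r ` {v \<in> V. \<not> v j} \<union> ?r ` {v \<in> V. v j}" by blast
  have disj: "?r ` {v \<in> V. \<not> v j} \<inter> ?r ` {v \<in> V. v j} = {}"
    by (auto dest: fun_cong[where x = j])
  have card: "card (?r ` {v \<in> V. v j = e}) = ntrace A {v \<in> V. v j = e}" for e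
  proof -
    have "(\<lambda>v. restrict v A) ` {v \<in> V. v j = e} = (\<lambda>w. restrict w A) ` (?r ` {v \<in> V. v j = e})"
      unfolding image_image by (intro image_cong) (auto simp: restrict_def)
    moreover have "inj_on (\<lambda>w. restrict w A) (?r ` {v \<in> V. v j = e})"
    proof (rule inj_onI)
      fix f g assume fg: "f \<in> ?r ` {v \<in> V. v j = e}" "g \<in> ?r ` {v \<in> V. v j = e}"
        and eq: "restrict f A = restrict g A"
      show "f = g"
      proof
        fix i show "f i = g i"
          using fg fun_cong[OF eq, of i] by (auto simp: restrict_def split: if_splits)
      qed
    qed
    ultimately show ?thesis by (simp add: ntrace_def card_image)
  qed
  show ?thesis
    unfolding ntrace_def[of "insert j A"] split
    using card[of True] card[of False] finite_trace[of "insert j A"] A disj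
    by (subst card_Un_disjoint) auto
qed

text \<open>The weights are the conditional entropies in the chain rule for a uniformly chosen trace.\<close>

lemma trace_weights:
  fixes V :: "('i \<Rightarrow> bool) set"
  assumes "finite I" "V \<noteq> {}"
  shows "\<exists>w. (\<forall>i\<in>I. 0 \<le> w i \<and> w i \<le> ln 2) \<and> (\<Sum>i\<in>I. w i) = ln (ntrace I V)
    \<and> (\<forall>A\<subseteq>I. (\<Sum>i\<in>A. w i) \<le> ln (ntrace A V))"
  using assms
proof (induction I arbitrary: V rule: finite_induct)
  case empty
  then have "(\<lambda>v. restrict v {}) ` V = {\<lambda>_. undefined}" by (auto simp: restrict_def)
  then show ?case by (simp add: ntrace_def)
next
  case (insert j I)
  let ?V0 = "{v \<in> V. \<not> v j}" and ?V1 = "{v \<in> V. v j}"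
  have sub: "ntrace A ?V0 \<le> ntrace A V" "ntrace A ?V1 \<le> ntrace A V" if "finite A" for A
    using that by (auto intro: ntrace_mono)
  have finA: "finite A" if "A \<subseteq> insert j I" for A
    using that insert.hyps by (meson finite.insertI finite_subset)
  have Aj: "ntrace A V = ntrace (A - {j}) ?V0 + ntrace (A - {j}) ?V1"
    if "j \<in> A" "A \<subseteq> insert j I" for A
    using ntrace_insert[of "A - {j}" j V] that finA[OF that(2)] by (simp add: insert_absorb)
  have Ij: "ntrace (insert j I) V = ntrace I ?V0 + ntrace I ?V1"
    using insert.hyps by (intro ntrace_insert)
  show ?case
  proof (cases "?V0 = {} \<or> ?V1 = {}")
    case True
    have triv: "ntrace (insert j I) V = ntrace I V \<and> (\<forall>A. A \<subseteq> insert j I \<longrightarrow> j \<in> A \<longrightarrow> ntrace A V = ntrace (A - {j}) V)"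
    proof -
      have "(?V0 = V \<and> ?V1 = {}) \<or> (?V0 = {} \<and> ?V1 = V)" using True by blast
      then show ?thesis
      proof
        assume "?V0 = V \<and> ?V1 = {}"
        then have e: "?V0 = V" "?V1 = {}" by blast+
        show ?thesis using Ij Aj unfolding e by (simp add: ntrace_def)
      next
        assume "?V0 = {} \<and> ?V1 = V"
        then have e: "?V0 = {}" "?V1 = V" by blast+
        show ?thesis using Ij Aj unfolding e by (simp add: ntrace_def)
      qed
    qed
    obtain w where w: "\<forall>i\<in>I. 0 \<le> w i \<and> w i \<le> ln 2" "(\<Sum>i\<in>I. w i) = ln (ntrace I V)"
      "\<forall>A\<subseteq>I. (\<Sum>i\<in>A. w i) \<le> ln (ntrace A V)"
      using insert.IH[OF insert.prems] by blast
    let ?w = "w(j := 0)"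
    have upd: "(\<Sum>i\<in>A. ?w i) = (\<Sum>i\<in>A - {j}. w i)" if "finite A" for A
      using that by (cases "j \<in> A") (auto simp: sum.remove intro!: sum.cong)
    show ?thesis
    proof (intro exI[of _ ?w] conjI allI impI)
      show "\<forall>i\<in>insert j I. 0 \<le> ?w i \<and> ?w i \<le> ln 2" using w(1) by auto
      show "(\<Sum>i\<in>insert j I. ?w i) = ln (ntrace (insert j I) V)"
        using upd[of "insert j I"] insert.hyps w(2) triv by simp
      fix A assume A: "A \<subseteq> insert j I"
      then have "A - {j} \<subseteq> I" by blast
      then have "(\<Sum>i\<in>A. ?w i) \<le> ln (ntrace (A - {j}) V)"
        using upd[OF finA[OF A]] w(3) by simp
      then show "(\<Sum>i\<in>A. ?w i) \<le> ln (ntrace A V)"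
        using triv A by (cases "j \<in> A") auto
    qed
  next
    case False
    then have ne: "?V0 \<noteq> {}" "?V1 \<noteq> {}" by auto
    obtain w0 where w0: "\<forall>i\<in>I. 0 \<le> w0 i \<and> w0 i \<le> ln 2" "(\<Sum>i\<in>I. w0 i) = ln (ntrace I ?V0)"
      "\<forall>A\<subseteq>I. (\<Sum>i\<in>A. w0 i) \<le> ln (ntrace A ?V0)"
      using insert.IH[OF ne(1)] by blast
    obtain w1 where w1: "\<forall>i\<in>I. 0 \<le> w1 i \<and> w1 i \<le> ln 2" "(\<Sum>i\<in>I. w1 i) = ln (ntrace I ?V1)"
      "\<forall>A\<subseteq>I. (\<Sum>i\<in>A. w1 i) \<le> ln (ntrace A ?V1)"
      using insert.IH[OF ne(2)] by blast
    define p where "p = real (ntrace I ?V0)"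
    define q where "q = real (ntrace I ?V1)"
    have pq: "p > 0" "q > 0" using ntrace_pos[OF insert.hyps(1)] ne by (auto simp: p_def q_def)
    define \<theta> where "\<theta> = p / (p + q)"
    have \<theta>: "0 < \<theta>" "\<theta> < 1" "1 - \<theta> = q / (p + q)"
      using pq by (auto simp: \<theta>_def field_simps)
    define H where "H = - \<theta> * ln \<theta> - (1 - \<theta>) * ln (1 - \<theta>)"
    have gibbs: "\<theta> * ln a + (1 - \<theta>) * ln b + H \<le> ln (a + b)" if "a > 0" "b > 0" for a b :: real
    proof -
      have "ln (a / \<theta> / (a + b)) \<le> a / \<theta> / (a + b) - 1" "ln (b / (1 - \<theta>) / (a + b)) \<le> b / (1 - \<theta>) / (a + b) - 1"
        using that \<theta>(1,2) by (auto intro!: ln_le_minus_one divide_pos_pos add_pos_pos simp del: times_divide_eq_right divide_divide_eq_left)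
      then have "\<theta> * ln (a / \<theta> / (a + b)) + (1 - \<theta>) * ln (b / (1 - \<theta>) / (a + b))
          \<le> \<theta> * (a / \<theta> / (a + b) - 1) + (1 - \<theta>) * (b / (1 - \<theta>) / (a + b) - 1)"
        using \<theta> by (intro add_mono mult_left_mono) auto
      also have "\<dots> = a / (a + b) + b / (a + b) - 1"
      proof -
        have "z * (w / z / y - 1) = w / y - z" if "z > 0" for z w y :: real
          using that by (simp add: right_diff_distrib)
        then show ?thesis using \<theta>(1,2) by simp
      qed
      also have "\<dots> = 0" using that by (simp add: add_divide_distrib[symmetric])
      finally have "\<theta> * ln (a / \<theta> / (a + b)) + (1 - \<theta>) * ln (b / (1 - \<theta>) / (a + b)) \<le> 0" .
      moreover have "ln (w / z / (a + b)) = ln w - ln z - ln (a + b)" if "w > 0" "z > 0" for w z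
        using that \<open>a > 0\<close> \<open>b > 0\<close> by (simp add: ln_div ln_mult)
      then have "ln (a / \<theta> / (a + b)) = ln a - ln \<theta> - ln (a + b)"
        "ln (b / (1 - \<theta>) / (a + b)) = ln b - ln (1 - \<theta>) - ln (a + b)"
        using that \<theta>(1,2) by simp_all
      ultimately have "\<theta> * (ln a - ln \<theta> - ln (a + b)) + (1 - \<theta>) * (ln b - ln (1 - \<theta>) - ln (a + b)) \<le> 0"
        by simp
      then show ?thesis by (simp add: H_def algebra_simps)
    qed
    have Hpq: "\<theta> * ln p + (1 - \<theta>) * ln q + H = ln (p + q)"
    proof -
      have "ln \<theta> = ln p - ln (p + q)" "ln (1 - \<theta>) = ln q - ln (p + q)"
        using pq unfolding \<theta>(3) by (simp_all add: \<theta>_def ln_div)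
      then show ?thesis unfolding H_def by algebra
    qed
    have H0: "0 \<le> H"
    proof -
      have "\<theta> * ln \<theta> \<le> 0" "(1 - \<theta>) * ln (1 - \<theta>) \<le> 0"
        using \<theta>(1,2) by (intro mult_nonneg_nonpos; simp)+
      then show ?thesis by (simp add: H_def)
    qed
    have H2: "H \<le> ln 2" using gibbs[of 1 1] by simp
    define w where "w = (\<lambda>i. \<theta> * w0 i + (1 - \<theta>) * w1 i)(j := H)"
    have mix: "(\<Sum>i\<in>A. w i) = \<theta> * (\<Sum>i\<in>A. w0 i) + (1 - \<theta>) * (\<Sum>i\<in>A. w1 i)" if "A \<subseteq> I" for A
      unfolding sum_distrib_left sum.distrib[symmetric]
      using that insert.hyps by (intro sum.cong) (auto simp: w_def)
    have le: "(\<Sum>i\<in>A. w i) \<le> \<theta> * ln (ntrace A ?V0) + (1 - \<theta>) * ln (ntrace A ?V1)" if "A \<subseteq> I" for A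
      unfolding mix[OF that] using w0(3) w1(3) that \<theta> by (intro add_mono mult_left_mono) auto
    show ?thesis
    proof (intro exI[of _ w] conjI allI impI)
      show "\<forall>i\<in>insert j I. 0 \<le> w i \<and> w i \<le> ln 2"
      proof
        fix i assume "i \<in> insert j I"
        show "0 \<le> w i \<and> w i \<le> ln 2"
        proof (cases "i = j")
          case False
          then have "i \<in> I" using \<open>i \<in> insert j I\<close> by simp
          then have "0 \<le> w0 i" "w0 i \<le> ln 2" "0 \<le> w1 i" "w1 i \<le> ln 2" using w0(1) w1(1) by auto
          then have "\<theta> * w0 i + (1 - \<theta>) * w1 i \<le> \<theta> * ln 2 + (1 - \<theta>) * ln 2"
            using \<theta>(1,2) by (intro add_mono mult_left_mono) auto
          moreover have "0 \<le> \<theta> * w0 i + (1 - \<theta>) * w1 i"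
            using \<theta>(1,2) \<open>0 \<le> w0 i\<close> \<open>0 \<le> w1 i\<close> by (intro add_nonneg_nonneg mult_nonneg_nonneg) auto
          ultimately have "0 \<le> \<theta> * w0 i + (1 - \<theta>) * w1 i" "\<theta> * w0 i + (1 - \<theta>) * w1 i \<le> ln 2"
            by (simp_all add: algebra_simps)
          then show ?thesis using False by (simp add: w_def)
        qed (use H0 H2 in \<open>simp add: w_def\<close>)
      qed
      show "(\<Sum>i\<in>insert j I. w i) = ln (ntrace (insert j I) V)"
        using insert.hyps mix[of I] w0(2) w1(2) Hpq by (simp add: Ij p_def q_def w_def)
      fix A assume A: "A \<subseteq> insert j I"
      show "(\<Sum>i\<in>A. w i) \<le> ln (ntrace A V)"
      proof (cases "j \<in> A")
        case True
        let ?B = "A - {j}"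
        have B: "?B \<subseteq> I" "finite ?B" using A finA[OF A] by auto
        have "(\<Sum>i\<in>A. w i) = H + (\<Sum>i\<in>?B. w i)"
          using True finA[OF A] by (simp add: sum.remove w_def)
        also have "\<dots> \<le> \<theta> * ln (ntrace ?B ?V0) + (1 - \<theta>) * ln (ntrace ?B ?V1) + H"
          using le[OF B(1)] by simp
        also have "\<dots> \<le> ln (real (ntrace ?B ?V0) + real (ntrace ?B ?V1))"
          using ntrace_pos[OF B(2)] ne by (intro gibbs) auto
        also have "\<dots> = ln (ntrace A V)" using Aj[OF True A] by simp
        finally show ?thesis .
      next
        case False
        then have B: "A \<subseteq> I" "finite A" using A finA[OF A] by auto
        have "ln (ntrace A ?V0) \<le> ln (ntrace A V)" "ln (ntrace A ?V1) \<le> ln (ntrace A V)"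
          using sub[OF B(2)] ntrace_pos[OF B(2) ne(1)] ntrace_pos[OF B(2) ne(2)] by simp_all
        then have "\<theta> * ln (ntrace A ?V0) + (1 - \<theta>) * ln (ntrace A ?V1)
            \<le> \<theta> * ln (ntrace A V) + (1 - \<theta>) * ln (ntrace A V)"
          using \<theta> by (intro add_mono mult_left_mono) auto
        then show ?thesis using le[OF B(1)] by (simp add: algebra_simps)
      qed
    qed
  qed
qed

section \<open>Exchanging the halves of a double sample\<close>

definition train_errors :: "nat \<Rightarrow> ('v \<Rightarrow> nat \<Rightarrow> bool \<Rightarrow> bool) \<Rightarrow> (nat \<Rightarrow> real) \<Rightarrow> 'v \<Rightarrow> real" where
  "train_errors n x s f = (\<Sum>i<n. of_bool (x f i (s i < 0)))"

definition ghost_errors :: "nat \<Rightarrow> ('v \<Rightarrow> nat \<Rightarrow> bool \<Rightarrow> bool) \<Rightarrow> (nat \<Rightarrow> real) \<Rightarrow> 'v \<Rightarrow> real" where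
  "ghost_errors n x s f = (\<Sum>i<n. of_bool (x f i (\<not> s i < 0)))"

definition log_traces :: "nat \<Rightarrow> 'v set \<Rightarrow> ('v \<Rightarrow> nat \<Rightarrow> bool \<Rightarrow> bool) \<Rightarrow> (nat \<Rightarrow> real) \<Rightarrow> real" where
  "log_traces n X x s = ln (ntrace {..<n} ((\<lambda>f i. x f i (s i < 0)) ` X))"

definition rademacher_sum :: "nat \<Rightarrow> 'v set \<Rightarrow> ('v \<Rightarrow> nat \<Rightarrow> bool \<Rightarrow> bool) \<Rightarrow> (nat \<Rightarrow> real) \<Rightarrow> real" where
  "rademacher_sum n X x s = avg n (\<lambda>e. SUP f\<in>X. \<Sum>i<n. e i * of_bool (x f i (s i < 0)))"

text \<open>The signs \<open>s\<close> choose which member of each pair belongs to the training half; \<open>U\<close> is \<open>n\<close> times the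
  quantity \<open>u_hat\<close>. The term \<open>1 + sqrt (ghost_errors n x s f)\<close> pays for replacing the loss of \<open>f\<close> by its
  ghost empirical loss.\<close>

definition swap_good :: "nat \<Rightarrow> real \<Rightarrow> 'v set \<Rightarrow> ('v \<Rightarrow> nat \<Rightarrow> bool \<Rightarrow> bool) \<Rightarrow> (nat \<Rightarrow> real) \<Rightarrow> bool" where
  "swap_good n t X x s \<longleftrightarrow> (\<forall>f\<in>X. (\<forall>g\<in>X. train_errors n x s f \<le> train_errors n x s g) \<longrightarrow>
     (let U = 64 * log_traces n X x s + 144 * t in
      ghost_errors n x s f - train_errors n x s f + 1 + sqrt (ghost_errors n x s f)
        \<le> 8 * rademacher_sum n {g \<in> X. train_errors n x s g \<le> 16 * train_errors n x s f + 15 * U} x s + 20 * t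
          + 2 * sqrt (t * (8 * train_errors n x s f + 7 * U))
      \<and> 3 * ghost_errors n x s f + 6 \<le> 8 * train_errors n x s f + 7 * U))"

lemma train_errors_nonneg [simp]: "0 \<le> train_errors n x s f" and ghost_errors_nonneg [simp]: "0 \<le> ghost_errors n x s f"
  by (auto simp: train_errors_def ghost_errors_def intro: sum_nonneg)

lemma train_plus_ghost_errors:
  "train_errors n x s f + ghost_errors n x s f = (\<Sum>i<n. of_bool (x f i False) + of_bool (x f i True))"
  unfolding train_errors_def ghost_errors_def sum.distrib[symmetric]
proof (rule sum.cong)
  fix i show "of_bool (x f i (s i < 0)) + of_bool (x f i (\<not> s i < 0))
      = (of_bool (x f i False) + of_bool (x f i True) :: real)"
    by (cases "s i < 0") simp_all
qed simp

lemma ghost_minus_train_errors: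
  assumes "s \<in> signs n"
  shows "ghost_errors n x s f - train_errors n x s f = (\<Sum>i<n. s i * (of_bool (x f i True) - of_bool (x f i False)))"
  unfolding train_errors_def ghost_errors_def sum_subtractf[symmetric]
proof (rule sum.cong)
  fix i assume "i \<in> {..<n}"
  then show "of_bool (x f i (\<not> s i < 0)) - of_bool (x f i (s i < 0))
      = s i * (of_bool (x f i True) - of_bool (x f i False))"
    using signs_cases[OF assms, of i] by auto
qed simp

lemma avg_sign_max_le_rademacher_sum:
  assumes W: "W \<subseteq> X" "W \<noteq> {}" and X: "finite X"
  shows "avg n (sign_max n W (\<lambda>v i. of_bool (x v i (s i < 0)))) \<le> rademacher_sum n X x s"
  unfolding rademacher_sum_def
proof (rule avg_mono)
  fix e
  have finW: "finite W" using W X finite_subset by blast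
  obtain v where v: "v \<in> W" "sign_max n W (\<lambda>v i. of_bool (x v i (s i < 0))) e = (\<Sum>i<n. e i * of_bool (x v i (s i < 0)))"
    by (rule sign_max_attained[OF finW W(2), where n = n and c = "\<lambda>v i. of_bool (x v i (s i < 0))" and s = e])
  show "sign_max n W (\<lambda>v i. of_bool (x v i (s i < 0))) e \<le> (SUP f\<in>X. \<Sum>i<n. e i * of_bool (x f i (s i < 0)))"
    unfolding v(2) using v(1) W X by (intro cSUP_upper bdd_above_finite) auto
qed

lemma shatter_lower_tail:
  fixes V :: "(nat \<Rightarrow> bool \<Rightarrow> bool) set"
  assumes V: "finite V" "V \<noteq> {}" and supp: "\<And>v i b. v \<in> V \<Longrightarrow> n \<le> i \<Longrightarrow> \<not> v i b"
  shows "avg n (\<lambda>s. of_bool (log_traces n V (\<lambda>v. v) s < ln (card V) / 4 - 2 * t)) \<le> exp (- 2 * t)"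
proof -
  let ?I = "{..<n} \<times> (UNIV :: bool set)"
  let ?V = "(\<lambda>v (i, b). v i b) ` V"
  obtain w where w: "\<forall>p\<in>?I. 0 \<le> w p \<and> w p \<le> ln 2" "(\<Sum>p\<in>?I. w p) = ln (ntrace ?I ?V)"
    "\<forall>A\<subseteq>?I. (\<Sum>p\<in>A. w p) \<le> ln (ntrace A ?V)"
    using trace_weights[of ?I ?V] V by auto
  have "inj_on (\<lambda>v. restrict (\<lambda>(i, b). v i b) ?I) V"
  proof (rule inj_onI)
    fix v v' assume "v \<in> V" "v' \<in> V" and eq: "restrict (\<lambda>(i, b). v i b) ?I = restrict (\<lambda>(i, b). v' i b) ?I"
    show "v = v'"
    proof (intro ext)
      fix i b show "v i b = v' i b"
        using fun_cong[OF eq, of "(i, b)"] supp[OF \<open>v \<in> V\<close>, of i b] supp[OF \<open>v' \<in> V\<close>, of i b]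
        by (cases "i < n") auto
    qed
  qed
  then have cardV: "ntrace ?I ?V = card V"
    by (simp add: ntrace_def image_image card_image)
  have total: "(\<Sum>i<n. w (i, False) + w (i, True)) = ln (card V)"
  proof -
    have "(\<Sum>p\<in>?I. w p) = (\<Sum>i<n. \<Sum>b\<in>UNIV. w (i, b))"
      by (simp add: sum.cartesian_product)
    also have "\<dots> = (\<Sum>i<n. w (i, False) + w (i, True))"
      by (simp add: UNIV_bool)
    finally show ?thesis using w(2) cardV by metis
  qed
  have lower: "(\<Sum>i<n. w (i, s i < 0)) \<le> log_traces n V (\<lambda>v. v) s" for s :: "nat \<Rightarrow> real"
  proof -
    let ?A = "(\<lambda>i. (i, s i < 0)) ` {..<n}"
    have "(\<Sum>i<n. w (i, s i < 0)) = (\<Sum>p\<in>?A. w p)"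
      by (subst sum.reindex) (auto simp: inj_on_def)
    also have "\<dots> \<le> ln (ntrace ?A ?V)"
    proof -
      have "?A \<subseteq> ?I" by auto
      then show ?thesis using w(3) by metis
    qed
    also have "\<dots> \<le> log_traces n V (\<lambda>v. v) s"
    proof -
      let ?T = "(\<lambda>v. restrict v {..<n}) ` (\<lambda>f i. f i (s i < 0)) ` V"
      have "(\<lambda>v. restrict v ?A) ` ?V = (\<lambda>u. restrict (\<lambda>(i, b). u i) ?A) ` ?T"
        unfolding image_image by (intro image_cong refl ext) (auto simp: restrict_def)
      then have "ntrace ?A ?V \<le> ntrace {..<n} ((\<lambda>f i. f i (s i < 0)) ` V)"
        unfolding ntrace_def using card_image_le[of ?T "\<lambda>u. restrict (\<lambda>(i, b). u i) ?A"] V(1)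
        by (metis finite_imageI)
      moreover have "0 < ntrace ?A ?V" using V by (intro ntrace_pos) auto
      ultimately show ?thesis unfolding log_traces_def by simp
    qed
    finally show ?thesis .
  qed
  have "avg n (\<lambda>s. of_bool (log_traces n V (\<lambda>v. v) s < ln (card V) / 4 - 2 * t))
     \<le> avg n (\<lambda>s. of_bool ((\<Sum>i<n. w (i, s i < 0)) < (\<Sum>i<n. w (i, False) + w (i, True)) / 4 - 2 * t))"
    unfolding total
  proof (rule avg_mono)
    fix s show "(of_bool (log_traces n V (\<lambda>v. v) s < ln (card V) / 4 - 2 * t) :: real)
      \<le> of_bool ((\<Sum>i<n. w (i, s i < 0)) < ln (card V) / 4 - 2 * t)"
      using lower[of s] by auto
  qed
  also have "\<dots> \<le> exp (- (2 * t))"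
  proof (rule chosen_weight_lower_tail)
    have "ln 2 \<le> (1::real)" using ln_le_minus_one[of 2] by simp
    then show "0 \<le> w (i, b) \<and> w (i, b) \<le> 1" if "i < n" for i b
      using bspec[OF w(1), of "(i, b)"] that by auto
  qed
  finally show ?thesis by simp
qed

lemma swap_good_deterministic:
  assumes X: "finite V" and t: "t \<ge> 3 / 2" and s: "s \<in> signs n"
    and N: "\<And>v. N v = train_errors n x s v + ghost_errors n x s v"
    and c: "c = (\<lambda>v i. of_bool (x v i True) - of_bool (x v i False))"
    and vmin: "vmin \<in> V" "\<And>v. v \<in> V \<Longrightarrow> N vmin \<le> N v"
    and r: "r = 20 / 19 * (21 / 20 * N vmin + 20 * t + 10 * (h + 2 * t))"
    and W: "W = {v \<in> V. N v \<le> r}"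
    and E1: "h / 4 - 2 * t \<le> log_traces n V x s"
    and E2: "\<And>v. v \<in> V \<Longrightarrow> ghost_errors n x s v - train_errors n x s v \<le> 1 / 20 * N v + 10 * (h + 2 * t)"
    and E2': "train_errors n x s vmin - ghost_errors n x s vmin \<le> 1 / 20 * N vmin + 20 * t"
    and E3: "sign_max n W c s \<le> 2 * avg n (sign_max n W c) + sqrt (8 * r * t) + 4 * t"
    and E4: "avg n (sign_max n W c) \<le> 4 * avg n (sign_max n W (\<lambda>v i. of_bool (x v i (s i < 0)))) + 4 * t"
  shows "swap_good n t V x s"
  unfolding swap_good_def Let_def
proof (intro ballI impI)
  fix f assume f: "f \<in> V" and min: "\<forall>g\<in>V. train_errors n x s f \<le> train_errors n x s g"
  define H where "H = log_traces n V x s"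
  define m where "m = train_errors n x s f"
  define B where "B = ghost_errors n x s f"
  let ?U = "64 * H + 144 * t"
  let ?W' = "{g \<in> V. train_errors n x s g \<le> 16 * m + 15 * ?U}"
  have m0: "0 \<le> m" "0 \<le> B" by (simp_all add: m_def B_def)
  have h: "h \<le> 4 * H + 8 * t" using E1 by (simp add: H_def)
  have Nf: "N f = m + B" by (simp add: N m_def B_def)
  have f2: "B - m \<le> 1 / 20 * (m + B) + 10 * (h + 2 * t)"
    using E2[OF f] Nf by (simp add: m_def B_def)
  have \<rho>: "N vmin \<le> m + B" using vmin(2)[OF f] Nf by simp
  have mvmin: "2 * m \<le> 21 / 20 * N vmin + 20 * t"
  proof -
    have "m \<le> train_errors n x s vmin" using min vmin(1) by (simp add: m_def)
    then show ?thesis using E2' N[of vmin] by argo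
  qed
  have Nfr: "m + B \<le> r" using f2 mvmin unfolding r by argo
  have H0: "0 \<le> H"
    unfolding H_def log_traces_def using ntrace_pos[of "{..<n}" "(\<lambda>f i. x f i (s i < 0)) ` V"] f
    by (intro ln_ge_zero) (auto simp: Suc_le_eq)
  have r_le: "133225 * r \<le> 10000 * (32 * m + 28 * ?U)"
    using f2 \<rho> h t m0 H0 unfolding r by argo
  have fW: "f \<in> W" using f Nfr Nf by (simp add: W)
  have WV: "W \<subseteq> V" by (auto simp: W)
  have r0: "0 \<le> r" using Nfr m0 by simp
  have "r \<le> 16 * m + 15 * ?U"
    using r_le m0 H0 t by argo
  then have "W \<subseteq> ?W'"
    using N by (auto simp: W) (smt (verit) ghost_errors_nonneg)
  then have G: "avg n (sign_max n W (\<lambda>v i. of_bool (x v i (s i < 0)))) \<le> rademacher_sum n ?W' x s"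
    using fW X by (intro avg_sign_max_le_rademacher_sum) auto
  have "B - m \<le> sign_max n W c s"
    using sign_max_ge[of W f s c n] fW WV X finite_subset[OF WV X]
    by (simp add: m_def B_def ghost_minus_train_errors[OF s] c)
  then have dev: "B - m \<le> 8 * rademacher_sum n ?W' x s + 12 * t + sqrt (8 * r * t)"
    using E3 E4 G by argo
  have rt: "0 \<le> r * t" using r0 t by simp
  have sq: "(k * sqrt (r * t))\<^sup>2 = k\<^sup>2 * (r * t)" for k
    unfolding power_mult_distrib using rt by simp
  have "8 * (r * t) \<le> (283 / 100)\<^sup>2 * (r * t)"
    using rt by (intro mult_right_mono) (simp_all add: power2_eq_square)
  then have "8 * r * t \<le> (283 / 100 * sqrt (r * t))\<^sup>2"
    unfolding sq by simp
  then have "sqrt (8 * r * t) \<le> 283 / 100 * sqrt (r * t)"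
    using rt by (intro real_le_lsqrt) auto
  moreover have "sqrt B \<le> 82 / 100 * sqrt (r * t)"
  proof (rule real_le_lsqrt)
    have "B \<le> r * 1" using Nfr m0 by simp
    also have "r * 1 \<le> r * ((82 / 100)\<^sup>2 * t)"
      using r0 t by (intro mult_left_mono) (simp_all add: power2_eq_square)
    finally show "B \<le> (82 / 100 * sqrt (r * t))\<^sup>2"
      unfolding sq by (simp only: mult_ac)
  qed (use rt in auto)
  moreover have "365 / 100 * sqrt (r * t) \<le> 2 * sqrt (t * (8 * m + 7 * ?U))"
  proof -
    have "133225 * r * t \<le> 10000 * (32 * m + 28 * ?U) * t"
      using r_le t by (intro mult_right_mono) auto
    then have "(365 / 100)\<^sup>2 * (r * t) \<le> 2\<^sup>2 * (t * (8 * m + 7 * ?U))"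
      by (simp add: power2_eq_square algebra_simps)
    then have "sqrt ((365 / 100)\<^sup>2 * (r * t)) \<le> sqrt (2\<^sup>2 * (t * (8 * m + 7 * ?U)))"
      by (rule real_sqrt_le_mono)
    then show ?thesis by (simp only: real_sqrt_mult real_sqrt_abs)
  qed
  moreover have "x + y \<le> z" if "x \<le> 283 / 100 * S" "y \<le> 82 / 100 * S" "365 / 100 * S \<le> z" for x y z S :: real
    using that by linarith
  ultimately have "sqrt (8 * r * t) + sqrt B \<le> 2 * sqrt (t * (8 * m + 7 * ?U))" by metis
  then have "B - m + 1 + sqrt B \<le> 8 * rademacher_sum n ?W' x s + 20 * t + 2 * sqrt (t * (8 * m + 7 * ?U))"
    using dev t by linarith
  moreover have "3 * B + 6 \<le> 8 * m + 7 * ?U"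
  proof -
    have "216 \<le> ?U" using H0 t by simp
    then have "3 * y + 6 \<le> 8 * m + 7 * u"
      if "m + y \<le> r" "133225 * r \<le> 10000 * (32 * m + 28 * u)" "216 \<le> u" for u y
      using that m0(1) by argo
    from this[OF Nfr r_le] show ?thesis using \<open>216 \<le> ?U\<close> by blast
  qed
  ultimately show "ghost_errors n x s f - train_errors n x s f + 1 + sqrt (ghost_errors n x s f)
        \<le> 8 * rademacher_sum n {g \<in> V. train_errors n x s g \<le> 16 * train_errors n x s f + 15 * (64 * log_traces n V x s + 144 * t)} x s + 20 * t
          + 2 * sqrt (t * (8 * train_errors n x s f + 7 * (64 * log_traces n V x s + 144 * t)))
      \<and> 3 * ghost_errors n x s f + 6 \<le> 8 * train_errors n x s f + 7 * (64 * log_traces n V x s + 144 * t)"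
    unfolding m_def B_def H_def by blast
qed

lemma avg_swap_good:
  fixes V :: "(nat \<Rightarrow> bool \<Rightarrow> bool) set"
  assumes V: "finite V" "V \<noteq> {}" and supp: "\<And>v i b. v \<in> V \<Longrightarrow> n \<le> i \<Longrightarrow> \<not> v i b"
    and t: "t \<ge> 3 / 2"
  shows "avg n (\<lambda>s. of_bool (\<not> swap_good n t V (\<lambda>v. v) s)) \<le> 5 * exp (- 2 * t)"
proof -
  let ?x = "\<lambda>v::nat \<Rightarrow> bool \<Rightarrow> bool. v"
  define N where "N = (\<lambda>v::nat \<Rightarrow> bool \<Rightarrow> bool. \<Sum>i<n. of_bool (v i False) + of_bool (v i True) :: real)"
  define c :: "(nat \<Rightarrow> bool \<Rightarrow> bool) \<Rightarrow> nat \<Rightarrow> real"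
    where "c = (\<lambda>v i. of_bool (v i True) - of_bool (v i False))"
  define v0 where "v0 = arg_min_on N V"
  have v0: "v0 \<in> V" "\<And>v. v \<in> V \<Longrightarrow> N v0 \<le> N v"
    unfolding v0_def using V arg_min_if_finite[OF V, of N] by (auto simp: not_less)
  define h where "h = ln (card V)"
  have h0: "0 \<le> h" using V by (simp add: h_def Suc_le_eq card_gt_0_iff)
  define r where "r = 20 / 19 * (21 / 20 * N v0 + 20 * t + 10 * (h + 2 * t))"
  have N0: "0 \<le> N v" for v by (auto simp: N_def intro: sum_nonneg)
  have r0: "0 < r" using N0[of v0] h0 t by (simp add: r_def)
  define W where "W = {v \<in> V. N v \<le> r}"
  have finW: "finite W" using V by (simp add: W_def)
  have "N v0 \<le> r" using N0[of v0] h0 t by (simp add: r_def)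
  then have W0: "W \<noteq> {}" using v0(1) by (auto simp: W_def)
  have c_abs: "(\<Sum>i<n. \<bar>c v i\<bar>) \<le> N v" "(\<Sum>i<n. (c v i)\<^sup>2) \<le> N v" "(\<Sum>i<n. (- c v i)\<^sup>2) \<le> N v" for v
    by (auto simp: N_def c_def of_bool_def intro!: sum_mono)
  let ?e1 = "\<lambda>s. log_traces n V ?x s < ln (card V) / 4 - 2 * t"
  let ?e2 = "\<lambda>v s. (\<Sum>i<n. s i * c v i) > 1 / 20 * N v + 10 * (h + 2 * t)"
  let ?e2' = "\<lambda>s. (\<Sum>i<n. s i * (- c v0 i)) > 1 / 20 * N v0 + 20 * t"
  let ?e3 = "\<lambda>s. sign_max n W c s > 2 * avg n (sign_max n W c) + sqrt (8 * r * t) + 4 * t"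
  let ?e4 = "\<lambda>s. 4 * avg n (sign_max n W (\<lambda>v i. of_bool (v i (s i < 0)))) + 4 * t < avg n (sign_max n W c)"
  have "(of_bool (\<not> swap_good n t V ?x s) :: real)
      \<le> of_bool (?e1 s) + (\<Sum>v\<in>V. of_bool (?e2 v s)) + of_bool (?e2' s) + of_bool (?e3 s) + of_bool (?e4 s)"
    if s: "s \<in> signs n" for s
  proof (cases "?e1 s \<or> (\<exists>v\<in>V. ?e2 v s) \<or> ?e2' s \<or> ?e3 s \<or> ?e4 s")
    case True
    have nn: "0 \<le> (\<Sum>v\<in>V. of_bool (?e2 v s) :: real)" by (intro sum_nonneg) auto
    have "1 \<le> (\<Sum>v\<in>V. of_bool (?e2 v s) :: real)" if "v \<in> V" "?e2 v s" for v
      using member_le_sum[of v V "\<lambda>v. of_bool (?e2 v s) :: real"] that V by simp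
    then have "1 \<le> (of_bool (?e1 s) :: real) \<or> 1 \<le> (\<Sum>v\<in>V. of_bool (?e2 v s) :: real) \<or> 1 \<le> (of_bool (?e2' s) :: real)
        \<or> 1 \<le> (of_bool (?e3 s) :: real) \<or> 1 \<le> (of_bool (?e4 s) :: real)"
      using True by (elim disjE bexE) (simp_all only: of_bool_eq order_refl simp_thms)
    moreover have "0 \<le> (of_bool P :: real)" for P by simp
    ultimately have "1 \<le> of_bool (?e1 s) + (\<Sum>v\<in>V. of_bool (?e2 v s)) + of_bool (?e2' s) + of_bool (?e3 s) + (of_bool (?e4 s) :: real)"
      using nn by (smt (verit))
    moreover have "of_bool (\<not> swap_good n t V ?x s) \<le> (1::real)" by simp
    ultimately show ?thesis by linarith
  next
    case False
    have diff: "(\<Sum>i<n. s i * c v i) = ghost_errors n ?x s v - train_errors n ?x s v" for v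
      unfolding c_def using ghost_minus_train_errors[OF s, of ?x v] by simp
    have diff': "(\<Sum>i<n. s i * (- c v i)) = train_errors n ?x s v - ghost_errors n ?x s v" for v
      using diff[of v] by (simp add: sum_negf)
    have "swap_good n t V ?x s"
    proof (rule swap_good_deterministic[where N = N and vmin = v0 and h = h and r = r and W = W and c = c])
      show "N v = train_errors n ?x s v + ghost_errors n ?x s v" for v
        by (simp add: N_def train_plus_ghost_errors)
      show "ghost_errors n ?x s v - train_errors n ?x s v \<le> 1 / 20 * N v + 10 * (h + 2 * t)" if "v \<in> V" for v
        using False that diff[of v] by (auto simp: not_less)
      show "train_errors n ?x s v0 - ghost_errors n ?x s v0 \<le> 1 / 20 * N v0 + 20 * t"
        using False diff'[of v0] by (simp add: not_less)
    qed (use V t s v0 False in \<open>auto simp: c_def r_def W_def h_def not_less\<close>)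
    then show ?thesis by (auto intro!: add_nonneg_nonneg sum_nonneg)
  qed
  then have "avg n (\<lambda>s. of_bool (\<not> swap_good n t V ?x s))
      \<le> avg n (\<lambda>s. of_bool (?e1 s) + (\<Sum>v\<in>V. of_bool (?e2 v s)) + of_bool (?e2' s) + of_bool (?e3 s) + of_bool (?e4 s))"
    by (rule avg_mono)
  also have "\<dots> = avg n (\<lambda>s. of_bool (?e1 s)) + (\<Sum>v\<in>V. avg n (\<lambda>s. of_bool (?e2 v s)))
      + avg n (\<lambda>s. of_bool (?e2' s)) + avg n (\<lambda>s. of_bool (?e3 s)) + avg n (\<lambda>s. of_bool (?e4 s))"
    by (simp only: avg_add avg_sum)
  also have "\<dots> \<le> exp (- 2 * t) + exp (- 2 * t) + exp (- 2 * t) + exp (- 2 * t) + exp (- 2 * t)"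
  proof (intro add_mono)
    show "avg n (\<lambda>s. of_bool (?e1 s)) \<le> exp (- 2 * t)"
      by (rule shatter_lower_tail[OF V]) (rule supp)
    have "(\<Sum>v\<in>V. avg n (\<lambda>s. of_bool (?e2 v s))) \<le> (\<Sum>v\<in>V. exp (- 2 * (1 / 20) * (10 * (h + 2 * t))))"
      using c_abs by (intro sum_mono sign_sum_tail) auto
    also have "- 2 * (1 / 20) * (10 * (h + 2 * t)) = - (h + 2 * t)" by (simp add: field_simps)
    also have "(\<Sum>v\<in>V. exp (- (h + 2 * t))) = exp h * exp (- (h + 2 * t))"
      using V by (simp add: h_def card_gt_0_iff)
    also have "\<dots> = exp (- 2 * t)" by (simp flip: exp_add)
    finally show "(\<Sum>v\<in>V. avg n (\<lambda>s. of_bool (?e2 v s))) \<le> exp (- 2 * t)" .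
    have "avg n (\<lambda>s. of_bool (?e2' s)) \<le> exp (- 2 * (1 / 20) * (20 * t))"
      using c_abs by (intro sign_sum_tail) auto
    then show "avg n (\<lambda>s. of_bool (?e2' s)) \<le> exp (- 2 * t)" by simp
    show "avg n (\<lambda>s. of_bool (?e3 s)) \<le> exp (- 2 * t)"
    proof (rule sign_max_upper_tail[OF finW W0])
      show "(\<Sum>i<n. \<bar>c v i\<bar>) \<le> r" if "v \<in> W" for v
        using that c_abs(1)[of v] by (simp add: W_def)
    qed (use r0 t in \<open>auto simp: c_def of_bool_def\<close>)
    show "avg n (\<lambda>s. of_bool (?e4 s)) \<le> exp (- 2 * t)"
      unfolding c_def by (rule chosen_rademacher_lower_tail[OF finW W0])
  qed
  finally show ?thesis by simp
qed

section \<open>From losses to error patterns\<close>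

lemma swap_good_image: "swap_good n t (h ` X) x s = swap_good n t X (\<lambda>f. x (h f)) s"
proof -
  have "{g \<in> h ` X. P g} = h ` {g \<in> X. P (h g)}" for P by blast
  then show ?thesis
    by (simp add: swap_good_def log_traces_def rademacher_sum_def train_errors_def ghost_errors_def image_image)
qed

lemma swap_good_cong:
  assumes "\<And>f i b. f \<in> X \<Longrightarrow> i < n \<Longrightarrow> x f i b = y f i b"
  shows "swap_good n t X x s = swap_good n t X y s"
proof -
  have A: "train_errors n x s f = train_errors n y s f" if "f \<in> X" for f
    using assms[OF that] by (simp add: train_errors_def)
  have B: "ghost_errors n x s f = ghost_errors n y s f" if "f \<in> X" for f
    using assms[OF that] by (simp add: ghost_errors_def)
  have r: "restrict (\<lambda>i. x f i (s i < 0)) {..<n} = restrict (\<lambda>i. y f i (s i < 0)) {..<n}" if "f \<in> X" for f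
    by (rule ext) (simp add: restrict_def assms[OF that])
  have L: "log_traces n X x s = log_traces n X y s"
    unfolding log_traces_def ntrace_def image_image using r by (simp cong: image_cong)
  have R: "rademacher_sum n Y x s = rademacher_sum n Y y s" if "Y \<subseteq> X" for Y
  proof -
    have "(\<Sum>i<n. e i * of_bool (x f i (s i < 0))) = (\<Sum>i<n. e i * of_bool (y f i (s i < 0)) :: real)"
      if "f \<in> Y" for e f
      using assms[of f] \<open>f \<in> Y\<close> \<open>Y \<subseteq> X\<close> by (intro sum.cong) auto
    then show ?thesis unfolding rademacher_sum_def by (simp cong: SUP_cong)
  qed
  show ?thesis
  proof -
    have F: "{g \<in> X. train_errors n x s g \<le> c} = {g \<in> X. train_errors n y s g \<le> c}" for c
      using A by auto
    have "{g \<in> X. train_errors n y s g \<le> c} \<subseteq> X" for c by auto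
    then show ?thesis
      unfolding swap_good_def L Let_def F using A B R by simp
  qed
qed

lemma swap_good_swap:
  "swap_good n t X (\<lambda>f i b. x f i (b \<noteq> (s i < 0))) (\<lambda>_. 1) = swap_good n t X x s"
  by (simp add: swap_good_def train_errors_def ghost_errors_def log_traces_def rademacher_sum_def)

definition pairs_err :: "(nat \<times> bool \<Rightarrow> 'a \<times> bool) \<Rightarrow> ('a \<Rightarrow> bool) \<Rightarrow> nat \<Rightarrow> bool \<Rightarrow> bool" where
  "pairs_err \<omega> f i b \<longleftrightarrow> f (fst (\<omega> (i, b))) \<noteq> snd (\<omega> (i, b))"

definition pattern :: "nat \<Rightarrow> (nat \<times> bool \<Rightarrow> 'a \<times> bool) \<Rightarrow> ('a \<Rightarrow> bool) \<Rightarrow> nat \<Rightarrow> bool \<Rightarrow> bool" where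
  "pattern n \<omega> f i b \<longleftrightarrow> i < n \<and> pairs_err \<omega> f i b"

definition patterns :: "nat \<Rightarrow> (nat \<Rightarrow> bool \<Rightarrow> bool) set" where
  "patterns n = {v. \<forall>i b. n \<le> i \<longrightarrow> \<not> v i b}"

lemma finite_patterns: "finite (patterns n)"
proof -
  have "inj_on (\<lambda>v. restrict (\<lambda>(i, b). v i b) ({..<n} \<times> UNIV)) (patterns n)"
  proof (rule inj_onI)
    fix v v' assume v: "v \<in> patterns n" "v' \<in> patterns n"
      and eq: "restrict (\<lambda>(i, b). v i b) ({..<n} \<times> UNIV) = restrict (\<lambda>(i, b). v' i b) ({..<n} \<times> UNIV)"
    show "v = v'"
    proof (intro ext)
      fix i b show "v i b = v' i b"
        using v fun_cong[OF eq, of "(i, b)"] by (cases "i < n") (auto simp: patterns_def)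
    qed
  qed
  moreover have "(\<lambda>v. restrict (\<lambda>(i, b). v i b) ({..<n} \<times> UNIV)) ` patterns n
      \<subseteq> ({..<n} \<times> UNIV) \<rightarrow>\<^sub>E (UNIV :: bool set)" by auto
  ultimately show ?thesis
    by (meson finite_PiE finite_SigmaI finite_lessThan finite finite_imageD finite_subset)
qed

lemma pattern_in_patterns: "pattern n \<omega> ` G \<subseteq> patterns n"
  by (auto simp: pattern_def patterns_def)

lemma swap_good_pattern:
  "swap_good n t G (pairs_err \<omega>) s = swap_good n t (pattern n \<omega> ` G) (\<lambda>v. v) s"
  unfolding swap_good_image by (rule swap_good_cong) (simp add: pattern_def)

lemma avg_swap_good_sample:
  assumes "G \<noteq> {}" "t \<ge> 3 / 2"
  shows "avg n (\<lambda>s. of_bool (\<not> swap_good n t G (pairs_err \<omega>) s)) \<le> 5 * exp (- 2 * t)"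
  unfolding swap_good_pattern
  using assms finite_subset[OF pattern_in_patterns finite_patterns]
  by (intro avg_swap_good) (auto simp: pattern_def)

definition join_samples :: "nat \<Rightarrow> (nat \<Rightarrow> 'a) \<Rightarrow> (nat \<Rightarrow> 'a) \<Rightarrow> nat \<times> bool \<Rightarrow> 'a" where
  "join_samples n D D' = (\<lambda>p\<in>{..<n} \<times> UNIV. if snd p then D' (fst p) else D (fst p))"

lemma emp_loss_count:
  assumes "n \<ge> 1"
  shows "real n * emp_loss n D f = (\<Sum>i<n. of_bool (f (fst (D i)) \<noteq> snd (D i)))"
  using assms by (simp add: emp_loss_def of_bool_def)

lemma emp_loss_nonneg: "0 \<le> emp_loss n D f"
  by (auto simp: emp_loss_def intro!: divide_nonneg_nonneg sum_nonneg)

lemma train_errors_join: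
  assumes "n \<ge> 1"
  shows "train_errors n (pairs_err (join_samples n D D')) (\<lambda>_. 1) f = n * emp_loss n D f"
  using assms by (simp add: emp_loss_count train_errors_def pairs_err_def join_samples_def)

lemma ghost_errors_join:
  assumes "n \<ge> 1"
  shows "ghost_errors n (pairs_err (join_samples n D D')) (\<lambda>_. 1) f = n * emp_loss n D' f"
  using assms by (simp add: emp_loss_count ghost_errors_def pairs_err_def join_samples_def)

lemma log_traces_join:
  "log_traces n G (pairs_err (join_samples n D D')) (\<lambda>_. 1) = ln (shatter G n D)"
proof -
  let ?L = "(\<lambda>f. map (\<lambda>i. f (fst (D i))) [0..<n]) ` G"
  let ?h = "\<lambda>l. \<lambda>i\<in>{..<n}. l ! i \<noteq> snd (D i)"
  have "inj_on ?h ?L"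
  proof (rule inj_onI)
    fix l l' assume l: "l \<in> ?L" "l' \<in> ?L" and eq: "?h l = ?h l'"
    have "l ! i = l' ! i" if "i < n" for i
      using fun_cong[OF eq, of i] that by auto
    then show "l = l'" using l by (intro nth_equalityI) auto
  qed
  then have "card ?L = card (?h ` ?L)" by (simp add: card_image)
  also have "?h ` ?L = (\<lambda>v. restrict v {..<n}) ` (\<lambda>f i. pairs_err (join_samples n D D') f i ((1::real) < 0)) ` G"
    unfolding image_image by (intro image_cong refl ext) (auto simp: pairs_err_def join_samples_def)
  finally show ?thesis by (simp add: log_traces_def ntrace_def shatter_def)
qed

lemma rademacher_sum_join:
  assumes n: "n \<ge> 1" and X: "X \<noteq> {}"
  shows "rademacher_sum n X (pairs_err (join_samples n D D')) (\<lambda>_. 1) = n * rademacher n D X"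
proof -
  define g where "g = (\<lambda>e f. \<Sum>i<n. e i * (if f (fst (D i)) \<noteq> snd (D i) then 1 else 0 :: real))"
  have fin: "finite (g e ` X)" for e
  proof -
    have that: "g e f = g e f'" if "pattern n (join_samples n D D) f = pattern n (join_samples n D D) f'" for f f'
    proof -
      have "(f (fst (D i)) \<noteq> snd (D i)) = (f' (fst (D i)) \<noteq> snd (D i))" if "i < n" for i
        using fun_cong[OF fun_cong[OF \<open>pattern n (join_samples n D D) f = pattern n (join_samples n D D) f'\<close>], of i False] that
        by (simp add: pattern_def pairs_err_def join_samples_def)
      then show ?thesis unfolding g_def by (intro sum.cong) auto
    qed
    have "g e ` X \<subseteq> (\<lambda>v. g e (inv_into X (pattern n (join_samples n D D)) v)) ` (pattern n (join_samples n D D) ` X)"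
    proof (intro subsetI, elim imageE)
      fix z f assume "z = g e f" "f \<in> X"
      then show "z \<in> (\<lambda>v. g e (inv_into X (pattern n (join_samples n D D)) v)) ` (pattern n (join_samples n D D) ` X)"
        using that[of f "inv_into X (pattern n (join_samples n D D)) (pattern n (join_samples n D D) f)"]
        unfolding image_image by (intro image_eqI[of _ _ f]) (simp_all add: f_inv_into_f)
    qed
    then show ?thesis
      using finite_subset[OF pattern_in_patterns finite_patterns] by (meson finite_imageI finite_subset)
  qed
  have sup: "Sup ((\<lambda>f. g e f / real n) ` X) = Sup (g e ` X) / real n" for e
  proof -
    have "mono (\<lambda>y. y / real n)" using n by (auto intro!: monoI divide_right_mono)
    then have "Max (g e ` X) / real n = Max ((\<lambda>y. y / real n) ` g e ` X)"
      using fin X by (intro mono_Max_commute) auto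
    moreover have "finite ((\<lambda>y. y / real n) ` g e ` X)" using fin by blast
    ultimately show ?thesis using fin[of e] X
      by (simp add: cSup_eq_Max image_image)
  qed
  have "rademacher_sum n X (pairs_err (join_samples n D D')) (\<lambda>_. 1) = avg n (\<lambda>e. Sup (g e ` X))"
  proof -
    have "(\<Sum>i<n. e i * of_bool (pairs_err (join_samples n D D') f i ((1::real) < 0))) = g e f" for e f
      unfolding g_def by (rule sum.cong) (auto simp: pairs_err_def join_samples_def)
    then show ?thesis unfolding rademacher_sum_def by simp
  qed
  moreover have "real n * rademacher n D X = avg n (\<lambda>e. real n * Sup ((\<lambda>f. g e f / real n) ` X))"
    unfolding avg_cmult by (simp add: rademacher_def avg_def signs_def g_def)
  ultimately show ?thesis using n by (simp add: sup)
qed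

lemma ln_prod_nonneg:
  assumes "n \<ge> 1" "k \<ge> 1"
  shows "0 \<le> ln (real (n * k))"
  using assms by (intro ln_ge_zero) (metis mult_le_mono nat_mult_1 of_nat_1 of_nat_mono)

lemma u_hat_nonneg:
  assumes "n \<ge> 1" "k \<ge> 1" "G \<noteq> {}"
  shows "0 \<le> u_hat G n k D"
proof -
  have "finite ((\<lambda>f. map (\<lambda>i. f (fst (D i))) [0..<n]) ` G)"
    by (rule finite_subset[OF _ finite_lists_length_eq[of UNIV n]]) auto
  then have "1 \<le> shatter G n D" using assms by (auto simp: shatter_def Suc_le_eq card_gt_0_iff)
  then show ?thesis
    unfolding u_hat_def using ln_prod_nonneg[OF assms(1,2)]
    by (intro divide_nonneg_nonneg mult_nonneg_nonneg add_nonneg_nonneg) auto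
qed

lemma F_hat_nonempty:
  assumes "n \<ge> 1" "k \<ge> 1" "f \<in> G"
  shows "F_hat G n k f D \<noteq> {}"
proof -
  have "G \<noteq> {}" using assms by auto
  then have "f \<in> F_hat G n k f D"
    using assms u_hat_nonneg[of n k G D] emp_loss_nonneg[of n D f] by (simp add: F_hat_def)
  then show ?thesis by blast
qed

lemma swap_good_join:
  assumes n: "n \<ge> 1" and k: "k \<ge> 1"
    and good: "swap_good n (ln (real (n * k))) G (pairs_err (join_samples n D D')) (\<lambda>_. 1)"
    and f: "f \<in> G" "\<And>g. g \<in> G \<Longrightarrow> emp_loss n D f \<le> emp_loss n D g"
  shows "n * emp_loss n D' f - n * emp_loss n D f + 1 + sqrt (n * emp_loss n D' f)
      \<le> n * (8 * rademacher n D (F_hat G n k f D) + 20 * ln (real (n * k)) / n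
          + 2 * sqrt (ln (real (n * k)) / n) * sqrt (8 * emp_loss n D f + 7 * u_hat G n k D))"
    and "3 * (n * emp_loss n D' f) + 6 \<le> n * (8 * emp_loss n D f + 7 * u_hat G n k D)"
proof -
  let ?t = "ln (real (n * k))"
  let ?x = "pairs_err (join_samples n D D')"
  define U where "U = 64 * log_traces n G ?x (\<lambda>_. 1) + 144 * ?t"
  have U: "U = n * u_hat G n k D"
    unfolding U_def u_hat_def log_traces_join using n by (simp add: field_simps)
  have "{g \<in> G. train_errors n ?x (\<lambda>_. 1) g \<le> 16 * train_errors n ?x (\<lambda>_. 1) f + 15 * U}
      = {g \<in> G. n * emp_loss n D g \<le> n * (16 * emp_loss n D f + 15 * u_hat G n k D)}"
    unfolding train_errors_join[OF n] U by (simp add: algebra_simps)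
  also have "\<dots> = F_hat G n k f D" using n by (simp add: F_hat_def)
  finally have Fh: "{g \<in> G. train_errors n ?x (\<lambda>_. 1) g \<le> 16 * train_errors n ?x (\<lambda>_. 1) f + 15 * U} = F_hat G n k f D" .
  have ne: "F_hat G n k f D \<noteq> {}" by (rule F_hat_nonempty[OF n k f(1)])
  have min: "\<forall>g\<in>G. train_errors n ?x (\<lambda>_. 1) f \<le> train_errors n ?x (\<lambda>_. 1) g"
    unfolding train_errors_join[OF n] using f(2) by (auto intro: mult_left_mono)
  have main: "ghost_errors n ?x (\<lambda>_. 1) f - train_errors n ?x (\<lambda>_. 1) f + 1 + sqrt (ghost_errors n ?x (\<lambda>_. 1) f)
      \<le> 8 * rademacher_sum n (F_hat G n k f D) ?x (\<lambda>_. 1) + 20 * ?t + 2 * sqrt (?t * (8 * train_errors n ?x (\<lambda>_. 1) f + 7 * U))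
    \<and> 3 * ghost_errors n ?x (\<lambda>_. 1) f + 6 \<le> 8 * train_errors n ?x (\<lambda>_. 1) f + 7 * U"
    using good f(1) min unfolding swap_good_def Let_def U_def[symmetric] Fh[symmetric] by blast
  have sq: "sqrt (?t * (8 * (n * emp_loss n D f) + 7 * U))
      = n * (sqrt (?t / n) * sqrt (8 * emp_loss n D f + 7 * u_hat G n k D))"
  proof -
    have "?t * (8 * (n * emp_loss n D f) + 7 * U) = (real n)\<^sup>2 * (?t / n * (8 * emp_loss n D f + 7 * u_hat G n k D))"
      unfolding U using n by (simp add: power2_eq_square algebra_simps)
    then show ?thesis by (simp only: real_sqrt_mult real_sqrt_abs abs_of_nat)
  qed
  show "n * emp_loss n D' f - n * emp_loss n D f + 1 + sqrt (n * emp_loss n D' f)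
      \<le> n * (8 * rademacher n D (F_hat G n k f D) + 20 * ?t / n
          + 2 * sqrt (?t / n) * sqrt (8 * emp_loss n D f + 7 * u_hat G n k D))"
    using conjunct1[OF main] n unfolding train_errors_join[OF n] ghost_errors_join[OF n] rademacher_sum_join[OF n ne] sq
    by (simp add: algebra_simps)
  show "3 * (n * emp_loss n D' f) + 6 \<le> n * (8 * emp_loss n D f + 7 * u_hat G n k D)"
    using conjunct2[OF main] unfolding train_errors_join[OF n] ghost_errors_join[OF n] U by (simp add: algebra_simps)
qed

section \<open>Symmetrization\<close>

locale labelled_sample = prob_space \<mu>
  for \<mu> :: "('a::topological_space \<times> bool) measure" +
  assumes sets_mu: "sets \<mu> = sets (borel \<Otimes>\<^sub>M count_space UNIV)"
begin

abbreviation sample :: "nat \<Rightarrow> (nat \<Rightarrow> 'a \<times> bool) measure" where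
  "sample n \<equiv> Pi\<^sub>M {..<n} (\<lambda>_. \<mu>)"

abbreviation double_sample :: "nat \<Rightarrow> (nat \<times> bool \<Rightarrow> 'a \<times> bool) measure" where
  "double_sample n \<equiv> Pi\<^sub>M ({..<n} \<times> UNIV) (\<lambda>_. \<mu>)"

lemma space_mu: "space \<mu> = UNIV"
  using sets_eq_imp_space_eq[OF sets_mu] by (simp add: space_pair_measure)

lemma product_prob_mu: "product_prob_space (\<lambda>_. \<mu>)"
  by unfold_locales

lemma prob_space_sample: "prob_space (sample n)"
  by (intro prob_space_PiM prob_space_axioms)

lemma prob_space_double_sample: "prob_space (double_sample n)"
  by (intro prob_space_PiM prob_space_axioms)

lemma label_measurable: "(\<lambda>z. (fst z, snd z \<noteq> c)) \<in> \<mu> \<rightarrow>\<^sub>M \<mu>"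
proof -
  have "(\<lambda>z. (fst z, snd z \<noteq> c)) \<in> borel \<Otimes>\<^sub>M count_space UNIV \<rightarrow>\<^sub>M borel \<Otimes>\<^sub>M count_space (UNIV :: bool set)"
    by measurable
  then show ?thesis using sets_mu measurable_cong_sets by blast
qed

lemma error_measurable [measurable]:
  assumes "f \<in> classifiers"
  shows "(\<lambda>z. f (fst z) \<noteq> snd z) \<in> \<mu> \<rightarrow>\<^sub>M count_space UNIV"
proof -
  have [measurable]: "f \<in> borel \<rightarrow>\<^sub>M count_space UNIV" using assms by (simp add: classifiers_def)
  have "(\<lambda>z. f (fst z) \<noteq> snd z) \<in> borel \<Otimes>\<^sub>M count_space UNIV \<rightarrow>\<^sub>M count_space (UNIV :: bool set)"
    by measurable
  then show ?thesis using sets_mu measurable_cong_sets by blast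
qed

lemma emp_loss_measurable:
  assumes "f \<in> classifiers"
  shows "(\<lambda>D. emp_loss n D f) \<in> borel_measurable (sample n)"
proof -
  have "(\<lambda>D. if f (fst (D i)) \<noteq> snd (D i) then 1 else 0 :: real) \<in> borel_measurable (sample n)" if "i < n" for i
  proof -
    have "(\<lambda>D. D i) \<in> sample n \<rightarrow>\<^sub>M \<mu>" using that by (intro measurable_component_singleton) auto
    then have "(\<lambda>D. f (fst (D i)) \<noteq> snd (D i)) \<in> sample n \<rightarrow>\<^sub>M count_space UNIV"
      using measurable_compose[OF _ error_measurable[OF assms]] by blast
    then show ?thesis by measurable
  qed
  then show ?thesis
    unfolding emp_loss_def by (intro borel_measurable_divide borel_measurable_sum borel_measurable_const) auto
qed

text \<open>Measurability of the infimum of the empirical loss over all samples, also those with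
  altered labels, says which error patterns a class realises on a given sample.\<close>

lemma pattern_measurable:
  assumes G: "G \<noteq> {}" and v: "v \<in> patterns n" and n: "n \<ge> 1"
    and meas: "(\<lambda>D. SUP f\<in>G. - emp_loss (2 * n) D f) \<in> borel_measurable (sample (2 * n))"
  shows "{\<omega> \<in> space (double_sample n). v \<in> pattern n \<omega> ` G} \<in> sets (double_sample n)"
proof -
  define relabel where "relabel = (\<lambda>\<omega>. \<lambda>j\<in>{..<2 * n}. (fst (\<omega> (j div 2, odd j)), snd (\<omega> (j div 2, odd j)) \<noteq> v (j div 2) (odd j)) :: 'a \<times> bool)"
  have "relabel \<in> double_sample n \<rightarrow>\<^sub>M sample (2 * n)"
    unfolding relabel_def
  proof (rule measurable_restrict)
    fix j assume "j \<in> {..<2 * n}"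
    then have "(\<lambda>\<omega>. \<omega> (j div 2, odd j)) \<in> double_sample n \<rightarrow>\<^sub>M \<mu>"
      by (intro measurable_component_singleton) auto
    then show "(\<lambda>\<omega>. (fst (\<omega> (j div 2, odd j)), snd (\<omega> (j div 2, odd j)) \<noteq> v (j div 2) (odd j))) \<in> double_sample n \<rightarrow>\<^sub>M \<mu>"
      by (rule measurable_compose[OF _ label_measurable])
  qed
  then have m: "(\<lambda>\<omega>. SUP f\<in>G. - emp_loss (2 * n) (relabel \<omega>) f) \<in> borel_measurable (double_sample n)"
    by (rule measurable_compose[OF _ meas])
  have "v \<in> pattern n \<omega> ` G \<longleftrightarrow> - (1 / (2 * n)) < (SUP f\<in>G. - emp_loss (2 * n) (relabel \<omega>) f)" for \<omega>
  proof -
    have "(- (1 / (2 * n)) < (SUP f\<in>G. - emp_loss (2 * n) (relabel \<omega>) f))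
      \<longleftrightarrow> (\<exists>f\<in>G. - (1 / (2 * n)) < - emp_loss (2 * n) (relabel \<omega>) f)"
      using G emp_loss_nonneg by (intro less_cSUP_iff bdd_aboveI2[where M = 0]) auto
    also have "\<dots> \<longleftrightarrow> (\<exists>f\<in>G. \<forall>j<2 * n. f (fst (relabel \<omega> j)) = snd (relabel \<omega> j))"
    proof (intro bex_cong refl)
      fix f
      let ?e = "\<lambda>j. if f (fst (relabel \<omega> j)) \<noteq> snd (relabel \<omega> j) then 1 else 0 :: real"
      have "- (1 / (2 * n)) < - emp_loss (2 * n) (relabel \<omega>) f \<longleftrightarrow> (\<Sum>j<2 * n. ?e j) < 1"
        using n by (simp add: emp_loss_def field_simps)
      also have "\<dots> \<longleftrightarrow> (\<forall>j<2 * n. f (fst (relabel \<omega> j)) = snd (relabel \<omega> j))"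
      proof
        assume lt: "(\<Sum>j<2 * n. ?e j) < 1"
        show "\<forall>j<2 * n. f (fst (relabel \<omega> j)) = snd (relabel \<omega> j)"
        proof (intro allI impI)
          fix j assume "j < 2 * n"
          then have "?e j \<le> (\<Sum>j<2 * n. ?e j)" by (intro member_le_sum) auto
          then have "?e j < 1" using lt by linarith
          then show "f (fst (relabel \<omega> j)) = snd (relabel \<omega> j)" by (simp split: if_splits)
        qed
      next
        assume "\<forall>j<2 * n. f (fst (relabel \<omega> j)) = snd (relabel \<omega> j)"
        then have "(\<Sum>j<2 * n. ?e j) = 0" by (intro sum.neutral) auto
        then show "(\<Sum>j<2 * n. ?e j) < 1" by simp
      qed
      finally show "(- (1 / (2 * n)) < - emp_loss (2 * n) (relabel \<omega>) f) = (\<forall>j<2 * n. f (fst (relabel \<omega> j)) = snd (relabel \<omega> j))" .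
    qed
    also have "\<dots> \<longleftrightarrow> (\<exists>f\<in>G. \<forall>i<n. \<forall>b. pairs_err \<omega> f i b = v i b)"
    proof (intro bex_cong refl)
      fix f
      have *: "f (fst (relabel \<omega> j)) = snd (relabel \<omega> j) \<longleftrightarrow> pairs_err \<omega> f (j div 2) (odd j) = v (j div 2) (odd j)"
        if "j < 2 * n" for j
        using that by (auto simp: relabel_def pairs_err_def)
      show "(\<forall>j<2 * n. f (fst (relabel \<omega> j)) = snd (relabel \<omega> j)) = (\<forall>i<n. \<forall>b. pairs_err \<omega> f i b = v i b)"
      proof
        assume L: "\<forall>j<2 * n. f (fst (relabel \<omega> j)) = snd (relabel \<omega> j)"
        show "\<forall>i<n. \<forall>b. pairs_err \<omega> f i b = v i b"
        proof (intro allI impI)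
          fix i b assume "i < n"
          then have j: "2 * i + of_bool b < 2 * n" by (cases b) auto
          show "pairs_err \<omega> f i b = v i b" using L[rule_format, OF j] *[OF j] by (cases b) auto
        qed
      next
        assume "\<forall>i<n. \<forall>b. pairs_err \<omega> f i b = v i b"
        then show "\<forall>j<2 * n. f (fst (relabel \<omega> j)) = snd (relabel \<omega> j)"
          using * by (auto simp: less_mult_imp_div_less mult.commute)
      qed
    qed
    also have "\<dots> \<longleftrightarrow> v \<in> pattern n \<omega> ` G"
    proof -
      have "(\<forall>i<n. \<forall>b. pairs_err \<omega> f i b = v i b) \<longleftrightarrow> v = pattern n \<omega> f" for f
        using v by (auto simp: pattern_def patterns_def fun_eq_iff not_less[symmetric])
      then show ?thesis by blast
    qed
    finally show ?thesis ..
  qed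
  then have "{\<omega> \<in> space (double_sample n). v \<in> pattern n \<omega> ` G}
     = {\<omega> \<in> space (double_sample n). - (1 / (2 * n)) < (SUP f\<in>G. - emp_loss (2 * n) (relabel \<omega>) f)}" by blast
  also have "\<dots> \<in> sets (double_sample n)" using m by measurable
  finally show ?thesis .
qed

lemma pattern_event_measurable:
  assumes "G \<noteq> {}" "n \<ge> 1"
    and "(\<lambda>D. SUP f\<in>G. - emp_loss (2 * n) D f) \<in> borel_measurable (sample (2 * n))"
  shows "{\<omega> \<in> space (double_sample n). Q (pattern n \<omega> ` G)} \<in> sets (double_sample n)"
proof -
  let ?S = "\<lambda>v. {\<omega> \<in> space (double_sample n). v \<in> pattern n \<omega> ` G}"
  have S: "?S v \<in> sets (double_sample n)" if "v \<in> patterns n" for v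
    using pattern_measurable[OF assms(1) that assms(2,3)] .
  have eq: "{\<omega> \<in> space (double_sample n). pattern n \<omega> ` G = V}
      = {\<omega> \<in> space (double_sample n). \<forall>v\<in>patterns n. \<omega> \<in> ?S v \<longleftrightarrow> v \<in> V}" if "V \<subseteq> patterns n" for V
    using that pattern_in_patterns[of n _ G] by blast
  have sV: "{\<omega> \<in> space (double_sample n). pattern n \<omega> ` G = V} \<in> sets (double_sample n)" if "V \<subseteq> patterns n" for V
    unfolding eq[OF that]
  proof (intro sets.sets_Collect_finite_All finite_patterns)
    fix v assume "v \<in> patterns n"
    note S[OF this, measurable]
    show "{\<omega> \<in> space (double_sample n). \<omega> \<in> ?S v \<longleftrightarrow> v \<in> V} \<in> sets (double_sample n)"
      by measurable
  qed
  have "{\<omega> \<in> space (double_sample n). Q (pattern n \<omega> ` G)}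
     = (\<Union>V\<in>{V \<in> Pow (patterns n). Q V}. {\<omega> \<in> space (double_sample n). pattern n \<omega> ` G = V})"
    using pattern_in_patterns[of n _ G] by blast
  also have "\<dots> \<in> sets (double_sample n)"
    using finite_patterns sV by (intro sets.finite_UN) auto
  finally show ?thesis .
qed

lemma distr_swap:
  "distr (double_sample n) (double_sample n) (\<lambda>\<omega>. \<lambda>p\<in>{..<n} \<times> UNIV. \<omega> (fst p, snd p \<noteq> (s (fst p) < (0::real)))) = double_sample n"
  using prob_space_axioms
  by (intro distr_PiM_reindex[where M = "\<lambda>_. \<mu>"]) (auto simp: inj_on_def)

lemma prob_bad_swap:
  assumes G: "G \<noteq> {}" and n: "n \<ge> 1" and t: "t \<ge> 3 / 2"
    and meas: "(\<lambda>D. SUP f\<in>G. - emp_loss (2 * n) D f) \<in> borel_measurable (sample (2 * n))"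
  shows "measure (double_sample n) {\<omega> \<in> space (double_sample n). \<not> swap_good n t G (pairs_err \<omega>) (\<lambda>_. 1)} \<le> 5 * exp (- 2 * t)"
proof -
  interpret Q: prob_space "double_sample n" by (rule prob_space_double_sample)
  define E where "E = (\<lambda>s. {\<omega> \<in> space (double_sample n). \<not> swap_good n t G (pairs_err \<omega>) s})"
  have E: "E s \<in> sets (double_sample n)" for s
    unfolding E_def swap_good_pattern by (rule pattern_event_measurable[OF G n meas])
  have same: "measure (double_sample n) (E s) = measure (double_sample n) (E (\<lambda>_. 1))" for s
  proof -
    let ?\<pi> = "\<lambda>\<omega>. \<lambda>p\<in>{..<n} \<times> UNIV. \<omega> (fst p, snd p \<noteq> (s (fst p) < (0::real)))"
    have \<pi>: "?\<pi> \<in> double_sample n \<rightarrow>\<^sub>M double_sample n"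
      by (intro measurable_restrict measurable_component_singleton) auto
    have "swap_good n t G (pairs_err (?\<pi> \<omega>)) (\<lambda>_. 1) = swap_good n t G (pairs_err \<omega>) s" for \<omega>
    proof -
      have "swap_good n t G (pairs_err (?\<pi> \<omega>)) (\<lambda>_. 1)
          = swap_good n t G (\<lambda>f i b. pairs_err \<omega> f i (b \<noteq> (s i < 0))) (\<lambda>_. 1)"
        by (rule swap_good_cong) (simp add: pairs_err_def)
      then show ?thesis by (simp only: swap_good_swap)
    qed
    then have "?\<pi> -` E (\<lambda>_. 1) \<inter> space (double_sample n) = E s"
      using measurable_space[OF \<pi>] by (auto simp: E_def)
    then have "measure (distr (double_sample n) (double_sample n) ?\<pi>) (E (\<lambda>_. 1)) = measure (double_sample n) (E s)"
      using measure_distr[OF \<pi> E] by simp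
    then show ?thesis unfolding distr_swap by simp
  qed
  have "2 ^ n * measure (double_sample n) (E (\<lambda>_. 1)) = (\<Sum>s\<in>signs n. measure (double_sample n) (E (\<lambda>_. 1)))"
    by simp
  also have "\<dots> = (\<Sum>s\<in>signs n. measure (double_sample n) (E s))"
    by (intro sum.cong refl same[symmetric])
  also have "\<dots> = (\<Sum>s\<in>signs n. \<integral>\<omega>. indicator (E s) \<omega> \<partial>double_sample n)"
    using E by simp
  also have "\<dots> = (\<integral>\<omega>. (\<Sum>s\<in>signs n. indicator (E s) \<omega>) \<partial>double_sample n)"
    using E by (intro Bochner_Integration.integral_sum[symmetric]) (auto simp: integrable_indicator_iff less_top[symmetric])
  also have "\<dots> \<le> (\<integral>\<omega>. 2 ^ n * (5 * exp (- 2 * t)) \<partial>double_sample n)"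
  proof (rule integral_mono)
    show "integrable (double_sample n) (\<lambda>\<omega>. \<Sum>s\<in>signs n. indicator (E s) \<omega> :: real)"
      using E by (intro Bochner_Integration.integrable_sum) (auto simp: less_top[symmetric])
    fix \<omega> assume "\<omega> \<in> space (double_sample n)"
    then have "(\<Sum>s\<in>signs n. indicator (E s) \<omega>) = 2 ^ n * avg n (\<lambda>s. of_bool (\<not> swap_good n t G (pairs_err \<omega>) s))"
      by (simp add: avg_def E_def indicator_def of_bool_def)
    also have "\<dots> \<le> 2 ^ n * (5 * exp (- 2 * t))"
      using avg_swap_good_sample[OF G t] by (intro mult_left_mono) auto
    finally show "(\<Sum>s\<in>signs n. indicator (E s) \<omega>) \<le> 2 ^ n * (5 * exp (- 2 * t))" .
  qed simp
  also have "\<dots> = 2 ^ n * (5 * exp (- 2 * t))" by (simp add: Q.prob_space)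
  finally show ?thesis by (simp add: E_def)
qed

lemma join_measurable: "(\<lambda>(D, D'). join_samples n D D') \<in> sample n \<Otimes>\<^sub>M sample n \<rightarrow>\<^sub>M double_sample n"
  unfolding join_samples_def split_beta
proof (rule measurable_restrict)
  fix p :: "nat \<times> bool" assume p: "p \<in> {..<n} \<times> UNIV"
  then have "(\<lambda>D. D (fst p)) \<in> sample n \<rightarrow>\<^sub>M \<mu>"
    by (intro measurable_component_singleton) auto
  then show "(\<lambda>x. if snd p then snd x (fst p) else fst x (fst p)) \<in> sample n \<Otimes>\<^sub>M sample n \<rightarrow>\<^sub>M \<mu>"
    by (cases "snd p") (auto intro: measurable_compose[OF measurable_fst] measurable_compose[OF measurable_snd])
qed

lemma distr_join:
  "distr (sample n \<Otimes>\<^sub>M sample n) (double_sample n) (\<lambda>(D, D'). join_samples n D D') = double_sample n"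
proof -
  interpret PP: product_prob_space "\<lambda>_. \<mu>" by (rule product_prob_mu)
  interpret P: prob_space "sample n" by (rule prob_space_sample)
  show ?thesis
  proof (rule PP.PiM_eqI)
    fix A assume A: "\<And>p. p \<in> {..<n} \<times> (UNIV :: bool set) \<Longrightarrow> A p \<in> sets \<mu>"
    have "(\<lambda>(D, D'). join_samples n D D') -` Pi\<^sub>E ({..<n} \<times> UNIV) A \<inter> space (sample n \<Otimes>\<^sub>M sample n)
        = Pi\<^sub>E {..<n} (\<lambda>i. A (i, False)) \<times> Pi\<^sub>E {..<n} (\<lambda>i. A (i, True))"
      (is "?L = ?R")
    proof (intro set_eqI)
      fix x :: "(nat \<Rightarrow> 'a \<times> bool) \<times> (nat \<Rightarrow> 'a \<times> bool)"
      obtain D D' where x: "x = (D, D')" by (cases x)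
      have "join_samples n D D' \<in> Pi\<^sub>E ({..<n} \<times> UNIV) A
          \<longleftrightarrow> (\<forall>i<n. \<forall>b. (if b then D' i else D i) \<in> A (i, b))"
        unfolding join_samples_def PiE_iff by (simp add: Ball_def)
      also have "\<dots> \<longleftrightarrow> (\<forall>i<n. D i \<in> A (i, False)) \<and> (\<forall>i<n. D' i \<in> A (i, True))"
        by (simp add: all_bool_eq) blast
      finally show "x \<in> ?L \<longleftrightarrow> x \<in> ?R"
        unfolding x by (simp add: space_pair_measure space_PiM space_mu PiE_iff Ball_def) blast
    qed
    then have "emeasure (distr (sample n \<Otimes>\<^sub>M sample n) (double_sample n) (\<lambda>(D, D'). join_samples n D D')) (Pi\<^sub>E ({..<n} \<times> UNIV) A)
        = emeasure (sample n \<Otimes>\<^sub>M sample n) (Pi\<^sub>E {..<n} (\<lambda>i. A (i, False)) \<times> Pi\<^sub>E {..<n} (\<lambda>i. A (i, True)))"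
      using A by (subst emeasure_distr[OF join_measurable]) (auto intro!: sets_PiM_I_finite)
    also have "\<dots> = emeasure (sample n) (Pi\<^sub>E {..<n} (\<lambda>i. A (i, False))) * emeasure (sample n) (Pi\<^sub>E {..<n} (\<lambda>i. A (i, True)))"
      using A by (intro P.emeasure_pair_measure_Times sets_PiM_I_finite) auto
    also have "\<dots> = (\<Prod>i<n. emeasure \<mu> (A (i, False)) * emeasure \<mu> (A (i, True)))"
    proof -
      have "A (i, b) \<in> sets \<mu>" if "i < n" for i b using A that by simp
      then have "emeasure (sample n) (Pi\<^sub>E {..<n} (\<lambda>i. A (i, b))) = (\<Prod>i<n. emeasure \<mu> (A (i, b)))" for b
        using PP.emeasure_PiM[of "{..<n}" "\<lambda>i. A (i, b)"] by simp
      then show ?thesis by (simp add: prod.distrib)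
    qed
    also have "\<dots> = (\<Prod>i<n. \<Prod>b\<in>UNIV. emeasure \<mu> (A (i, b)))"
      by (simp add: UNIV_bool)
    also have "\<dots> = (\<Prod>p\<in>{..<n} \<times> UNIV. emeasure \<mu> (A p))"
      by (simp add: prod.cartesian_product)
    finally show "emeasure (distr (sample n \<Otimes>\<^sub>M sample n) (double_sample n) (\<lambda>(D, D'). join_samples n D D')) (Pi\<^sub>E ({..<n} \<times> UNIV) A)
        = (\<Prod>p\<in>{..<n} \<times> UNIV. emeasure \<mu> (A p))" .
  qed auto
qed

text \<open>Working with the set of first halves whose section of \<open>E\<close> is large avoids any measurability
  requirement on the functions selected from the data.\<close>

lemma bad_first_half:
  assumes E: "E \<in> sets (double_sample n)" and a: "a > 0"
  obtains B where "B \<in> sets (sample n)" "measure (sample n) B \<le> measure (double_sample n) E / a"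
    "\<And>D. D \<in> space (sample n) - B \<Longrightarrow> {D' \<in> space (sample n). join_samples n D D' \<in> E} \<in> sets (sample n)
        \<and> measure (sample n) {D' \<in> space (sample n). join_samples n D D' \<in> E} < a"
proof -
  interpret P: prob_space "sample n" by (rule prob_space_sample)
  interpret Q: prob_space "double_sample n" by (rule prob_space_double_sample)
  let ?J = "\<lambda>(D, D'). join_samples n D D'"
  define E' where "E' = ?J -` E \<inter> space (sample n \<Otimes>\<^sub>M sample n)"
  have E': "E' \<in> sets (sample n \<Otimes>\<^sub>M sample n)"
    unfolding E'_def using join_measurable E by (rule measurable_sets)
  have sec: "Pair D -` E' = {D' \<in> space (sample n). join_samples n D D' \<in> E}" if "D \<in> space (sample n)" for D
    using that by (auto simp: E'_def space_pair_measure)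
  have secm: "Pair D -` E' \<in> sets (sample n)" for D
    using E' by (rule sets_Pair1)
  define g where "g = (\<lambda>D. emeasure (sample n) (Pair D -` E'))"
  have g[measurable]: "g \<in> borel_measurable (sample n)"
    unfolding g_def using P.measurable_emeasure_Pair[OF E'] .
  define B where "B = {D \<in> space (sample n). ennreal a \<le> g D}"
  have B: "B \<in> sets (sample n)" unfolding B_def by measurable
  have "ennreal a * emeasure (sample n) B = (\<integral>\<^sup>+D. ennreal a * indicator B D \<partial>sample n)"
    using B by (simp add: nn_integral_cmult)
  also have "\<dots> \<le> (\<integral>\<^sup>+D. g D \<partial>sample n)"
    by (intro nn_integral_mono) (auto simp: B_def indicator_def)
  also have "\<dots> = emeasure (sample n \<Otimes>\<^sub>M sample n) E'"
    unfolding g_def using P.emeasure_pair_measure_alt[OF E'] ..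
  also have "\<dots> = emeasure (distr (sample n \<Otimes>\<^sub>M sample n) (double_sample n) ?J) E"
    unfolding E'_def by (rule emeasure_distr[OF join_measurable E, symmetric])
  also have "\<dots> = emeasure (double_sample n) E" by (simp only: distr_join)
  finally have "ennreal (a * measure (sample n) B) \<le> ennreal (measure (double_sample n) E)"
    using a by (simp add: P.emeasure_eq_measure Q.emeasure_eq_measure ennreal_mult)
  then have "measure (sample n) B \<le> measure (double_sample n) E / a"
    using a by (simp add: pos_le_divide_eq mult.commute)
  moreover have "{D' \<in> space (sample n). join_samples n D D' \<in> E} \<in> sets (sample n)
        \<and> measure (sample n) {D' \<in> space (sample n). join_samples n D D' \<in> E} < a"
    if "D \<in> space (sample n) - B" for D
    using that sec[of D] secm[of D] a
    by (auto simp: B_def g_def P.emeasure_eq_measure not_le ennreal_less_iff)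
  ultimately show ?thesis using that B by blast
qed

end

section \<open>Deviation bounds\<close>

lemma rademacher_sum_pattern: "rademacher_sum n X (pairs_err \<omega>) s = rademacher_sum n (pattern n \<omega> ` X) (\<lambda>v. v) s"
proof -
  have "(\<Sum>i<n. e i * of_bool (pairs_err \<omega> f i (s i < 0))) = (\<Sum>i<n. e i * of_bool (pattern n \<omega> f i (s i < 0)) :: real)"
    for e f by (rule sum.cong) (auto simp: pattern_def)
  then show ?thesis unfolding rademacher_sum_def image_image by simp
qed

lemma rademacher_nonneg:
  assumes n: "n \<ge> 1" and X: "X \<noteq> {}"
  shows "0 \<le> rademacher n D X"
proof -
  let ?V = "pattern n (join_samples n D D) ` X"
  have V: "finite ?V" "?V \<noteq> {}"
    using X finite_subset[OF pattern_in_patterns finite_patterns] by auto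
  have "0 \<le> avg n (sign_max n ?V (\<lambda>v i. of_bool (v i ((1::real) < 0))))"
    by (rule avg_sign_max_nonneg[OF V])
  also have "\<dots> \<le> rademacher_sum n ?V (\<lambda>v. v) (\<lambda>_. 1)"
    using avg_sign_max_le_rademacher_sum[of ?V ?V n "\<lambda>v. v" "\<lambda>_. 1"] V by simp
  also have "\<dots> = n * rademacher n D X"
    using rademacher_sum_join[OF n X, of D D] by (simp only: rademacher_sum_pattern)
  finally show ?thesis using n by (simp add: zero_le_mult_iff)
qed

lemma penalty_nonneg:
  assumes "n \<ge> 1" "k \<ge> 1" "f \<in> G"
  shows "0 \<le> penalty G n k f D"
proof -
  have "G \<noteq> {}" using assms by auto
  then have "0 \<le> 8 * emp_loss n D f + 7 * u_hat G n k D"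
    using u_hat_nonneg[of n k G D] emp_loss_nonneg[of n D f] assms by simp
  then show ?thesis
    unfolding penalty_def
    using rademacher_nonneg[OF assms(1) F_hat_nonempty[OF assms], of D D] ln_prod_nonneg[OF assms(1,2)]
    by auto
qed

lemma emp_loss_le_1: "emp_loss n D f \<le> 1"
proof (cases "n = 0")
  case False
  have "(\<Sum>i<n. if f (fst (D i)) \<noteq> snd (D i) then 1 else 0 :: real) \<le> (\<Sum>i<n. 1)"
    by (intro sum_mono) auto
  then show ?thesis using False by (simp add: emp_loss_def)
qed (simp add: emp_loss_def)

lemma exp_3_half_le: "exp (3 / 2) \<le> (5::real)"
proof -
  have "exp (1 / 8) \<le> 1 + 1 / 8 + (1 / 8 :: real)\<^sup>2" by (rule exp_bound) auto
  then have "exp (1 / 8 :: real) ^ 12 \<le> (1 + 1 / 8 + (1 / 8)\<^sup>2) ^ 12"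
    by (intro power_mono) auto
  also have "\<dots> \<le> (5::real)" by (simp add: power2_eq_square) (simp add: field_simps)
  also have "exp (1 / 8 :: real) ^ 12 = exp (3 / 2)" by (simp flip: exp_of_nat_mult)
  finally show ?thesis .
qed

lemma ln_sample_ge:
  assumes "n \<ge> 5" "k \<ge> 1"
  shows "3 / 2 \<le> ln (real (n * k))"
proof -
  have "5 \<le> n * k" using mult_le_mono[OF assms] by simp
  then have "exp (3 / 2) \<le> real (n * k)" using exp_3_half_le by linarith
  then show ?thesis by (subst ln_ge_iff) (use assms in auto)
qed

lemma exp_minus_2_ln:
  assumes "n \<ge> 1" "k \<ge> 1"
  shows "exp (- 2 * ln (real (n * k))) = 1 / (real n * real k)\<^sup>2"
proof -
  have "exp (- 2 * ln (real (n * k))) = inverse (exp (ln (real (n * k))) ^ 2)"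
    by (simp add: exp_minus flip: exp_of_nat_mult)
  then show ?thesis using assms by (simp add: inverse_eq_divide)
qed

lemma sum_inverse_squares:
  "summable (\<lambda>k. 1 / (real (Suc k))\<^sup>2)" "(\<Sum>k. 1 / (real (Suc k))\<^sup>2) \<le> 5 / 3"
proof -
  have step: "(\<Sum>k<Suc N. 1 / (real (Suc k))\<^sup>2) \<le> 5 / 3 - 1 / (real N + 3 / 2)" for N
  proof (induction N)
    case (Suc N)
    let ?x = "real N + 2"
    let ?a = "real N + 3 / 2"
    have "?x\<^sup>2 - 1 / 4 = ?a * (?a + 1)" by (simp add: power2_eq_square algebra_simps)
    moreover have inv: "1 / a - 1 / (a + 1) = 1 / (a * (a + 1))" if "a > 0" for a :: real
      using that by (simp add: field_simps)
    have "1 / ?a - 1 / (?a + 1) = 1 / (?a * (?a + 1))" by (rule inv) simp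
    ultimately have "1 / ?a - 1 / (?a + 1) = 1 / (?x\<^sup>2 - 1 / 4)" by (simp only:)
    moreover have "1 / ?x\<^sup>2 \<le> 1 / (?x\<^sup>2 - 1 / 4)"
    proof (rule divide_left_mono)
      have "2\<^sup>2 \<le> ?x\<^sup>2" by (rule power_mono) auto
      then show "0 < ?x\<^sup>2 * (?x\<^sup>2 - 1 / 4)" by (intro mult_pos_pos) auto
    qed auto
    ultimately have "1 / ?x\<^sup>2 \<le> 1 / (real N + 3 / 2) - 1 / (real (Suc N) + 3 / 2)"
      by (simp add: add_ac)
    moreover have "(\<Sum>k<Suc (Suc N). 1 / (real (Suc k))\<^sup>2) = (\<Sum>k<Suc N. 1 / (real (Suc k))\<^sup>2) + 1 / ?x\<^sup>2"
      by (simp add: add_ac)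
    ultimately show ?case using Suc.IH by linarith
  qed simp
  have le: "(\<Sum>k<N. 1 / (real (Suc k))\<^sup>2) \<le> 5 / 3" for N
  proof (cases N)
    case (Suc M)
    have "5 / 3 - 1 / (real M + 3 / 2) \<le> 5 / 3" by simp
    from order_trans[OF step this] show ?thesis unfolding Suc .
  qed simp
  show "summable (\<lambda>k. 1 / (real (Suc k))\<^sup>2)"
    using le by (intro summableI_nonneg_bounded[where x = "5 / 3"]) auto
  then show "(\<Sum>k. 1 / (real (Suc k))\<^sup>2) \<le> 5 / 3"
    using le by (rule suminf_le_const)
qed

context labelled_sample
begin

lemma loss_bounds: "0 \<le> loss \<mu> f" "loss \<mu> f \<le> 1"
  by (auto simp: loss_def)

lemma error_event:
  assumes "f \<in> classifiers"
  shows "{z \<in> space \<mu>. f (fst z) \<noteq> snd z} \<in> sets \<mu>"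
  using error_measurable[OF assms] by measurable

lemma integral_error:
  assumes f: "f \<in> classifiers"
  shows "integrable \<mu> (\<lambda>z. g (f (fst z) \<noteq> snd z) :: real)"
    and "(\<integral>z. g (f (fst z) \<noteq> snd z) \<partial>\<mu>) = g False + loss \<mu> f * (g True - g False)"
proof -
  let ?A = "{z \<in> space \<mu>. f (fst z) \<noteq> snd z}"
  have eq: "g (f (fst z) \<noteq> snd z) = g False + (g True - g False) * indicator ?A z" if "z \<in> space \<mu>" for z
    using that by (auto simp: indicator_def)
  have int: "integrable \<mu> (\<lambda>z. (g True - g False) * indicator ?A z)"
    using error_event[OF f] by (intro integrable_mult_right integrable_real_indicator) (auto simp: less_top[symmetric])
  have "integrable \<mu> (\<lambda>z. g False + (g True - g False) * indicator ?A z)"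
    using int by (intro Bochner_Integration.integrable_add) auto
  then show "integrable \<mu> (\<lambda>z. g (f (fst z) \<noteq> snd z))"
    by (subst Bochner_Integration.integrable_cong[OF refl eq])
  have "(\<integral>z. g (f (fst z) \<noteq> snd z) \<partial>\<mu>) = (\<integral>z. g False + (g True - g False) * indicator ?A z \<partial>\<mu>)"
    by (rule Bochner_Integration.integral_cong[OF refl eq])
  also have "\<dots> = g False + (g True - g False) * measure \<mu> ?A"
    using int error_event[OF f] by (subst Bochner_Integration.integral_add) (auto simp: prob_space)
  finally show "(\<integral>z. g (f (fst z) \<noteq> snd z) \<partial>\<mu>) = g False + loss \<mu> f * (g True - g False)"
    by (simp add: loss_def mult.commute)
qed

lemma emp_loss_integral:
  assumes f: "f \<in> classifiers" and n: "n \<ge> 1"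
  shows "integrable (sample n) (\<lambda>D. emp_loss n D f)" "(\<integral>D. emp_loss n D f \<partial>sample n) = loss \<mu> f"
proof -
  interpret P: prob_space "sample n" by (rule prob_space_sample)
  interpret PP: product_prob_space "\<lambda>_. \<mu>" by (rule product_prob_mu)
  show "integrable (sample n) (\<lambda>D. emp_loss n D f)"
    using emp_loss_measurable[OF f] emp_loss_nonneg emp_loss_le_1
    by (intro P.integrable_const_bound[where B = 1] AE_I2) (auto simp: abs_of_nonneg[OF emp_loss_nonneg])
  let ?g = "\<lambda>b. if b then 1 else 0 :: real"
  have comp: "(\<integral>D. ?g (f (fst (D i)) \<noteq> snd (D i)) \<partial>sample n) = loss \<mu> f"
    and int: "integrable (sample n) (\<lambda>D. ?g (f (fst (D i)) \<noteq> snd (D i)))" if "i < n" for i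
  proof -
    have d: "distr (sample n) \<mu> (\<lambda>D. D i) = \<mu>"
      using distr_PiM_component[of "{..<n}" "\<lambda>_. \<mu>" i] that prob_space_axioms by simp
    have m: "(\<lambda>D. D i) \<in> sample n \<rightarrow>\<^sub>M \<mu>" using that by (intro measurable_component_singleton) auto
    have gm: "(\<lambda>z. ?g (f (fst z) \<noteq> snd z)) \<in> borel_measurable \<mu>"
      using integral_error(1)[OF f, of ?g] by (rule borel_measurable_integrable)
    show "(\<integral>D. ?g (f (fst (D i)) \<noteq> snd (D i)) \<partial>sample n) = loss \<mu> f"
      using integral_distr[OF m gm] integral_error(2)[OF f, of ?g] by (simp add: d)
    show "integrable (sample n) (\<lambda>D. ?g (f (fst (D i)) \<noteq> snd (D i)))"
      using integrable_distr_eq[OF m gm] integral_error(1)[OF f, of ?g] by (simp add: d)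
  qed
  have "(\<integral>D. emp_loss n D f \<partial>sample n) = (\<Sum>i<n. \<integral>D. ?g (f (fst (D i)) \<noteq> snd (D i)) \<partial>sample n) / n"
    unfolding emp_loss_def using int by (simp add: Bochner_Integration.integral_sum)
  also have "\<dots> = loss \<mu> f" using n comp by simp
  finally show "(\<integral>D. emp_loss n D f \<partial>sample n) = loss \<mu> f" .
qed

lemma emp_loss_chernoff:
  assumes f: "f \<in> classifiers" and n: "n \<ge> 1"
  shows "measure (sample n) {D \<in> space (sample n). a \<le> l * (n * emp_loss n D f)}
    \<le> exp (n * loss \<mu> f * (exp l - 1) - a)"
proof -
  interpret P: prob_space "sample n" by (rule prob_space_sample)
  interpret PP: product_prob_space "\<lambda>_. \<mu>" by (rule product_prob_mu)
  let ?g = "\<lambda>z. exp (l * of_bool (f (fst z) \<noteq> snd z)) :: real"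
  let ?S = "{D \<in> space (sample n). a \<le> l * (n * emp_loss n D f)}"
  have S: "?S \<in> sets (sample n)"
    using emp_loss_measurable[OF f, of n] by simp
  have gint: "integrable \<mu> ?g" and gval: "(\<integral>z. ?g z \<partial>\<mu>) = 1 + loss \<mu> f * (exp l - 1)"
    using integral_error[OF f, of "\<lambda>b. exp (l * of_bool b)"] by auto
  have exp_eq: "exp (l * (n * emp_loss n D f)) = (\<Prod>i<n. ?g (D i))" for D
    by (simp only: emp_loss_count[OF n] sum_distrib_left exp_sum[OF finite_lessThan])
  have int: "integrable (sample n) (\<lambda>D. exp (- a) * (\<Prod>i<n. ?g (D i)))"
    by (intro integrable_mult_right PP.product_integrable_prod gint) auto
  have "measure (sample n) ?S = (\<integral>D. indicator ?S D \<partial>sample n)" using S by simp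
  also have "\<dots> \<le> (\<integral>D. exp (- a) * (\<Prod>i<n. ?g (D i)) \<partial>sample n)"
  proof (rule integral_mono[OF _ int])
    show "integrable (sample n) (indicator ?S :: _ \<Rightarrow> real)"
      using S by (auto simp: less_top[symmetric])
    fix D
    have "(indicator ?S D :: real) \<le> exp (- a) * exp (l * (n * emp_loss n D f))"
      by (auto simp: indicator_def simp flip: exp_add)
    then show "(indicator ?S D :: real) \<le> exp (- a) * (\<Prod>i<n. ?g (D i))"
      by (simp only: exp_eq)
  qed
  also have "\<dots> = exp (- a) * (1 + loss \<mu> f * (exp l - 1)) ^ n"
    using PP.product_integral_prod[of "{..<n}" "\<lambda>_. ?g"] gint gval by simp
  also have "\<dots> \<le> exp (- a) * exp (loss \<mu> f * (exp l - 1)) ^ n"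
  proof (intro mult_left_mono power_mono exp_ge_add_one_self)
    have "loss \<mu> f * (exp l - 1) \<ge> loss \<mu> f * (- 1)"
      using loss_bounds by (intro mult_left_mono) auto
    then show "0 \<le> 1 + loss \<mu> f * (exp l - 1)" using loss_bounds(2)[of f] by linarith
  qed auto
  also have "\<dots> = exp (n * loss \<mu> f * (exp l - 1) - a)"
    by (simp add: mult.assoc flip: exp_of_nat_mult exp_add)
  finally show ?thesis .
qed

lemma emp_loss_lower_tail:
  assumes f: "f \<in> classifiers" and n: "n \<ge> 1"
  shows "measure (sample n) {D \<in> space (sample n). n * emp_loss n D f < n * loss \<mu> f - sqrt (n * loss \<mu> f)} \<le> 62 / 100"
proof (cases "loss \<mu> f = 0")
  case True
  have "\<not> real n * emp_loss n D f < 0" for D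
    using emp_loss_nonneg[of n D f] by (simp add: mult_less_0_iff not_less)
  then show ?thesis using True by simp
next
  case False
  interpret P: prob_space "sample n" by (rule prob_space_sample)
  define M where "M = n * loss \<mu> f"
  have M: "M > 0" using False loss_bounds(1)[of f] n by (simp add: M_def less_le)
  define l where "l = 1 / sqrt M"
  have l: "l > 0" "M * l\<^sup>2 = 1" "l * sqrt M = 1"
    using M by (simp_all add: l_def power_divide)
  have exp_le: "exp (- x) \<le> 1 - x + x\<^sup>2 / 2" if "x \<ge> 0" for x :: real
  proof -
    have "(1 - x + x\<^sup>2 / 2) * (1 + x + x\<^sup>2 / 2) = 1 + (x\<^sup>2)\<^sup>2 / 4"
      by (simp add: power2_eq_square field_simps)
    then have "1 \<le> (1 - x + x\<^sup>2 / 2) * (1 + x + x\<^sup>2 / 2)" by simp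
    also have "\<dots> \<le> (1 - x + x\<^sup>2 / 2) * exp x"
    proof (intro mult_left_mono exp_lower_Taylor_quadratic that)
      have eq: "1 - x + x\<^sup>2 / 2 = ((1 - x)\<^sup>2 + 1) / 2" by (simp add: power2_eq_square field_simps)
      show "0 \<le> 1 - x + x\<^sup>2 / 2" unfolding eq by simp
    qed
    finally show ?thesis by (simp add: exp_minus field_simps)
  qed
  have "M * (exp (- l) - 1) \<le> M * (- l + l\<^sup>2 / 2)"
    using exp_le[of l] l(1) M by (intro mult_left_mono) auto
  also have "\<dots> = 1 / 2 - l * M" using l(2) by (simp add: algebra_simps)
  finally have e: "M * (exp (- l) - 1) - (- l * (M - sqrt M)) \<le> - (1 / 2)"
    using l(3) by (simp add: algebra_simps)
  have "{D \<in> space (sample n). n * emp_loss n D f < n * loss \<mu> f - sqrt (n * loss \<mu> f)}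
      \<subseteq> {D \<in> space (sample n). - l * (M - sqrt M) \<le> - l * (n * emp_loss n D f)}"
    using l(1) by (auto simp: M_def)
  then have "measure (sample n) {D \<in> space (sample n). n * emp_loss n D f < n * loss \<mu> f - sqrt (n * loss \<mu> f)}
      \<le> measure (sample n) {D \<in> space (sample n). - l * (M - sqrt M) \<le> - l * (n * emp_loss n D f)}"
    using emp_loss_measurable[OF f, of n] by (intro P.finite_measure_mono) simp_all
  also have "\<dots> \<le> exp (M * (exp (- l) - 1) - (- l * (M - sqrt M)))"
    using emp_loss_chernoff[OF f n, of "- l * (M - sqrt M)" "- l"] by (simp add: M_def)
  also have "\<dots> \<le> exp (- (1 / 2))" using e by simp
  also have "\<dots> \<le> 62 / 100"
    using exp_lower_Taylor_quadratic[of "1 / 2"] by (simp add: exp_minus field_simps power2_eq_square)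
  finally show ?thesis .
qed

lemma emp_loss_upper_tail:
  assumes f: "f \<in> classifiers" and n: "n \<ge> 1" and t: "t > 0"
  shows "measure (sample n) {D \<in> space (sample n). n * loss \<mu> f + sqrt (8 * t * (n * loss \<mu> f)) + 4 * t < n * emp_loss n D f}
    \<le> exp (- 2 * t)"
proof -
  interpret P: prob_space "sample n" by (rule prob_space_sample)
  define M where "M = n * loss \<mu> f"
  have M: "M \<ge> 0" using loss_bounds(1)[of f] n by (simp add: M_def)
  define y where "y = M + sqrt (8 * t * M) + 4 * t"
  define l where "l = (if M \<ge> 2 * t then sqrt (2 * t / M) else 1)"
  have l: "0 < l" "l \<le> 1" using t by (auto simp: l_def)
  have "M * (exp l - 1) \<le> M * (l + l\<^sup>2)"
    using exp_bound[of l] l M by (intro mult_left_mono) auto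
  also have "\<dots> - l * y \<le> - 2 * t"
  proof (cases "M \<ge> 2 * t")
    case True
    have l2: "M * l\<^sup>2 = 2 * t" using True t by (simp add: l_def)
    have "l * sqrt (8 * t * M) = sqrt (2 * t / M * (8 * t * M))"
      by (simp only: l_def True if_True real_sqrt_mult[symmetric])
    also have "2 * t / M * (8 * t * M) = (4 * t)\<^sup>2" using True t by (simp add: power2_eq_square)
    finally have "l * sqrt (8 * t * M) = 4 * t"
      unfolding real_sqrt_abs using t by simp
    moreover have "0 \<le> l * (4 * t)" using l t by simp
    ultimately show ?thesis using l2 by (simp add: y_def algebra_simps)
  next
    case False
    have "M < 2 * t" using False by simp
    moreover have "0 \<le> sqrt (8 * t * M)" using M t by simp
    ultimately have "2 * M - (M + sqrt (8 * t * M) + 4 * t) \<le> - 2 * t" using t by linarith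
    then show ?thesis using False by (simp add: y_def l_def)
  qed
  finally have e: "M * (exp l - 1) - l * y \<le> - 2 * t" by simp
  have "{D \<in> space (sample n). n * loss \<mu> f + sqrt (8 * t * (n * loss \<mu> f)) + 4 * t < n * emp_loss n D f}
      \<subseteq> {D \<in> space (sample n). l * y \<le> l * (n * emp_loss n D f)}"
    using l(1) by (auto simp: M_def y_def)
  then have "measure (sample n) {D \<in> space (sample n). n * loss \<mu> f + sqrt (8 * t * (n * loss \<mu> f)) + 4 * t < n * emp_loss n D f}
      \<le> measure (sample n) {D \<in> space (sample n). l * y \<le> l * (n * emp_loss n D f)}"
    using emp_loss_measurable[OF f, of n] by (intro P.finite_measure_mono) simp_all
  also have "\<dots> \<le> exp (M * (exp l - 1) - l * y)"
    using emp_loss_chernoff[OF f n, of "l * y" l] by (simp add: M_def)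
  also have "\<dots> \<le> exp (- 2 * t)" using e by simp
  finally show ?thesis .
qed

lemma empirical_minimizer_bound:
  assumes n: "n \<ge> 5" and k: "k \<ge> 1" and G: "G \<noteq> {}" "G \<subseteq> classifiers"
    and meas: "(\<lambda>D. SUP f\<in>G. - emp_loss (2 * n) D f) \<in> borel_measurable (sample (2 * n))"
  obtains B where "B \<in> sets (sample n)" "measure (sample n) B \<le> 5 / (38 / 100) / (real n * real k)\<^sup>2"
    "\<And>D f. D \<in> space (sample n) - B \<Longrightarrow> f \<in> G \<Longrightarrow> (\<And>g. g \<in> G \<Longrightarrow> emp_loss n D f \<le> emp_loss n D g) \<Longrightarrow>
       loss \<mu> f \<le> emp_loss n D f + penalty G n k f D \<and> 2 * loss \<mu> f \<le> 8 * emp_loss n D f + 7 * u_hat G n k D"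
proof -
  interpret P: prob_space "sample n" by (rule prob_space_sample)
  have n1: "n \<ge> 1" using n by simp
  let ?t = "ln (real (n * k))"
  define E where "E = {\<omega> \<in> space (double_sample n). \<not> swap_good n ?t G (pairs_err \<omega>) (\<lambda>_. 1)}"
  have E: "E \<in> sets (double_sample n)"
    unfolding E_def swap_good_pattern by (rule pattern_event_measurable[OF G(1) n1 meas])
  have mE: "measure (double_sample n) E \<le> 5 / (real n * real k)\<^sup>2"
    using prob_bad_swap[OF G(1) n1 ln_sample_ge[OF n k] meas] exp_minus_2_ln[OF n1 k] by (simp add: E_def)
  obtain B where B: "B \<in> sets (sample n)" "measure (sample n) B \<le> measure (double_sample n) E / (38 / 100)"
    "\<And>D. D \<in> space (sample n) - B \<Longrightarrow> {D' \<in> space (sample n). join_samples n D D' \<in> E} \<in> sets (sample n)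
        \<and> measure (sample n) {D' \<in> space (sample n). join_samples n D D' \<in> E} < 38 / 100"
    by (rule bad_first_half[OF E, of "38 / 100"]) auto
  show ?thesis
  proof (rule that[OF B(1)])
    show "measure (sample n) B \<le> 5 / (38 / 100) / (real n * real k)\<^sup>2"
      using B(2) mE by simp
    fix D f assume D: "D \<in> space (sample n) - B" and f: "f \<in> G"
      and min: "\<And>g. g \<in> G \<Longrightarrow> emp_loss n D f \<le> emp_loss n D g"
    let ?S1 = "{D' \<in> space (sample n). join_samples n D D' \<in> E}"
    let ?S2 = "{D' \<in> space (sample n). n * emp_loss n D' f < n * loss \<mu> f - sqrt (n * loss \<mu> f)}"
    have fc: "f \<in> classifiers" using f G by auto
    have S2: "?S2 \<in> sets (sample n)" using emp_loss_measurable[OF fc, of n] by simp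
    have "measure (sample n) (?S1 \<union> ?S2) \<le> measure (sample n) ?S1 + measure (sample n) ?S2"
      using B(3)[OF D] S2 by (intro measure_Un_le) auto
    also have "\<dots> < 1" using B(3)[OF D] emp_loss_lower_tail[OF fc n1] by linarith
    finally have "?S1 \<union> ?S2 \<noteq> space (sample n)" using P.prob_space by force
    then obtain D' where D': "D' \<in> space (sample n)" "join_samples n D D' \<notin> E"
      "\<not> n * emp_loss n D' f < n * loss \<mu> f - sqrt (n * loss \<mu> f)" by blast
    have "join_samples n D D' \<in> space (double_sample n)"
      using measurable_space[OF join_measurable, of "(D, D')" n] D D'(1) by (simp add: space_pair_measure)
    then have good: "swap_good n ?t G (pairs_err (join_samples n D D')) (\<lambda>_. 1)"
      using D'(2) by (simp add: E_def)
    define b where "b = n * emp_loss n D' f"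
    define x where "x = sqrt (n * loss \<mu> f)"
    have b0: "0 \<le> b" by (simp add: b_def emp_loss_nonneg)
    have x: "x\<^sup>2 = n * loss \<mu> f" "0 \<le> x" using loss_bounds(1)[of f] by (simp_all add: x_def)
    have xb: "x\<^sup>2 - x \<le> b" using D'(3) by (simp add: x(1) b_def) (simp add: x_def)
    have "x \<le> 1 + sqrt b"
    proof (rule ccontr)
      assume "\<not> x \<le> 1 + sqrt b"
      then have "(1 + sqrt b) * sqrt b < x * (x - 1)"
        using b0 by (intro mult_strict_mono') auto
      also have "x * (x - 1) = x\<^sup>2 - x" by (simp add: power2_eq_square algebra_simps)
      finally show False using xb b0 real_sqrt_ge_zero[OF b0] by (simp add: algebra_simps)
    qed
    then have nL: "n * loss \<mu> f \<le> b + 1 + sqrt b" using xb x(1) by linarith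
    have amgm: "2 * sqrt b \<le> b + 1"
      using zero_le_power2[of "sqrt b - 1"] b0 by (simp add: power2_diff)
    note J = swap_good_join[OF n1 k good f min]
    let ?pen = "8 * rademacher n D (F_hat G n k f D) + 20 * ?t / n
          + 2 * sqrt (?t / n) * sqrt (8 * emp_loss n D f + 7 * u_hat G n k D)"
    have "n * (loss \<mu> f - emp_loss n D f) \<le> n * ?pen"
      using J(1) nL unfolding b_def by (simp add: algebra_simps)
    then have "loss \<mu> f - emp_loss n D f \<le> ?pen"
      using n1 by (simp only: mult_le_cancel_left_pos of_nat_0_less_iff)
    moreover have "loss \<mu> f - emp_loss n D f \<le> 1"
      using loss_bounds(2)[of f] emp_loss_nonneg[of n D f] by linarith
    ultimately have "loss \<mu> f \<le> emp_loss n D f + penalty G n k f D"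
      unfolding penalty_def by linarith
    moreover have "n * (2 * loss \<mu> f) \<le> n * (8 * emp_loss n D f + 7 * u_hat G n k D)"
      using J(2) nL amgm b0 unfolding b_def by linarith
    then have "2 * loss \<mu> f \<le> 8 * emp_loss n D f + 7 * u_hat G n k D"
      using n1 by (simp only: mult_le_cancel_left_pos of_nat_0_less_iff)
    ultimately show "loss \<mu> f \<le> emp_loss n D f + penalty G n k f D
        \<and> 2 * loss \<mu> f \<le> 8 * emp_loss n D f + 7 * u_hat G n k D" ..
  qed
qed

lemma countable_union_bound:
  assumes B: "\<And>k. k \<ge> 1 \<Longrightarrow> B k \<in> sets (sample n)"
    and mB: "\<And>k. k \<ge> 1 \<Longrightarrow> measure (sample n) (B k) \<le> c / (real n * real k)\<^sup>2"
    and c: "c \<ge> 0"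
  shows "(\<Union>k\<in>{1..}. B k) \<in> sets (sample n)" "measure (sample n) (\<Union>k\<in>{1..}. B k) \<le> c * (5 / 3) / (real n)\<^sup>2"
proof -
  interpret P: prob_space "sample n" by (rule prob_space_sample)
  have eq: "(\<Union>k\<in>{1..}. B k) = (\<Union>k. B (Suc k))"
  proof -
    have "{1..} = range Suc" by (auto simp: image_iff) (metis Suc_le_D)
    then show ?thesis by (simp add: image_image)
  qed
  have le: "measure (sample n) (B (Suc k)) \<le> c / (real n)\<^sup>2 * (1 / (real (Suc k))\<^sup>2)" for k
    using mB[of "Suc k"] by (simp add: power_mult_distrib)
  have sm: "summable (\<lambda>k. c / (real n)\<^sup>2 * (1 / (real (Suc k))\<^sup>2))"
    by (intro summable_mult sum_inverse_squares)
  have smB: "summable (\<lambda>k. measure (sample n) (B (Suc k)))"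
    using le by (intro summable_comparison_test'[OF sm]) auto
  show "(\<Union>k\<in>{1..}. B k) \<in> sets (sample n)" unfolding eq using B by auto
  have "measure (sample n) (\<Union>k. B (Suc k)) \<le> (\<Sum>k. measure (sample n) (B (Suc k)))"
    using B smB by (intro P.finite_measure_subadditive_countably) auto
  also have "\<dots> \<le> (\<Sum>k. c / (real n)\<^sup>2 * (1 / (real (Suc k))\<^sup>2))"
    by (intro suminf_le le smB sm)
  also have "\<dots> = c / (real n)\<^sup>2 * (\<Sum>k. 1 / (real (Suc k))\<^sup>2)"
    by (intro suminf_mult sum_inverse_squares)
  also have "\<dots> \<le> c / (real n)\<^sup>2 * (5 / 3)"
    using c by (intro mult_left_mono sum_inverse_squares) auto
  finally show "measure (sample n) (\<Union>k\<in>{1..}. B k) \<le> c * (5 / 3) / (real n)\<^sup>2"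
    unfolding eq by simp
qed

end

section \<open>The penalized estimator\<close>

locale penalized_selection = labelled_sample \<mu>
  for \<mu> :: "('a::topological_space \<times> bool) measure" +
  fixes F :: "nat \<Rightarrow> ('a \<Rightarrow> bool) set"
    and fhat :: "nat \<Rightarrow> nat \<Rightarrow> (nat \<Rightarrow> 'a \<times> bool) \<Rightarrow> ('a \<Rightarrow> bool)"
    and khat :: "nat \<Rightarrow> (nat \<Rightarrow> 'a \<times> bool) \<Rightarrow> nat"
  assumes F_cls: "\<And>k. k \<ge> 1 \<Longrightarrow> F k \<subseteq> classifiers"
    and fstar: "\<And>k. k \<ge> 1 \<Longrightarrow> \<exists>f\<in>F k. loss \<mu> f = class_risk \<mu> (F k)"
    and fhat_min: "\<And>n k D. n \<ge> 1 \<Longrightarrow> k \<ge> 1 \<Longrightarrow> D \<in> space (sample n) \<Longrightarrow>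
        fhat n k D \<in> F k \<and> (\<forall>f\<in>F k. emp_loss n D (fhat n k D) \<le> emp_loss n D f)"
    and khat_min: "\<And>n D. n \<ge> 1 \<Longrightarrow> D \<in> space (sample n) \<Longrightarrow>
        khat n D \<ge> 1 \<and>
        (\<forall>k\<ge>1. emp_loss n D (fhat n (khat n D) D) + C_hat F fhat n (khat n D) D
                 \<le> emp_loss n D (fhat n k D) + C_hat F fhat n k D)"
    and meas_loss: "\<And>n k. n \<ge> 1 \<Longrightarrow> k \<ge> 1 \<Longrightarrow>
        (\<lambda>D. loss \<mu> (fhat n k D)) \<in> borel_measurable (sample n)"
    and meas_C: "\<And>n k. n \<ge> 1 \<Longrightarrow> k \<ge> 1 \<Longrightarrow>
        (\<lambda>D. C_hat F fhat n k D) \<in> borel_measurable (sample n)"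
    and meas_khat: "\<And>n. n \<ge> 1 \<Longrightarrow> khat n \<in> sample n \<rightarrow>\<^sub>M count_space UNIV"
    and meas_sup: "\<And>n k. n \<ge> 1 \<Longrightarrow> k \<ge> 1 \<Longrightarrow>
        (\<lambda>D. SUP f\<in>F k. - emp_loss n D f) \<in> borel_measurable (sample n)"
begin

abbreviation selected_loss :: "nat \<Rightarrow> (nat \<Rightarrow> 'a \<times> bool) \<Rightarrow> real" where
  "selected_loss n D \<equiv> loss \<mu> (fhat n (khat n D) D)"

abbreviation oracle_bound :: "nat \<Rightarrow> (nat \<Rightarrow> 'a \<times> bool) \<Rightarrow> real" where
  "oracle_bound n D \<equiv> (INF k\<in>{1..}. class_risk \<mu> (F k) - Bayes_risk \<mu> + 2 * C_hat F fhat n k D)"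

definition target :: "nat \<Rightarrow> 'a \<Rightarrow> bool" where
  "target k = (SOME f. f \<in> F k \<and> loss \<mu> f = class_risk \<mu> (F k))"

lemma target: "target k \<in> F k" "loss \<mu> (target k) = class_risk \<mu> (F k)" "target k \<in> classifiers" if "k \<ge> 1"
proof -
  have "target k \<in> F k \<and> loss \<mu> (target k) = class_risk \<mu> (F k)"
    unfolding target_def
    by (rule someI_ex[of "\<lambda>f. f \<in> F k \<and> loss \<mu> f = class_risk \<mu> (F k)"]) (use fstar[OF that] in blast)
  then show "target k \<in> F k" "loss \<mu> (target k) = class_risk \<mu> (F k)" "target k \<in> classifiers"
    using F_cls[OF that] by auto
qed

lemma class_risk_le: "k \<ge> 1 \<Longrightarrow> f \<in> F k \<Longrightarrow> class_risk \<mu> (F k) \<le> loss \<mu> f"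
  unfolding class_risk_def using loss_bounds by (intro cINF_lower bdd_belowI2[where m = 0]) auto

lemma class_risk_nonneg: "k \<ge> 1 \<Longrightarrow> 0 \<le> class_risk \<mu> (F k)"
  using target(2) loss_bounds(1) by metis

lemma Bayes_risk_le: "k \<ge> 1 \<Longrightarrow> Bayes_risk \<mu> \<le> class_risk \<mu> (F k)"
  unfolding Bayes_risk_def target(2)[symmetric] using loss_bounds target(3)
  by (intro cINF_lower bdd_belowI2[where m = 0]) auto

lemma C_hat_bounds:
  assumes "n \<ge> 1" "k \<ge> 1" "D \<in> space (sample n)"
  shows "0 \<le> C_hat F fhat n k D" "C_hat F fhat n k D \<le> 1"
  using penalty_nonneg[OF assms(1,2)] fhat_min[OF assms] by (auto simp: C_hat_def penalty_def)

lemma selected_loss_measurable: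
  assumes n: "n \<ge> 1"
  shows "selected_loss n \<in> borel_measurable (sample n)"
proof -
  have "(\<lambda>D. loss \<mu> (fhat n (max 1 (khat n D)) D)) \<in> borel_measurable (sample n)"
    using meas_loss[OF n]
    by (intro measurable_compose_countable[where f = "\<lambda>k D. loss \<mu> (fhat n (max 1 k) D)", OF _ meas_khat[OF n]]) auto
  then show ?thesis
    using khat_min[OF n] by (subst measurable_cong[where g = "\<lambda>D. loss \<mu> (fhat n (max 1 (khat n D)) D)"]) (auto simp: max_def)
qed

lemma oracle_event_measurable:
  assumes n: "n \<ge> 1"
  shows "{D \<in> space (sample n). selected_loss n D - Bayes_risk \<mu> \<le> oracle_bound n D} \<in> sets (sample n)"
proof -
  have "selected_loss n D - Bayes_risk \<mu> \<le> oracle_bound n D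
      \<longleftrightarrow> (\<forall>k\<in>{1..}. selected_loss n D - Bayes_risk \<mu> \<le> class_risk \<mu> (F k) - Bayes_risk \<mu> + 2 * C_hat F fhat n k D)"
    if D: "D \<in> space (sample n)" for D
  proof (rule le_cINF_iff)
    show "bdd_below ((\<lambda>k. class_risk \<mu> (F k) - Bayes_risk \<mu> + 2 * C_hat F fhat n k D) ` {1..})"
      using Bayes_risk_le C_hat_bounds(1)[OF n _ D] by (intro bdd_belowI2[where m = 0]) (auto intro: add_nonneg_nonneg)
  qed auto
  then have "{D \<in> space (sample n). selected_loss n D - Bayes_risk \<mu> \<le> oracle_bound n D}
     = {D \<in> space (sample n). \<forall>k\<in>{1..}. selected_loss n D - Bayes_risk \<mu> \<le> class_risk \<mu> (F k) - Bayes_risk \<mu> + 2 * C_hat F fhat n k D}"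
    by blast
  also have "\<dots> = {D \<in> space (sample n). \<forall>k. selected_loss n D - Bayes_risk \<mu>
      \<le> class_risk \<mu> (F (Suc k)) - Bayes_risk \<mu> + 2 * C_hat F fhat n (Suc k) D}"
  proof -
    have "(\<forall>k\<in>{1..}. Q k) \<longleftrightarrow> (\<forall>k. Q (Suc k))" for Q
      by (metis Suc_le_D One_nat_def atLeast_iff le_add1 plus_1_eq_Suc)
    then show ?thesis by presburger
  qed
  also have "\<dots> \<in> sets (sample n)"
  proof (rule sets.sets_Collect_countable_All)
    fix k
    have "(\<lambda>D. class_risk \<mu> (F (Suc k)) - Bayes_risk \<mu> + 2 * C_hat F fhat n (Suc k) D) \<in> borel_measurable (sample n)"
      using meas_C[OF n, of "Suc k"] by (intro borel_measurable_add borel_measurable_times borel_measurable_const) auto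
    moreover have "(\<lambda>D. selected_loss n D - Bayes_risk \<mu>) \<in> borel_measurable (sample n)"
      using selected_loss_measurable[OF n] by (intro borel_measurable_diff borel_measurable_const)
    ultimately show "{D \<in> space (sample n). selected_loss n D - Bayes_risk \<mu>
      \<le> class_risk \<mu> (F (Suc k)) - Bayes_risk \<mu> + 2 * C_hat F fhat n (Suc k) D} \<in> sets (sample n)"
      by (intro borel_measurable_le)
  qed
  finally show ?thesis .
qed

lemma uniform_penalty_event:
  assumes n: "n \<ge> 5"
  obtains B where "B \<in> sets (sample n)" "measure (sample n) B \<le> 22 / (real n)\<^sup>2"
    "\<And>D k. D \<in> space (sample n) - B \<Longrightarrow> k \<ge> 1 \<Longrightarrow>
       loss \<mu> (fhat n k D) \<le> emp_loss n D (fhat n k D) + C_hat F fhat n k D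
       \<and> 2 * loss \<mu> (fhat n k D) \<le> 8 * emp_loss n D (fhat n k D) + 7 * u_hat (F k) n k D"
proof -
  have n1: "n \<ge> 1" using n by simp
  have "\<exists>B. B \<in> sets (sample n) \<and> measure (sample n) B \<le> 5 / (38 / 100) / (real n * real k)\<^sup>2
    \<and> (\<forall>D\<in>space (sample n) - B. loss \<mu> (fhat n k D) \<le> emp_loss n D (fhat n k D) + C_hat F fhat n k D
       \<and> 2 * loss \<mu> (fhat n k D) \<le> 8 * emp_loss n D (fhat n k D) + 7 * u_hat (F k) n k D)"
    if k: "k \<ge> 1" for k
  proof -
    have "F k \<noteq> {}" using target(1)[OF k] by blast
    moreover have "(\<lambda>D. SUP f\<in>F k. - emp_loss (2 * n) D f) \<in> borel_measurable (sample (2 * n))"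
      using n1 k by (intro meas_sup) auto
    ultimately obtain B where B: "B \<in> sets (sample n)" "measure (sample n) B \<le> 5 / (38 / 100) / (real n * real k)\<^sup>2"
      "\<And>D f. D \<in> space (sample n) - B \<Longrightarrow> f \<in> F k \<Longrightarrow> (\<And>g. g \<in> F k \<Longrightarrow> emp_loss n D f \<le> emp_loss n D g) \<Longrightarrow>
       loss \<mu> f \<le> emp_loss n D f + penalty (F k) n k f D \<and> 2 * loss \<mu> f \<le> 8 * emp_loss n D f + 7 * u_hat (F k) n k D"
      using empirical_minimizer_bound[OF n k _ F_cls[OF k]] by metis
    show ?thesis
      using B fhat_min[OF n1 k] by (intro exI[of _ B]) (auto simp: C_hat_def)
  qed
  then obtain B where B: "\<And>k. k \<ge> 1 \<Longrightarrow> B k \<in> sets (sample n)"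
    "\<And>k. k \<ge> 1 \<Longrightarrow> measure (sample n) (B k) \<le> 5 / (38 / 100) / (real n * real k)\<^sup>2"
    "\<And>k D. k \<ge> 1 \<Longrightarrow> D \<in> space (sample n) - B k \<Longrightarrow> loss \<mu> (fhat n k D) \<le> emp_loss n D (fhat n k D) + C_hat F fhat n k D
       \<and> 2 * loss \<mu> (fhat n k D) \<le> 8 * emp_loss n D (fhat n k D) + 7 * u_hat (F k) n k D"
    by metis
  note U = countable_union_bound[of B n "5 / (38 / 100)", OF B(1,2)]
  show ?thesis
  proof (rule that[of "\<Union>k\<in>{1..}. B k"])
    show "(\<Union>k\<in>{1..}. B k) \<in> sets (sample n)" using U(1) by simp
    have "measure (sample n) (\<Union>k\<in>{1..}. B k) \<le> 5 / (38 / 100) * (5 / 3) / (real n)\<^sup>2" using U(2) by simp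
    also have "\<dots> \<le> 22 / (real n)\<^sup>2" by (intro divide_right_mono) auto
    finally show "measure (sample n) (\<Union>k\<in>{1..}. B k) \<le> 22 / (real n)\<^sup>2" .
  qed (use B(3) in auto)
qed

lemma target_upper_event:
  assumes n: "n \<ge> 5"
  obtains S where "S \<in> sets (sample n)" "measure (sample n) S \<le> (5 / 3) / (real n)\<^sup>2"
    "\<And>D k. D \<in> space (sample n) - S \<Longrightarrow> k \<ge> 1 \<Longrightarrow>
       n * emp_loss n D (target k) \<le> n * loss \<mu> (target k)
         + sqrt (8 * ln (real (n * k)) * (n * loss \<mu> (target k))) + 4 * ln (real (n * k))"
proof -
  have n1: "n \<ge> 1" using n by simp
  define S where "S = (\<lambda>k. {D \<in> space (sample n). n * loss \<mu> (target k)
         + sqrt (8 * ln (real (n * k)) * (n * loss \<mu> (target k))) + 4 * ln (real (n * k)) < n * emp_loss n D (target k)})"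
  have S: "S k \<in> sets (sample n)" if "k \<ge> 1" for k
    using emp_loss_measurable[OF target(3)[OF that], of n] unfolding S_def by measurable
  have mS: "measure (sample n) (S k) \<le> 1 / (real n * real k)\<^sup>2" if "k \<ge> 1" for k
    using emp_loss_upper_tail[OF target(3)[OF that] n1, of "ln (real (n * k))"] ln_sample_ge[OF n that] exp_minus_2_ln[OF n1 that]
    by (simp add: S_def)
  note U = countable_union_bound[of S n 1, OF S mS]
  show ?thesis
  proof (rule that[of "\<Union>k\<in>{1..}. S k"])
    show "(\<Union>k\<in>{1..}. S k) \<in> sets (sample n)" using U(1) by simp
    show "measure (sample n) (\<Union>k\<in>{1..}. S k) \<le> (5 / 3) / (real n)\<^sup>2" using U(2) by simp
    fix D k assume "D \<in> space (sample n) - (\<Union>k\<in>{1..}. S k)" "k \<ge> (1::nat)"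
    then have "D \<in> space (sample n)" "D \<notin> S k" by auto
    then show "n * emp_loss n D (target k) \<le> n * loss \<mu> (target k)
         + sqrt (8 * ln (real (n * k)) * (n * loss \<mu> (target k))) + 4 * ln (real (n * k))"
      by (simp add: S_def not_less)
  qed
qed

lemma target_emp_loss_le:
  assumes n: "n \<ge> 5" and k: "k \<ge> 1" and D: "D \<in> space (sample n)"
    and up: "n * emp_loss n D (target k) \<le> n * loss \<mu> (target k)
         + sqrt (8 * ln (real (n * k)) * (n * loss \<mu> (target k))) + 4 * ln (real (n * k))"
    and L: "2 * loss \<mu> (fhat n k D) \<le> 8 * emp_loss n D (fhat n k D) + 7 * u_hat (F k) n k D"
  shows "emp_loss n D (target k) \<le> class_risk \<mu> (F k) + C_hat F fhat n k D"
proof -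
  have n1: "n \<ge> 1" using n by simp
  let ?t = "ln (real (n * k))" and ?f = "fhat n k D" and ?L = "class_risk \<mu> (F k)"
  let ?W = "8 * emp_loss n D ?f + 7 * u_hat (F k) n k D"
  have t: "0 \<le> ?t" using ln_sample_ge[OF n k] by linarith
  have f: "?f \<in> F k" using fhat_min[OF n1 k D] by blast
  have "2 * ?L \<le> ?W" using class_risk_le[OF k f] L by linarith
  then have "8 * ?t * (n * ?L) \<le> (2 * real n)\<^sup>2 * (?t / n * ?W)"
    using t n1 mult_left_mono[of "2 * ?L" ?W "4 * ?t * n"] by (simp add: power2_eq_square algebra_simps)
  then have "sqrt (8 * ?t * (n * ?L)) \<le> sqrt ((2 * real n)\<^sup>2 * (?t / n * ?W))"
    by (rule real_sqrt_le_mono)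
  also have "\<dots> = 2 * real n * (sqrt (?t / n) * sqrt ?W)"
    by (simp only: real_sqrt_mult[of _ "?t / n * ?W"] real_sqrt_mult[of "?t / n"] real_sqrt_abs)
  finally have sq: "sqrt (8 * ?t * (n * ?L)) \<le> 2 * real n * (sqrt (?t / n) * sqrt ?W)" .
  let ?pen = "8 * rademacher n D (F_hat (F k) n k ?f D) + 20 * ?t / n + 2 * sqrt (?t / n) * sqrt ?W"
  have rad: "0 \<le> real n * rademacher n D (F_hat (F k) n k ?f D)"
    using rademacher_nonneg[OF n1 F_hat_nonempty[OF n1 k f]] by simp
  have "n * (emp_loss n D (target k) - ?L) \<le> sqrt (8 * ?t * (n * ?L)) + 4 * ?t"
    using up unfolding target(2)[OF k] by (simp add: algebra_simps)
  also have "\<dots> \<le> 8 * (real n * rademacher n D (F_hat (F k) n k ?f D)) + 20 * ?t + 2 * real n * (sqrt (?t / n) * sqrt ?W)"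
    using sq rad t by linarith
  also have "\<dots> = n * ?pen" using n1 by (simp add: algebra_simps)
  finally have "emp_loss n D (target k) - ?L \<le> ?pen"
    using n1 by (simp only: mult_le_cancel_left_pos of_nat_0_less_iff)
  moreover have "emp_loss n D (target k) - ?L \<le> 1"
    using emp_loss_le_1[of n D "target k"] class_risk_nonneg[OF k] by linarith
  ultimately show ?thesis unfolding C_hat_def penalty_def by linarith
qed

lemma expected_oracle_inequality:
  assumes n: "n \<ge> 1"
  shows "(\<integral>D. selected_loss n D \<partial>sample n) - Bayes_risk \<mu>
    \<le> (INF k\<in>{1..}. class_risk \<mu> (F k) - Bayes_risk \<mu> + (\<integral>D. C_hat F fhat n k D \<partial>sample n)) + 22 / (real n)\<^sup>2"
proof -
  interpret P: prob_space "sample n" by (rule prob_space_sample)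
  have intC: "integrable (sample n) (\<lambda>D. C_hat F fhat n k D)" if "k \<ge> 1" for k
    using meas_C[OF n that] C_hat_bounds[OF n that]
    by (intro P.integrable_const_bound[where B = 1] AE_I2) (auto simp: abs_le_iff intro: order_trans[of _ 0])
  have intL: "integrable (sample n) (selected_loss n)"
    using selected_loss_measurable[OF n] loss_bounds
    by (intro P.integrable_const_bound[where B = 1] AE_I2) auto
  have "(\<integral>D. selected_loss n D \<partial>sample n) \<le> class_risk \<mu> (F k) + (\<integral>D. C_hat F fhat n k D \<partial>sample n) + 22 / (real n)\<^sup>2"
    if k: "k \<ge> 1" for k
  proof (cases "n \<ge> 5")
    case False
    have "(real n)\<^sup>2 \<le> 4\<^sup>2" using False by (intro power_mono) auto
    then have "1 \<le> 22 / (real n)\<^sup>2" using n by (simp add: pos_le_divide_eq)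
    moreover have "(\<integral>D. selected_loss n D \<partial>sample n) \<le> (\<integral>D. 1 \<partial>sample n)"
      using intL loss_bounds by (intro integral_mono) auto
    moreover have "0 \<le> (\<integral>D. C_hat F fhat n k D \<partial>sample n)"
      using C_hat_bounds(1)[OF n k] by (intro integral_nonneg_AE AE_I2) auto
    ultimately show ?thesis using class_risk_nonneg[OF k] by (simp add: P.prob_space)
  next
    case True
    obtain B where B: "B \<in> sets (sample n)" "measure (sample n) B \<le> 22 / (real n)\<^sup>2"
      "\<And>D k. D \<in> space (sample n) - B \<Longrightarrow> k \<ge> 1 \<Longrightarrow>
       loss \<mu> (fhat n k D) \<le> emp_loss n D (fhat n k D) + C_hat F fhat n k D
       \<and> 2 * loss \<mu> (fhat n k D) \<le> 8 * emp_loss n D (fhat n k D) + 7 * u_hat (F k) n k D"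
      by (rule uniform_penalty_event[OF True]) blast
    note intE = emp_loss_integral[OF target(3)[OF k] n]
    have intB: "integrable (sample n) (indicator B :: _ \<Rightarrow> real)"
      using B(1) by (auto simp: less_top[symmetric])
    have "(\<integral>D. selected_loss n D \<partial>sample n) \<le> (\<integral>D. emp_loss n D (target k) + C_hat F fhat n k D + indicator B D \<partial>sample n)"
    proof (rule integral_mono[OF intL])
      show "integrable (sample n) (\<lambda>D. emp_loss n D (target k) + C_hat F fhat n k D + indicator B D)"
        using intE(1) intC[OF k] intB by (intro Bochner_Integration.integrable_add)
      fix D assume D: "D \<in> space (sample n)"
      show "selected_loss n D \<le> emp_loss n D (target k) + C_hat F fhat n k D + indicator B D"
      proof (cases "D \<in> B")
        case True
        then show ?thesis
          using loss_bounds(2)[of "fhat n (khat n D) D"] emp_loss_nonneg[of n D "target k"] C_hat_bounds(1)[OF n k D] by simp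
      next
        case False
        have "selected_loss n D \<le> emp_loss n D (fhat n (khat n D) D) + C_hat F fhat n (khat n D) D"
          using B(3)[of D "khat n D"] D False khat_min[OF n D] by blast
        also have "\<dots> \<le> emp_loss n D (fhat n k D) + C_hat F fhat n k D"
          using khat_min[OF n D] k by blast
        also have "\<dots> \<le> emp_loss n D (target k) + C_hat F fhat n k D"
          using fhat_min[OF n k D] target(1)[OF k] by simp
        finally show ?thesis using False by simp
      qed
    qed
    also have "\<dots> = class_risk \<mu> (F k) + (\<integral>D. C_hat F fhat n k D \<partial>sample n) + measure (sample n) B"
      using intE intC[OF k] intB B(1) target(2)[OF k] by simp
    finally show ?thesis using B(2) by linarith
  qed
  then have "(\<integral>D. selected_loss n D \<partial>sample n) - Bayes_risk \<mu> - 22 / (real n)\<^sup>2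
    \<le> (INF k\<in>{1..}. class_risk \<mu> (F k) - Bayes_risk \<mu> + (\<integral>D. C_hat F fhat n k D \<partial>sample n))"
    by (intro cINF_greatest) (auto simp: algebra_simps)
  then show ?thesis by linarith
qed

lemma oracle_inequality_prob:
  assumes n: "n \<ge> 1"
  shows "measure (sample n) {D \<in> space (sample n). selected_loss n D - Bayes_risk \<mu> \<le> oracle_bound n D} > 1 - 44 / (real n)\<^sup>2"
proof (cases "n \<ge> 5")
  case False
  have "(real n)\<^sup>2 \<le> 4\<^sup>2" using False by (intro power_mono) auto
  then have "1 < 44 / (real n)\<^sup>2" using n by (simp add: pos_less_divide_eq)
  then have "1 - 44 / (real n)\<^sup>2 < 0" by simp
  then show ?thesis using measure_nonneg by (rule less_le_trans)
next
  case True
  interpret P: prob_space "sample n" by (rule prob_space_sample)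
  let ?A = "{D \<in> space (sample n). selected_loss n D - Bayes_risk \<mu> \<le> oracle_bound n D}"
  obtain B where B: "B \<in> sets (sample n)" "measure (sample n) B \<le> 22 / (real n)\<^sup>2"
    "\<And>D k. D \<in> space (sample n) - B \<Longrightarrow> k \<ge> 1 \<Longrightarrow>
     loss \<mu> (fhat n k D) \<le> emp_loss n D (fhat n k D) + C_hat F fhat n k D
     \<and> 2 * loss \<mu> (fhat n k D) \<le> 8 * emp_loss n D (fhat n k D) + 7 * u_hat (F k) n k D"
    by (rule uniform_penalty_event[OF True]) blast
  obtain S where S: "S \<in> sets (sample n)" "measure (sample n) S \<le> (5 / 3) / (real n)\<^sup>2"
    "\<And>D k. D \<in> space (sample n) - S \<Longrightarrow> k \<ge> 1 \<Longrightarrow>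
       n * emp_loss n D (target k) \<le> n * loss \<mu> (target k)
         + sqrt (8 * ln (real (n * k)) * (n * loss \<mu> (target k))) + 4 * ln (real (n * k))"
    by (rule target_upper_event[OF True]) blast
  have "space (sample n) - (B \<union> S) \<subseteq> ?A"
  proof
    fix D assume D: "D \<in> space (sample n) - (B \<union> S)"
    then have D': "D \<in> space (sample n)" by simp
    have "selected_loss n D - Bayes_risk \<mu> \<le> class_risk \<mu> (F k) - Bayes_risk \<mu> + 2 * C_hat F fhat n k D"
      if "k \<in> {1..}" for k
    proof -
      have k: "k \<ge> 1" using that by simp
      have "selected_loss n D \<le> emp_loss n D (fhat n (khat n D) D) + C_hat F fhat n (khat n D) D"
        using B(3)[of D "khat n D"] D khat_min[OF n D'] by blast
      also have "\<dots> \<le> emp_loss n D (fhat n k D) + C_hat F fhat n k D"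
        using khat_min[OF n D'] k by blast
      also have "emp_loss n D (fhat n k D) \<le> emp_loss n D (target k)"
        using fhat_min[OF n k D'] target(1)[OF k] by simp
      also have "emp_loss n D (target k) \<le> class_risk \<mu> (F k) + C_hat F fhat n k D"
        using B(3)[of D k] S(3)[of D k] D k by (intro target_emp_loss_le[OF True k D']) auto
      finally show ?thesis by simp
    qed
    then have "selected_loss n D - Bayes_risk \<mu> \<le> oracle_bound n D"
      by (intro cINF_greatest) auto
    then show "D \<in> ?A" using D' by simp
  qed
  then have "measure (sample n) (space (sample n) - (B \<union> S)) \<le> measure (sample n) ?A"
    using oracle_event_measurable[OF n] by (intro P.finite_measure_mono)
  moreover have "measure (sample n) (space (sample n) - (B \<union> S)) = 1 - measure (sample n) (B \<union> S)"
    using B(1) S(1) by (intro P.prob_compl) auto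
  moreover have "measure (sample n) (B \<union> S) \<le> measure (sample n) B + measure (sample n) S"
    using B(1) S(1) by (intro measure_Un_le) auto
  moreover have "22 / (real n)\<^sup>2 + (5 / 3) / (real n)\<^sup>2 < 44 / (real n)\<^sup>2"
    unfolding add_divide_distrib[symmetric] using n by (intro divide_strict_right_mono) auto
  ultimately show ?thesis using B(2) S(2) by linarith
qed

lemma oracle_inequality_eventually:
  "measure (Pi\<^sub>M UNIV (\<lambda>_::nat. \<mu>))
     {\<omega> \<in> space (Pi\<^sub>M UNIV (\<lambda>_::nat. \<mu>)).
        \<forall>\<^sub>F n in sequentially. selected_loss n (restrict \<omega> {..<n}) - Bayes_risk \<mu> \<le> oracle_bound n (restrict \<omega> {..<n})} = 1"
proof -
  let ?T = "Pi\<^sub>M UNIV (\<lambda>_::nat. \<mu>)"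
  interpret T: prob_space ?T by (intro prob_space_PiM prob_space_axioms)
  define A where "A = (\<lambda>n. {D \<in> space (sample n). selected_loss n D - Bayes_risk \<mu> \<le> oracle_bound n D})"
  have A: "A n \<in> sets (sample n)" if "n \<ge> 1" for n
    unfolding A_def by (rule oracle_event_measurable[OF that])
  have r: "(\<lambda>\<omega>. restrict \<omega> {..<n}) \<in> ?T \<rightarrow>\<^sub>M sample n" for n
    by (rule measurable_restrict_subset) simp
  have d: "distr ?T (sample n) (\<lambda>\<omega>. restrict \<omega> {..<n}) = sample n" for n
    using distr_PiM_reindex[of UNIV "\<lambda>_. \<mu>" "\<lambda>x. x" "{..<n}"] prob_space_axioms by simp
  define Bad where "Bad = (\<lambda>n. (\<lambda>\<omega>. restrict \<omega> {..<Suc n}) -` (space (sample (Suc n)) - A (Suc n)) \<inter> space ?T)"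
  have Bad: "Bad n \<in> sets ?T" for n
    unfolding Bad_def using A[of "Suc n"] by (intro measurable_sets[OF r]) auto
  have mBad: "measure ?T (Bad n) \<le> 44 * (1 / (real (Suc n))\<^sup>2)" for n
  proof -
    interpret P: prob_space "sample (Suc n)" by (rule prob_space_sample)
    have "measure ?T (Bad n) = measure (distr ?T (sample (Suc n)) (\<lambda>\<omega>. restrict \<omega> {..<Suc n})) (space (sample (Suc n)) - A (Suc n))"
      unfolding Bad_def using A[of "Suc n"] by (intro measure_distr[OF r, symmetric]) auto
    also have "\<dots> = 1 - measure (sample (Suc n)) (A (Suc n))"
      unfolding d using A[of "Suc n"] by (intro P.prob_compl) auto
    finally show ?thesis
      using oracle_inequality_prob[of "Suc n"] by (simp add: A_def)
  qed
  have "summable (\<lambda>n. measure ?T (Bad n))"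
    using mBad by (intro summable_comparison_test'[OF summable_mult[OF sum_inverse_squares(1), of 44]]) auto
  then have AE: "AE \<omega> in ?T. eventually (\<lambda>n. \<omega> \<in> space ?T - Bad n) sequentially"
    using Bad by (intro borel_cantelli_AE1) (auto simp: less_top[symmetric])
  let ?G = "\<lambda>\<omega> n. selected_loss n (restrict \<omega> {..<n}) - Bayes_risk \<mu> \<le> oracle_bound n (restrict \<omega> {..<n})"
  have iff: "eventually (\<lambda>n. \<omega> \<in> space ?T - Bad n) sequentially \<longleftrightarrow> eventually (?G \<omega>) sequentially"
    if \<omega>: "\<omega> \<in> space ?T" for \<omega>
  proof -
    have "restrict \<omega> {..<n} \<in> space (sample n)" for n using measurable_space[OF r \<omega>] .
    then have "\<omega> \<in> space ?T - Bad n \<longleftrightarrow> ?G \<omega> (Suc n)" for n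
      using \<omega> by (auto simp: Bad_def A_def)
    then show ?thesis using eventually_sequentially_Suc[of "?G \<omega>"] by simp
  qed
  have ev: "{\<omega> \<in> space ?T. eventually (?G \<omega>) sequentially}
      = {\<omega> \<in> space ?T. eventually (\<lambda>n. \<omega> \<in> space ?T - Bad n) sequentially}"
    using iff by blast
  have m: "{\<omega> \<in> space ?T. eventually (\<lambda>n. \<omega> \<in> space ?T - Bad n) sequentially} \<in> sets ?T"
    unfolding eventually_sequentially
  proof (intro sets.sets_Collect_countable_Ex sets.sets_Collect_countable_All)
    fix N n
    have "{\<omega> \<in> space ?T. N \<le> n \<longrightarrow> \<omega> \<in> space ?T - Bad n} = (if N \<le> n then space ?T - Bad n else space ?T)" by auto
    then show "{\<omega> \<in> space ?T. N \<le> n \<longrightarrow> \<omega> \<in> space ?T - Bad n} \<in> sets ?T" using Bad[of n] by auto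
  qed
  show ?thesis
    unfolding ev by (rule T.prob_Collect_eq_1[OF m, THEN iffD2, OF AE])
qed

end

theorem theorem4p1:
  fixes \<mu> :: "((real ^ ('d::finite)) \<times> bool) measure"
    and F :: "nat \<Rightarrow> ((real ^ 'd) \<Rightarrow> bool) set"
    and fhat :: "nat \<Rightarrow> nat \<Rightarrow> (nat \<Rightarrow> (real ^ 'd) \<times> bool) \<Rightarrow> ((real ^ 'd) \<Rightarrow> bool)"
    and khat :: "nat \<Rightarrow> (nat \<Rightarrow> (real ^ 'd) \<times> bool) \<Rightarrow> nat"
  assumes prob: "prob_space \<mu>"
    and sets_mu: "sets \<mu> = sets (borel \<Otimes>\<^sub>M count_space UNIV)"
    and F_cls: "\<And>k. k \<ge> 1 \<Longrightarrow> F k \<subseteq> classifiers"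
    and fstar: "\<And>k. k \<ge> 1 \<Longrightarrow> \<exists>f\<in>F k. loss \<mu> f = class_risk \<mu> (F k)"
    and fhat_min: "\<And>n k D. n \<ge> 1 \<Longrightarrow> k \<ge> 1 \<Longrightarrow> D \<in> space (Pi\<^sub>M {..<n} (\<lambda>_. \<mu>)) \<Longrightarrow>
        fhat n k D \<in> F k \<and> (\<forall>f\<in>F k. emp_loss n D (fhat n k D) \<le> emp_loss n D f)"
    and khat_min: "\<And>n D. n \<ge> 1 \<Longrightarrow> D \<in> space (Pi\<^sub>M {..<n} (\<lambda>_. \<mu>)) \<Longrightarrow>
        khat n D \<ge> 1 \<and>
        (\<forall>k\<ge>1. emp_loss n D (fhat n (khat n D) D) + C_hat F fhat n (khat n D) D
                 \<le> emp_loss n D (fhat n k D) + C_hat F fhat n k D)"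
    and meas_loss: "\<And>n k. n \<ge> 1 \<Longrightarrow> k \<ge> 1 \<Longrightarrow>
        (\<lambda>D. loss \<mu> (fhat n k D)) \<in> borel_measurable (Pi\<^sub>M {..<n} (\<lambda>_. \<mu>))"
    and meas_C: "\<And>n k. n \<ge> 1 \<Longrightarrow> k \<ge> 1 \<Longrightarrow>
        (\<lambda>D. C_hat F fhat n k D) \<in> borel_measurable (Pi\<^sub>M {..<n} (\<lambda>_. \<mu>))"
    and meas_khat: "\<And>n. n \<ge> 1 \<Longrightarrow>
        khat n \<in> Pi\<^sub>M {..<n} (\<lambda>_. \<mu>) \<rightarrow>\<^sub>M count_space UNIV"
    and meas_sup: "\<And>n k a b. n \<ge> 1 \<Longrightarrow> k \<ge> 1 \<Longrightarrow>
        (\<lambda>D. SUP f\<in>F k. a * loss \<mu> f + b * emp_loss n D f) \<in> borel_measurable (Pi\<^sub>M {..<n} (\<lambda>_. \<mu>))"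
  shows
    "(\<forall>n\<ge>1.
        (\<integral>D. loss \<mu> (fhat n (khat n D) D) \<partial>(Pi\<^sub>M {..<n} (\<lambda>_. \<mu>))) - Bayes_risk \<mu>
          \<le> (INF k\<in>{1..}. class_risk \<mu> (F k) - Bayes_risk \<mu>
                + (\<integral>D. C_hat F fhat n k D \<partial>(Pi\<^sub>M {..<n} (\<lambda>_. \<mu>))))
            + 22 / (real n) ^ 2)
   \<and> (\<forall>n\<ge>1.
        measure (Pi\<^sub>M {..<n} (\<lambda>_. \<mu>))
          {D \<in> space (Pi\<^sub>M {..<n} (\<lambda>_. \<mu>)).
             loss \<mu> (fhat n (khat n D) D) - Bayes_risk \<mu>
               \<le> (INF k\<in>{1..}. class_risk \<mu> (F k) - Bayes_risk \<mu> + 2 * C_hat F fhat n k D)}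
          > 1 - 44 / (real n) ^ 2)
   \<and> measure (Pi\<^sub>M UNIV (\<lambda>_::nat. \<mu>))
       {\<omega> \<in> space (Pi\<^sub>M UNIV (\<lambda>_::nat. \<mu>)).
          \<forall>\<^sub>F n in sequentially.
            loss \<mu> (fhat n (khat n (restrict \<omega> {..<n})) (restrict \<omega> {..<n})) - Bayes_risk \<mu>
              \<le> (INF k\<in>{1..}. class_risk \<mu> (F k) - Bayes_risk \<mu>
                    + 2 * C_hat F fhat n k (restrict \<omega> {..<n}))} = 1"
proof -
  have "penalized_selection \<mu> F fhat khat"
  proof (intro penalized_selection.intro labelled_sample.intro labelled_sample_axioms.intro
      penalized_selection_axioms.intro prob sets_mu F_cls fstar fhat_min khat_min meas_loss meas_C meas_khat)
    fix n k :: nat assume "n \<ge> 1" "k \<ge> 1"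
    from meas_sup[OF this, of 0 "-1"]
    show "(\<lambda>D. SUP f\<in>F k. - emp_loss n D f) \<in> borel_measurable (Pi\<^sub>M {..<n} (\<lambda>_. \<mu>))"
      by simp
  qed
  then interpret penalized_selection \<mu> F fhat khat .
  show ?thesis
    using expected_oracle_inequality oracle_inequality_prob oracle_inequality_eventually by blast
qed

end
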